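(* Let $(X,\rho)$ be a compact metric space, $Y\subset X$ compact, $f\colon X\to X$ a homeomorphism and $\varphi\colon X\to\mathbb{R}$ continuous. Assume that for some $k\ge1$ there is a flip-flop family $\mathfrak{F}$ associated to $\varphi_k$ and $f^k$ having $f$-sojourns along $Y$. Then there is an ergodic $f$-invariant probability measure $\mu$ with $h_\mu(f)>0$, whose support contains $Y$, and such that $\int\varphi\,d\mu=0$.
   Context: $\varphi_n(x)=\frac1n\sum_{i=0}^{n-1}\varphi(f^i(x))$. For a homeomorphism $g$ of $X$ and continuous $\psi\colon X\to\mathbb{R}$, a flip-flop family associated to $\psi$ and $g$ is a family $\mathfrak{F}=\mathfrak{F}^+\sqcup\mathfrak{F}^-$ of compact subsets of $X$ (plaques) for which there are $\alpha>0$ and $\zeta_n\to0^+$ with: (1) $\psi(x)>\alpha$ for all $x$ in a plaque of $\mathfrak{F}^+$ and $\psi(x)<-\alpha$ for all $x$ in a plaque of $\mathfrak{F}^-$; (2) for every $D\in\mathfrak{F}$ there are $D^+\in\mathfrak{F}^+$, $D^-\in\mathfrak{F}^-$ contained in $g(D)$; (3) for every $n>0$ and $D_0,\dots,D_n\in\mathfrak{F}$ with $D_{i+1}\subset g(D_i)$, $\operatorname{diam}(g^{-i}(D_n))\le\zeta_i$ for all $i\in\{0,\dots,n\}$. A flip-flop family $\mathfrak{F}$ associated to $\varphi_k,f^k$ has $f$-sojourns along $Y$ if there is $\eta_n\to0^+$ such that for every $\delta>0$ there is $N$ such that every $D\in\mathfrak{F}$ contains subsets $\widehat D^+,\widehat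 D^-$ with: (i) for every $x\in\widehat D^+\cup\widehat D^-$ the segment $\{x,f(x),\dots,f^N(x)\}$ is $\delta$-dense in $Y$; (ii) $f^N(\widehat D^+)\in\mathfrak{F}^+$ and $f^N(\widehat D^-)\in\mathfrak{F}^-$; (iii) $\operatorname{diam}(f^{-i}(f^N(\widehat D^\pm)))\le\eta_i$ for $i\in\{0,\dots,N\}$. *)

theory Defs
  imports "HOL-Analysis.Analysis" "HOL-Probability.Probability"
begin

definition birkhoff_avg :: "('a \<Rightarrow> 'a) \<Rightarrow> ('a \<Rightarrow> real) \<Rightarrow> nat \<Rightarrow> 'a \<Rightarrow> real" where
  "birkhoff_avg f \<phi> n x = (1 / real n) * (\<Sum>i<n. \<phi> ((f ^^ i) x))"

text \<open>Flip-flop family F = Fp disjoint-union Fm associated to psi and the homeomorphism g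
  of the whole (compact metric) space. g^{-i}(D) is written as the preimage under g^i.\<close>
definition flip_flop_family ::
  "('a::metric_space \<Rightarrow> 'a) \<Rightarrow> ('a \<Rightarrow> real) \<Rightarrow> 'a set set \<Rightarrow> 'a set set \<Rightarrow> bool" where
  "flip_flop_family g \<psi> Fp Fm \<longleftrightarrow>
     Fp \<inter> Fm = {} \<and> Fp \<union> Fm \<noteq> {} \<and>
     (\<forall>D \<in> Fp \<union> Fm. compact D) \<and>
     (\<exists>\<alpha>>0. \<exists>\<zeta>::nat \<Rightarrow> real. (\<forall>n. \<zeta> n > 0) \<and> \<zeta> \<longlonglongrightarrow> 0 \<and>
        (\<forall>D\<in>Fp. \<forall>x\<in>D. \<psi> x > \<alpha>) \<and>
        (\<forall>D\<in>Fm. \<forall>x\<in>D. \<psi> x < - \<alpha>) \<and>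
        (\<forall>D \<in> Fp \<union> Fm. (\<exists>Dp\<in>Fp. Dp \<subseteq> g ` D) \<and> (\<exists>Dm\<in>Fm. Dm \<subseteq> g ` D)) \<and>
        (\<forall>n>0. \<forall>Ds::nat \<Rightarrow> 'a set.
            (\<forall>i\<le>n. Ds i \<in> Fp \<union> Fm) \<and> (\<forall>i<n. Ds (Suc i) \<subseteq> g ` (Ds i)) \<longrightarrow>
            (\<forall>i\<le>n. diameter ((g ^^ i) -` (Ds n)) \<le> \<zeta> i)))"

definition has_sojourns ::
  "('a::metric_space \<Rightarrow> 'a) \<Rightarrow> 'a set \<Rightarrow> 'a set set \<Rightarrow> 'a set set \<Rightarrow> bool" where
  "has_sojourns f Y Fp Fm \<longleftrightarrow>
     (\<exists>\<eta>::nat \<Rightarrow> real. (\<forall>n. \<eta> n > 0) \<and> \<eta> \<longlonglongrightarrow> 0 \<and>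
       (\<forall>\<delta>>0. \<exists>N::nat. \<forall>D \<in> Fp \<union> Fm. \<exists>Dp Dm. Dp \<subseteq> D \<and> Dm \<subseteq> D \<and>
          (\<forall>x \<in> Dp \<union> Dm. \<forall>y\<in>Y. \<exists>i\<le>N. dist ((f ^^ i) x) y < \<delta>) \<and>
          (f ^^ N) ` Dp \<in> Fp \<and> (f ^^ N) ` Dm \<in> Fm \<and>
          (\<forall>i\<le>N. diameter ((f ^^ i) -` ((f ^^ N) ` Dp)) \<le> \<eta> i \<and>
                  diameter ((f ^^ i) -` ((f ^^ N) ` Dm)) \<le> \<eta> i)))"

definition invariant_measure :: "('a::topological_space \<Rightarrow> 'a) \<Rightarrow> 'a measure \<Rightarrow> bool" where
  "invariant_measure f \<mu> \<longleftrightarrow> (\<forall>A \<in> sets borel. measure \<mu> (f -` A) = measure \<mu> A)"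

definition ergodic_measure :: "('a::topological_space \<Rightarrow> 'a) \<Rightarrow> 'a measure \<Rightarrow> bool" where
  "ergodic_measure f \<mu> \<longleftrightarrow>
     (\<forall>A \<in> sets borel. f -` A = A \<longrightarrow> measure \<mu> A = 0 \<or> measure \<mu> A = 1)"

definition measure_support :: "'a::metric_space measure \<Rightarrow> 'a set" where
  "measure_support \<mu> = {x. \<forall>e>0. emeasure \<mu> (ball x e) > 0}"

definition finite_borel_partition :: "'a::topological_space set set \<Rightarrow> bool" where
  "finite_borel_partition P \<longleftrightarrow> finite P \<and> {} \<notin> P \<and> P \<subseteq> sets borel \<and>
     \<Union>P = UNIV \<and> (\<forall>A\<in>P. \<forall>B\<in>P. A \<noteq> B \<longrightarrow> A \<inter> B = {})"

definition partition_entropy :: "'a measure \<Rightarrow> 'a set set \<Rightarrow> real" where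
  "partition_entropy \<mu> P = (\<Sum>A\<in>P. - measure \<mu> A * ln (measure \<mu> A))"

definition iter_join :: "('a \<Rightarrow> 'a) \<Rightarrow> 'a set set \<Rightarrow> nat \<Rightarrow> 'a set set" where
  "iter_join f P n =
     {(\<Inter>i<n. (f ^^ i) -` (c i)) | c. \<forall>i<n. c i \<in> P} - {{}}"

definition partition_entropy_rate :: "'a measure \<Rightarrow> ('a \<Rightarrow> 'a) \<Rightarrow> 'a set set \<Rightarrow> real" where
  "partition_entropy_rate \<mu> f P =
     lim (\<lambda>n. partition_entropy \<mu> (iter_join f P (Suc n)) / real (Suc n))"

definition ks_entropy :: "'a::topological_space measure \<Rightarrow> ('a \<Rightarrow> 'a) \<Rightarrow> ereal" where
  "ks_entropy \<mu> f =
     (SUP P \<in> {P. finite_borel_partition P}. ereal (partition_entropy_rate \<mu> f P))"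

end

theory Submission
  imports Defs "HOL-Complex_Analysis.Great_Picard"
begin

text \<open>
  Let a word be a list of steps \<open>Coin\<close>, \<open>Flip\<close>, \<open>Sojourn\<close>; a coin step moves to a plaque of \<open>Fp\<close> or \<open>Fm\<close>
  according to a random bit, \<open>Flip True\<close> and \<open>Flip False\<close> move to a prescribed one. \<open>Plus\<close> and \<open>Minus\<close>
  are a coin step followed by enough flips of one sign to outweigh it. For a word \<open>w\<close> let \<open>U w\<close> be the
  mean over the bits of the supremum of the Birkhoff sums of the points following \<open>w\<close>, and \<open>L w\<close> a
  lower bound of these sums. Put
  \<open>w' = w^q Sojourn^p Minus^(m p) Plus^(r p)\<close> with \<open>p\<close> the length of \<open>w\<close>, \<open>q\<close> huge and \<open>r\<close> maximal with
  \<open>U w' \<le> 0\<close>; then \<open>U w'\<close> is almost \<open>0\<close>. Each \<open>Plus\<close> raises \<open>L\<close>, and \<open>L \<le> U \<le> 0\<close>, so the proportions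
  of the fillers in the iterated construction are summable although \<open>r\<close> is not controlled directly.

  The invariant measures on (point, bits, odometer phase) for which the bits are fair and independent
  of the phases, and for which points follow the words prescribed by the phases, form a closed face of
  the invariant measures. On it the integral of \<open>\<phi>\<close> is at most \<open>0\<close> by \<open>U \<le> 0\<close>, and it attains \<open>0\<close> since
  \<open>U w / p\<close> tends to \<open>0\<close>. The maximizers are again a closed face, hence contain an ergodic measure.
  Its projection to the space has a support containing \<open>Y\<close> because of the sojourns, and positive
  entropy because the orbit reveals independent bits with positive frequency.
\<close>

section \<open>Weak limits on compact metric spaces\<close>

text \<open>The bits must stay independent of everything that decides the course of a word. If the
  fillers reacted to the bits already drawn, the drift could be cancelled orbit by orbit, but word
  lengths would vary with the bits and the bits would no longer be fair given the phases. Hence one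
  word serves all bit patterns, \<open>r\<close> is fixed by a mean over them, and only this mean is
  controlled. The supremum over the points is taken before the mean because this makes
  \<open>U\<close> subadditive under concatenation. The control is one-sided: the integral is at
  most \<open>0\<close> for every coded measure, and \<open>0\<close> is reached only in the limit
  of the levels.

  Selecting an ergodic measure requires that conditioning on an invariant set preserves the law of
  bits and phases. It does, because disjoint time translates of a bit pattern are uncorrelated,
  while their correlation with an invariant set does not depend on the translate.\<close>

definition probs_on :: "'e::metric_space set \<Rightarrow> 'e measure set" where
  "probs_on K = {P. sets P = sets borel \<and> prob_space P \<and> measure P K = 1}"

definition weak_lim :: "(nat \<Rightarrow> 'e::metric_space measure) \<Rightarrow> 'e measure \<Rightarrow> bool" where
  "weak_lim P Q \<longleftrightarrow> (\<forall>g::'e \<Rightarrow> real. continuous_on UNIV g \<and> bounded (range g) \<longrightarrow>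
     (\<lambda>n. \<integral>x. g x \<partial>P n) \<longlonglongrightarrow> (\<integral>x. g x \<partial>Q))"

text \<open>One countable family of balls, taken from \<open>1 / Suc j\<close>-nets of
  \<open>K\<close>, serves two purposes: it is a base at the points of \<open>K\<close>, which
  identifies measures, and finitely many of its members tell distant points of \<open>K\<close>
  apart, which codes points by bits.\<close>

lemma compact_countable_balls:
  fixes K :: "'e::metric_space set"
  assumes "compact K"
  obtains a :: "nat \<Rightarrow> 'e" and r :: "nat \<Rightarrow> real" where
    "\<And>x e. x \<in> K \<Longrightarrow> e > 0 \<Longrightarrow> \<exists>m. x \<in> ball (a m) (r m) \<and> ball (a m) (r m) \<subseteq> ball x e"
    "\<And>e. e > 0 \<Longrightarrow> \<exists>n. \<forall>x\<in>K. \<forall>y\<in>K. (\<forall>m<n. x \<in> ball (a m) (r m) \<longleftrightarrow> y \<in> ball (a m) (r m)) \<longrightarrow> dist x y < e"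
proof -
  have "\<exists>F. finite F \<and> K \<subseteq> (\<Union>x\<in>F. ball x (1 / Suc j))" for j :: nat
    using assms unfolding compact_eq_totally_bounded by (elim conjE allE[of _ "1 / Suc j"]) simp
  then obtain F where F: "\<And>j::nat. finite (F j)" "\<And>j. K \<subseteq> (\<Union>x\<in>F j. ball x (1 / Suc j))"
    by metis
  \<comment> \<open>The extra pair makes \<open>I\<close> nonempty also when \<open>K\<close> is
    empty, so that it can be enumerated; its ball of radius 0 is empty.\<close>
  define I where "I = insert (undefined, 0) (SIGMA x:(\<Union>j. F j). range (\<lambda>j. 1 / real (Suc j)))"
  have cI: "countable I" "I \<noteq> {}"
    unfolding I_def using F(1) by (auto intro!: countable_SIGMA simp: countable_finite)
  define b where "b = from_nat_into I"
  have rb: "range b = I" using cI unfolding b_def by (simp add: range_from_nat_into)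
  define a where "a m = fst (b m)" for m
  define r where "r m = snd (b m)" for m
  have ex: "\<exists>m. a m = c \<and> r m = 1 / real (Suc j)" if "c \<in> F j" for c j
  proof -
    have "(c, 1 / real (Suc j)) \<in> I" using that unfolding I_def by auto
    then obtain m where "b m = (c, 1 / real (Suc j))" using rb by (metis rangeE)
    then show ?thesis unfolding a_def r_def by (intro exI[of _ m]) simp
  qed
  have net: "\<exists>j::nat. 2 / real (Suc j) < e" if "e > 0" for e :: real
    using reals_Archimedean[of "e/2"] that by (auto simp: field_simps inverse_eq_divide)
  show ?thesis
  proof
    fix x e assume x: "x \<in> K" and e: "(e::real) > 0"
    obtain j :: nat where j: "2 / real (Suc j) < e" using net[OF e] by auto
    obtain c where c: "c \<in> F j" "x \<in> ball c (1 / Suc j)" using F(2)[of j] x by auto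
    obtain m where m: "a m = c" "r m = 1 / real (Suc j)" using ex[OF c(1)] by auto
    have "ball c (1 / Suc j) \<subseteq> ball x e"
    proof
      fix y assume "y \<in> ball c (1 / Suc j)"
      then have "dist x y < 1 / Suc j + 1 / Suc j"
        using c(2) dist_triangle[of x y c] by (simp add: dist_commute)
      then show "y \<in> ball x e" using j by auto
    qed
    then show "\<exists>m. x \<in> ball (a m) (r m) \<and> ball (a m) (r m) \<subseteq> ball x e" using m c by (intro exI[of _ m]) auto
  next
    fix e :: real assume e: "e > 0"
    obtain j :: nat where j: "2 / real (Suc j) < e" using net[OF e] by auto
    have "\<forall>c\<in>F j. \<exists>m. a m = c \<and> r m = 1 / real (Suc j)" using ex by auto
    then obtain h where h: "\<And>c. c \<in> F j \<Longrightarrow> a (h c) = c \<and> r (h c) = 1 / real (Suc j)" by metis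
    obtain n where n: "\<And>c. c \<in> F j \<Longrightarrow> h c < n"
      using finite_nat_set_iff_bounded[of "h ` F j"] F(1) by auto
    have "dist x y < e" if xK: "x \<in> K" and "y \<in> K" and
      xy: "\<forall>m<n. x \<in> ball (a m) (r m) \<longleftrightarrow> y \<in> ball (a m) (r m)" for x y
    proof -
      obtain c where c: "c \<in> F j" "x \<in> ball c (1 / Suc j)" using F(2)[of j] xK by blast
      have "y \<in> ball c (1 / Suc j)" using xy n[OF c(1)] h[OF c(1)] c(2) by metis
      then have "dist x y < 1 / Suc j + 1 / Suc j"
        using c(2) dist_triangle[of x y c] by (simp add: dist_commute)
      then show ?thesis using j by auto
    qed
    then show "\<exists>n. \<forall>x\<in>K. \<forall>y\<in>K. (\<forall>m<n. x \<in> ball (a m) (r m) \<longleftrightarrow> y \<in> ball (a m) (r m)) \<longrightarrow> dist x y < e"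
      by blast
  qed
qed

text \<open>The newest answer stands at the head, so refining a cylinder means prepending one bit
  and the tail is the coarser itinerary. The same function names orbits later, with
  \<open>U i\<close> the preimage of one set under \<open>f ^^ i\<close>.\<close>

primrec itinerary :: "(nat \<Rightarrow> 'e set) \<Rightarrow> nat \<Rightarrow> 'e \<Rightarrow> bool list" where
  "itinerary U 0 x = []"
| "itinerary U (Suc n) x = (x \<in> U n) # itinerary U n x"

lemma length_itinerary [simp]: "length (itinerary U n x) = n"
  by (induction n) auto

lemma itinerary_eq_iff: "itinerary U n x = itinerary U n y \<longleftrightarrow> (\<forall>m<n. x \<in> U m \<longleftrightarrow> y \<in> U m)"
  by (induction n) (auto simp: less_Suc_eq)

lemma itinerary_borel:
  assumes "\<And>i. U i \<in> sets borel"
  shows "{x. itinerary U n x = s} \<in> sets borel"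
proof (induction n arbitrary: s)
  case (Suc n)
  show ?case
  proof (cases s)
    case (Cons b s')
    have "{x. itinerary U (Suc n) x = s} = (if b then U n else - U n) \<inter> {x. itinerary U n x = s'}"
      using Cons by auto
    then show ?thesis using assms[of n] Suc by auto
  qed auto
qed (auto simp: eq_commute[of "[]"])

lemma finite_length_bool: "finite {s :: bool list. length s = n}"
  using finite_lists_length_eq[of "UNIV::bool set" n] by simp

lemma (in prob_space) integral_finite_valued:
  fixes h :: "'b \<Rightarrow> real"
  assumes S: "finite S" "\<And>x. x \<in> space M \<Longrightarrow> d x \<in> S" and m: "\<And>s. s \<in> S \<Longrightarrow> {x \<in> space M. d x = s} \<in> sets M"
  shows "integrable M (\<lambda>x. h (d x))" "(\<integral>x. h (d x) \<partial>M) = (\<Sum>s\<in>S. h s * measure M {x \<in> space M. d x = s})"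
proof -
  let ?f = "\<lambda>x. \<Sum>s\<in>S. h s * indicator {x \<in> space M. d x = s} x"
  have eq: "h (d x) = ?f x" if "x \<in> space M" for x
  proof -
    have "?f x = (\<Sum>s\<in>S. if s = d x then h s else 0)"
      using that by (intro sum.cong) (auto simp: indicator_def)
    then show ?thesis using S that by simp
  qed
  have i: "integrable M (\<lambda>x. h s * indicator {x \<in> space M. d x = s} x)" if "s \<in> S" for s
    using m[OF that] by (intro integrable_mult_right integrable_real_indicator) (auto simp: emeasure_eq_measure)
  have "integrable M ?f" using i by auto
  then show "integrable M (\<lambda>x. h (d x))" using eq by (subst Bochner_Integration.integrable_cong[OF refl eq]) auto
  have "(\<integral>x. h (d x) \<partial>M) = (\<integral>x. ?f x \<partial>M)" using eq by (intro Bochner_Integration.integral_cong) auto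
  also have "\<dots> = (\<Sum>s\<in>S. \<integral>x. h s * indicator {x \<in> space M. d x = s} x \<partial>M)"
    using i by (intro Bochner_Integration.integral_sum) auto
  also have "\<dots> = (\<Sum>s\<in>S. h s * measure M {x \<in> space M. d x = s})"
    using m by (intro sum.cong) (auto simp: Int_absorb1 intro!: arg_cong[of _ _ "measure M"])
  finally show "(\<integral>x. h (d x) \<partial>M) = (\<Sum>s\<in>S. h s * measure M {x \<in> space M. d x = s})" .
qed

lemma (in prob_space) abs_integral_le_AE:
  fixes h :: "'a \<Rightarrow> real"
  assumes "integrable M h" "AE x in M. \<bar>h x\<bar> \<le> e"
  shows "\<bar>\<integral>x. h x \<partial>M\<bar> \<le> e"
proof -
  have "AE x in M. h x \<le> e" "AE x in M. - e \<le> h x" using assms(2) by (auto elim: eventually_mono)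
  then show ?thesis using integral_le_const[OF assms(1)] integral_ge_const[OF assms(1)] by (simp add: abs_le_iff) fastforce
qed

text \<open>\<open>q s\<close> is the mass of the cylinder \<open>s\<close>; these cylinders correspond to consecutive intervals of
  length \<open>q s\<close> in the unit interval. Weak limits are obtained as images of Lebesgue measure under this code.\<close>

primrec cut :: "(bool list \<Rightarrow> real) \<Rightarrow> bool list \<Rightarrow> real" where
  "cut q [] = 0"
| "cut q (b # s) = cut q s + (if b then q (False # s) else 0)"

primrec quantile_code :: "(bool list \<Rightarrow> real) \<Rightarrow> nat \<Rightarrow> real \<Rightarrow> bool list" where
  "quantile_code q 0 u = []"
| "quantile_code q (Suc n) u =
     (cut q (quantile_code q n u) + q (False # quantile_code q n u) \<le> u) # quantile_code q n u"

lemma length_quantile_code [simp]: "length (quantile_code q n u) = n"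
  by (induction n) auto

context
  fixes q :: "bool list \<Rightarrow> real"
  assumes q1: "q [] = 1" and q0: "\<And>s. q s \<ge> 0" and qs: "\<And>s. q s = q (True # s) + q (False # s)"
begin

lemma quantile_code_interval:
  "0 \<le> u \<Longrightarrow> u < 1 \<Longrightarrow> cut q (quantile_code q n u) \<le> u \<and> u < cut q (quantile_code q n u) + q (quantile_code q n u)"
proof (induction n)
  case 0
  then show ?case using q1 by simp
next
  case (Suc n)
  then show ?case using qs[of "quantile_code q n u"] by auto
qed

lemma cut_Cons_subset: "{cut q (b # s) ..< cut q (b # s) + q (b # s)} \<subseteq> {cut q s ..< cut q s + q s}"
  using qs[of s] q0[of "True # s"] q0[of "False # s"] by (cases b) auto

lemma cut_subset_unit: "{cut q s ..< cut q s + q s} \<subseteq> {0..<1}"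
proof (induction s)
  case Nil
  then show ?case using q1 by simp
next
  case (Cons b s)
  then show ?case using cut_Cons_subset[of b s] by blast
qed

lemma quantile_codeI: "u \<in> {cut q s ..< cut q s + q s} \<Longrightarrow> quantile_code q (length s) u = s"
proof (induction s)
  case (Cons b s)
  have "u \<in> {cut q s ..< cut q s + q s}" using Cons.prems cut_Cons_subset by blast
  then show ?case using Cons qs[of s] by (cases b) auto
qed simp

lemma quantile_code_preimage:
  assumes "length s = n"
  shows "{u \<in> {0..<1}. quantile_code q n u = s} = {cut q s ..< cut q s + q s}"
  using quantile_codeI[of _ s] quantile_code_interval[of _ n] cut_subset_unit[of s] assms by fastforce

end

text \<open>Sequential Prokhorov theorem for measures living on \<open>K\<close>. Along a
  subsequence all cylinder masses converge; the limits \<open>q\<close> are additive and thus the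
  law of a random code, and chosen points of \<open>K\<close> with longer and longer codes converge.
  The limit point may lie on the boundary of its balls and have another itinerary, so the limit
  measure need not give the cylinders the masses \<open>q\<close>; it is enough that points of
  \<open>K\<close> sharing an itinerary are close.\<close>

lemma weak_seq_compact:
  fixes K :: "'e::metric_space set" and P :: "nat \<Rightarrow> 'e measure"
  assumes K: "compact K" and P: "\<And>n. P n \<in> probs_on K"
  obtains k Q where "strict_mono k" "Q \<in> probs_on K" "weak_lim (P \<circ> k) Q"
proof -
  obtain a :: "nat \<Rightarrow> 'e" and r where
    ar: "\<And>e. e > 0 \<Longrightarrow> \<exists>n. \<forall>x\<in>K. \<forall>y\<in>K. (\<forall>m<n. x \<in> ball (a m) (r m) \<longleftrightarrow> y \<in> ball (a m) (r m)) \<longrightarrow> dist x y < e"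
    using compact_countable_balls[OF K] by metis
  define U where "U m = ball (a m) (r m)" for m
  have oU: "open (U m)" for m unfolding U_def by simp
  have sep: "\<exists>n. \<forall>x\<in>K. \<forall>y\<in>K. itinerary U n x = itinerary U n y \<longrightarrow> dist x y < e" if "e > 0" for e
    using ar[OF that] unfolding itinerary_eq_iff U_def .
  have Pp: "prob_space (P n)" "sets (P n) = sets borel" "measure (P n) K = 1" for n
    using P[of n] unfolding probs_on_def by auto
  have spP: "space (P n) = UNIV" for n using sets_eq_imp_space_eq[OF Pp(2)] by simp
  have PK: "AE x in P n. x \<in> K" for n
    using Pp[of n] K prob_space.AE_in_set_eq_1[of "P n" K] by (simp add: borel_compact)
  have im: "{x. itinerary U n x = s} \<in> sets (P N)" for n s N
    unfolding Pp(2) by (rule itinerary_borel[OF borel_open[OF oU]])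
  define qN where "qN N s = measure (P N) {x. itinerary U (length s) x = s}" for N s
  have cnt: "countable (UNIV :: bool list set)" by simp
  have bnd: "norm (qN N s) \<le> 1" for N s
    unfolding qN_def using Pp(1) by (simp add: prob_space.prob_le_1)
  \<comment> \<open>Diagonal extraction over the countably many words.\<close>
  obtain k where k: "strict_mono (k::nat\<Rightarrow>nat)" "\<And>s. \<exists>l. (\<lambda>n. qN (k n) s) \<longlonglongrightarrow> l"
    using function_convergent_subsequence[OF cnt, of qN 1] bnd by auto
  then obtain q where q: "\<And>s. (\<lambda>n. qN (k n) s) \<longlonglongrightarrow> q s" by metis
  have q1: "q [] = 1"
  proof -
    have "qN (k n) [] = 1" for n unfolding qN_def using prob_space.prob_space[OF Pp(1)] spP by simp
    then show ?thesis using q[of "[]"] LIMSEQ_unique[OF _ tendsto_const] by fastforce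
  qed
  have q0: "q s \<ge> 0" for s
    by (rule LIMSEQ_le_const[OF q]) (auto simp: qN_def)
  have qs: "q s = q (True # s) + q (False # s)" for s
  proof -
    have "qN N s = qN N (True # s) + qN N (False # s)" for N
    proof -
      interpret prob_space "P N" by (rule Pp)
      have e: "{x. itinerary U (length s) x = s} =
          {x. itinerary U (length (True # s)) x = True # s} \<union> {x. itinerary U (length (False # s)) x = False # s}"
        by auto
      have m: "{x. itinerary U (length (b # s)) x = b # s} \<in> sets (P N)" for b
        by (rule im)
      show ?thesis unfolding qN_def e by (rule finite_measure_Union[OF m m]) auto
    qed
    then have "(\<lambda>n. qN (k n) s) \<longlonglongrightarrow> q (True # s) + q (False # s)"
      using tendsto_add[OF q[of "True # s"] q[of "False # s"]] by simp
    then show ?thesis using q[of s] LIMSEQ_unique by blast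
  qed
  have ne: "\<exists>x\<in>K. itinerary U (length s) x = s" if "q s > 0" for s
  proof (rule ccontr)
    assume "\<not> ?thesis"
    then have "AE x in P N. x \<notin> {x. itinerary U (length s) x = s}" for N using PK[of N] by (auto elim: eventually_mono)
    then have "qN N s = 0" for N
      unfolding qN_def using im by (subst measure_eq_0_null_sets) (auto simp: AE_iff_null_sets)
    then show False using q[of s] that LIMSEQ_unique[OF _ tendsto_const] by fastforce
  qed
  obtain x0 where x0: "x0 \<in> K" using ne[of "[]"] q1 by auto
  \<comment> \<open>The default \<open>x0\<close> is only met with weight 0: a word not realized in
    \<open>K\<close> has mass 0 under every \<open>P N\<close>, hence in the limit.\<close>
  define pt where "pt s = (if \<exists>x\<in>K. itinerary U (length s) x = s then (SOME x. x \<in> K \<and> itinerary U (length s) x = s) else x0)" for s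
  have ptK: "pt s \<in> K" for s
    unfolding pt_def using x0 someI_ex[of "\<lambda>x. x \<in> K \<and> itinerary U (length s) x = s"] by (auto simp: Bex_def)
  have pt: "itinerary U (length s) (pt s) = s" if "\<exists>x\<in>K. itinerary U (length s) x = s" for s
    unfolding pt_def using that someI_ex[of "\<lambda>x. x \<in> K \<and> itinerary U (length s) x = s"] by (auto simp: Bex_def)
  define L where "L = restrict_space lborel {0..<1::real}"
  have spL: "space L = {0..<1}" unfolding L_def by (simp add: space_restrict_space)
  interpret L: prob_space L
    unfolding L_def by (rule prob_space_restrict_space) auto
  let ?c = "quantile_code q"
  have cpos: "q (?c n u) > 0" if "u \<in> {0..<1}" for n u
    using quantile_code_interval[OF q1 q0 qs, of u n] that by auto
  have cm: "{u \<in> space L. ?c n u = s} \<in> sets L" if "length s = n" for n s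
    unfolding spL quantile_code_preimage[OF q1 q0 qs that] unfolding L_def
    using cut_subset_unit[OF q1 q0 qs, of s] by (auto simp: sets_restrict_space_iff)
  have cL: "measure L {u \<in> space L. ?c n u = s} = q s" if "length s = n" for n s
    unfolding spL quantile_code_preimage[OF q1 q0 qs that] unfolding L_def
    using cut_subset_unit[OF q1 q0 qs, of s] q0[of s] by (subst measure_restrict_space) auto
  define X where "X n u = pt (?c n u)" for n u
  have drop: "itinerary U n (X m u) = ?c n u" if "u \<in> {0..<1}" "n \<le> m" for n m u
    using that(2)
  proof (induction n rule: inc_induct)
    case base
    then show ?case using pt[OF ne[OF cpos[OF that(1), of m]]] unfolding X_def by simp
  next
    case (step n)
    then show ?case by simp
  qed
  have XK: "X n u \<in> K" for n u unfolding X_def by (rule ptK)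
  have Xclose: "\<exists>n0. \<forall>u\<in>{0..<1}. \<forall>n\<ge>n0. \<forall>m\<ge>n0. dist (X n u) (X m u) < e" if e: "e > 0" for e
  proof -
    obtain n0 where "\<And>x y. x \<in> K \<Longrightarrow> y \<in> K \<Longrightarrow> itinerary U n0 x = itinerary U n0 y \<Longrightarrow> dist x y < e"
      using sep[OF e] by blast
    then show ?thesis using drop XK by (intro exI[of _ n0]) simp
  qed
  have "\<exists>x\<in>K. (\<lambda>n. X n u) \<longlonglongrightarrow> x" if "u \<in> {0..<1}" for u
  proof -
    have "Cauchy (\<lambda>n. X n u)"
    proof (rule metric_CauchyI)
      fix e :: real assume "e > 0"
      then obtain n0 where "\<forall>u\<in>{0..<1}. \<forall>n\<ge>n0. \<forall>m\<ge>n0. dist (X n u) (X m u) < e"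
        using Xclose by metis
      then show "\<exists>M. \<forall>m\<ge>M. \<forall>n\<ge>M. dist (X m u) (X n u) < e"
        using that by (intro exI[of _ n0]) simp
    qed
    then show ?thesis
      using compact_imp_complete[OF K, unfolded complete_def, rule_format, of "\<lambda>n. X n u"] XK by simp
  qed
  then obtain Z where Z: "\<And>u. u \<in> {0..<1} \<Longrightarrow> Z u \<in> K" "\<And>u. u \<in> {0..<1} \<Longrightarrow> (\<lambda>n. X n u) \<longlonglongrightarrow> Z u"
    by metis
  have Xm: "X n \<in> borel_measurable L" for n
  proof (rule measurableI)
    fix A :: "'e set" assume "A \<in> sets borel"
    have "X n -` A \<inter> space L = (\<Union>s\<in>{s. length s = n \<and> pt s \<in> A}. {u \<in> space L. ?c n u = s})"
      unfolding X_def by auto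
    also have "\<dots> \<in> sets L"
      using cm by (intro sets.finite_UN finite_subset[OF _ finite_length_bool[of n]]) auto
    finally show "X n -` A \<inter> space L \<in> sets L" .
  qed auto
  have Zm: "Z \<in> borel_measurable L"
    by (rule borel_measurable_LIMSEQ_metric[of X, OF Xm]) (use Z spL in auto)
  define Q where "Q = distr L borel Z"
  have Qs: "sets Q = sets borel" unfolding Q_def by simp
  have Qp: "prob_space Q" unfolding Q_def by (rule L.prob_space_distr[OF Zm])
  have "measure Q K = measure L (Z -` K \<inter> space L)"
    unfolding Q_def using Zm K by (intro measure_distr) (auto simp: borel_compact)
  also have "Z -` K \<inter> space L = space L" using Z spL by auto
  finally have "measure Q K = 1" using L.prob_space by simp
  then have QK: "Q \<in> probs_on K" unfolding probs_on_def using Qs Qp by auto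
  have "(\<lambda>n. \<integral>x. g x \<partial>P (k n)) \<longlonglongrightarrow> (\<integral>x. g x \<partial>Q)"
    if g: "continuous_on UNIV g" "bounded (range g)" for g :: "'e \<Rightarrow> real"
  proof (rule LIMSEQ_I)
    fix e :: real assume e: "e > 0"
    obtain B where B: "\<And>x. \<bar>g x\<bar> \<le> B" using g(2) by (auto simp: bounded_iff)
    have gm: "g \<in> borel_measurable borel" using g(1) by (rule borel_measurable_continuous_onI)
    have "uniformly_continuous_on K g"
      using compact_uniformly_continuous[OF continuous_on_subset[OF g(1)] K] by auto
    then obtain d where d: "d > 0" "\<And>x y. x \<in> K \<Longrightarrow> y \<in> K \<Longrightarrow> dist x y < d \<Longrightarrow> dist (g x) (g y) < e/4"
      unfolding uniformly_continuous_on_def by (metis divide_pos_pos e zero_less_numeral)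
    obtain n where n: "\<And>x y. x \<in> K \<Longrightarrow> y \<in> K \<Longrightarrow> itinerary U n x = itinerary U n y \<Longrightarrow> dist x y < d"
      using sep[OF d(1)] by blast
    let ?S = "{s :: bool list. length s = n}"
    \<comment> \<open>\<open>?T\<close> integrates \<open>g\<close> after replacing each point by
      the representative of its cylinder. It approximates the integrals for all \<open>P N\<close>
      and for \<open>Q\<close> with the same error, and as a finite sum it converges.\<close>
    let ?T = "\<lambda>q. \<Sum>s\<in>?S. g (pt s) * q s"
    have PN: "\<bar>(\<integral>x. g x \<partial>P N) - ?T (qN N)\<bar> \<le> e/4" for N
    proof -
      interpret prob_space "P N" by (rule Pp)
      have gi: "integrable (P N) g"
        using B gm Pp(2) by (intro integrable_const_bound[of _ B]) (auto cong: measurable_cong_sets)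
      have iv: "integrable (P N) (\<lambda>x. g (pt (itinerary U n x)))"
        "(\<integral>x. g (pt (itinerary U n x)) \<partial>P N) = (\<Sum>s\<in>?S. g (pt s) * measure (P N) {x \<in> space (P N). itinerary U n x = s})"
        using integral_finite_valued[OF finite_length_bool, of "itinerary U n" n "\<lambda>s. g (pt s)"]
          im[of n _ N] spP by auto
      have "(\<Sum>s\<in>?S. g (pt s) * measure (P N) {x \<in> space (P N). itinerary U n x = s}) = ?T (qN N)"
        unfolding qN_def spP by (intro sum.cong) auto
      moreover have "AE x in P N. \<bar>g x - g (pt (itinerary U n x))\<bar> \<le> e/4"
      proof (rule AE_mp[OF PK[of N]], rule AE_I2, rule impI)
        fix x assume "x \<in> K"
        then have "itinerary U n (pt (itinerary U n x)) = itinerary U n x"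
          using pt[of "itinerary U n x"] by auto
        then have "dist x (pt (itinerary U n x)) < d" using n[OF \<open>x \<in> K\<close> ptK] by metis
        then show "\<bar>g x - g (pt (itinerary U n x))\<bar> \<le> e/4"
          using d(2)[OF \<open>x \<in> K\<close> ptK] by (metis dist_real_def less_imp_le)
      qed
      ultimately show ?thesis
        using abs_integral_le_AE[OF Bochner_Integration.integrable_diff[OF gi iv(1)], of "e/4"]
        unfolding Bochner_Integration.integral_diff[OF gi iv(1)] iv(2) by simp
    qed
    have QT: "\<bar>(\<integral>x. g x \<partial>Q) - ?T q\<bar> \<le> e/4"
    proof -
      have i1: "(\<integral>x. g x \<partial>Q) = (\<integral>u. g (Z u) \<partial>L)"
        unfolding Q_def by (rule integral_distr[OF Zm gm])
      have gi: "integrable L (\<lambda>u. g (Z u))"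
        using B gm Zm by (intro L.integrable_const_bound[of _ B]) auto
      have iv: "integrable L (\<lambda>x. g (pt (?c n x)))"
        "(\<integral>x. g (pt (?c n x)) \<partial>L) = (\<Sum>s\<in>?S. g (pt s) * measure L {x \<in> space L. ?c n x = s})"
        using L.integral_finite_valued[OF finite_length_bool, of "?c n" n "\<lambda>s. g (pt s)"] cm[of _ n] by auto
      have "(\<Sum>s\<in>?S. g (pt s) * measure L {x \<in> space L. ?c n x = s}) = ?T q"
        using cL[of _ n] by (intro sum.cong) auto
      moreover have "\<bar>g (Z u) - g (pt (?c n u))\<bar> \<le> e/4" if "u \<in> space L" for u
      proof -
        have u: "u \<in> {0..<1}" using that spL by auto
        \<comment> \<open>\<open>Z u\<close> itself may have a different itinerary, so it is
          compared through the points \<open>X m u\<close>, whose first \<open>n\<close> answers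
          agree with those of \<open>X n u\<close> once \<open>m \<ge> n\<close>.\<close>
        have "(\<lambda>m. g (X m u)) \<longlonglongrightarrow> g (Z u)"
          using continuous_on_tendsto_compose[OF g(1) Z(2)[OF u]] by auto
        then have "(\<lambda>m. \<bar>g (X m u) - g (X n u)\<bar>) \<longlonglongrightarrow> \<bar>g (Z u) - g (X n u)\<bar>"
          by (intro tendsto_intros)
        moreover have "\<bar>g (X m u) - g (X n u)\<bar> \<le> e/4" if "m \<ge> n" for m
          using d(2)[OF XK XK n[OF XK XK]] drop[OF u that] drop[OF u order.refl, of n]
          by (metis dist_real_def less_imp_le)
        ultimately show ?thesis unfolding X_def by (intro LIMSEQ_le_const2) (auto simp: X_def)
      qed
      then have "AE u in L. \<bar>g (Z u) - g (pt (?c n u))\<bar> \<le> e/4" by auto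
      ultimately show ?thesis
        using L.abs_integral_le_AE[OF Bochner_Integration.integrable_diff[OF gi iv(1)], of "e/4"]
        unfolding Bochner_Integration.integral_diff[OF gi iv(1)] iv(2) i1 by simp
    qed
    have "(\<lambda>N. ?T (qN (k N))) \<longlonglongrightarrow> ?T q"
      by (intro tendsto_sum tendsto_mult q tendsto_const)
    then obtain N0 where N0: "\<And>N. N \<ge> N0 \<Longrightarrow> \<bar>?T (qN (k N)) - ?T q\<bar> < e/4"
      using LIMSEQ_D[of "\<lambda>N. ?T (qN (k N))" "?T q" "e/4"] e by auto
    show "\<exists>no. \<forall>n\<ge>no. norm ((\<integral>x. g x \<partial>P (k n)) - (\<integral>x. g x \<partial>Q)) < e"
    proof (intro exI[of _ N0] allI impI)
      fix N assume "N \<ge> N0"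
      then show "norm ((\<integral>x. g x \<partial>P (k N)) - (\<integral>x. g x \<partial>Q)) < e"
        using PN[of "k N"] QT N0[of N] e by (simp add: abs_if split: if_splits)
    qed
  qed
  then have "weak_lim (P \<circ> k) Q" unfolding weak_lim_def by (simp add: o_def)
  with k(1) QK that show ?thesis by blast
qed

section \<open>Testing and comparing measures on a compact set\<close>

lemma probs_onD:
  assumes "P \<in> probs_on K"
  shows "prob_space P" "sets P = sets borel" "measure P K = 1" "space P = UNIV"
  using assms sets_eq_imp_space_eq[of P borel] unfolding probs_on_def by auto

lemma probs_on_compl:
  assumes "P \<in> probs_on K" "A \<in> sets borel"
  shows "measure P (- A) = 1 - measure P A"
  using prob_space.prob_compl[OF probs_onD(1)[OF assms(1)], of A] assms(2)
  unfolding probs_onD(2,4)[OF assms(1)] Compl_eq_Diff_UNIV by blast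

lemma probs_on_AE:
  assumes "P \<in> probs_on K" "closed K"
  shows "AE x in P. x \<in> K"
  using probs_onD[OF assms(1)] assms(2) prob_space.AE_in_set_eq_1[of P K] by (simp add: borel_closed)

lemma integrable_bounded_borel:
  fixes g :: "'b :: topological_space \<Rightarrow> real"
  assumes "prob_space M" "sets M = sets borel" "g \<in> borel_measurable borel" "\<And>x. \<bar>g x\<bar> \<le> B"
  shows "integrable M g"
proof -
  interpret prob_space M by fact
  have "g \<in> borel_measurable M" using assms(3) measurable_cong_sets[OF assms(2) refl] by blast
  then show ?thesis using assms(4) by (intro integrable_const_bound[of _ B]) auto
qed

lemma integral_indicator_tendsto:
  fixes P :: "'e::topological_space measure"
  assumes "prob_space P" "sets P = sets borel" "A \<in> sets borel"
    and "\<And>l. f l \<in> borel_measurable borel" "\<And>l x. 0 \<le> f l x" "\<And>l x. f l x \<le> (1::real)"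
    and "\<And>x. (\<lambda>l. f l x) \<longlonglongrightarrow> indicator A x"
  shows "(\<lambda>l::nat. \<integral>x. f l x \<partial>P) \<longlonglongrightarrow> measure P A"
proof -
  interpret prob_space P by fact
  have m: "f l \<in> borel_measurable P" for l
    using assms(4) measurable_cong_sets[OF assms(2) refl] by blast
  have A: "A \<in> sets P" using assms by auto
  have "(\<lambda>l. \<integral>x. f l x \<partial>P) \<longlonglongrightarrow> (\<integral>x. indicator A x \<partial>P)"
    by (rule integral_dominated_convergence[where w = "\<lambda>_. 1"]) (use m A assms(5-7) in auto)
  moreover have "(\<integral>x. indicator A x \<partial>P) = measure P A"
    using A by (simp add: sets.Int_space_eq2)
  ultimately show ?thesis by simp
qed

lemma ramp_tendsto_indicator:
  assumes "d \<ge> (0::real)"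
  shows "(\<lambda>l. min 1 (real l * d)) \<longlonglongrightarrow> (if d > 0 then 1 else 0)"
proof (cases "d > 0")
  case True
  obtain N where N: "real N * d > 1" using reals_Archimedean3[OF True] by blast
  have "min 1 (real l * d) = 1" if "l \<ge> N" for l
  proof -
    have "real N * d \<le> real l * d" using that True by (intro mult_right_mono) auto
    then show ?thesis using N by simp
  qed
  then have "eventually (\<lambda>l. min 1 (real l * d) = 1) sequentially"
    using eventually_sequentially by auto
  then show ?thesis using True tendsto_eventually by simp
qed (use assms in auto)

lemma probs_on_eqI_open:
  assumes P: "P \<in> probs_on K" and Q: "Q \<in> probs_on K"
    and eq: "\<And>V. open V \<Longrightarrow> measure P V = measure Q V"
  shows "P = Q"
proof -
  interpret P: prob_space P using probs_onD[OF P] by auto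
  interpret Q: prob_space Q using probs_onD[OF Q] by auto
  show ?thesis
  proof (rule measure_eqI_generator_eq[of "{V. open V}" UNIV _ _ "\<lambda>_. UNIV"])
    show "sets P = sigma_sets UNIV {V. open V}" "sets Q = sigma_sets UNIV {V. open V}"
      using probs_onD[OF P] probs_onD[OF Q] unfolding borel_def by auto
  qed (use eq in \<open>auto simp: Int_stable_def P.emeasure_eq_measure Q.emeasure_eq_measure\<close>)
qed

text \<open>The complement of a finite union of balls is approximated by a product of ramps, one
  factor per ball, so the countable family \<open>h l js\<close> yields the measures of all finite
  unions. Such unions inside an open set increase to cover its part in \<open>K\<close>, which fixes
  the measure of open sets and hence the measure.\<close>

lemma countable_determining_class:
  fixes K :: "'e::metric_space set"
  assumes K: "compact K"
  obtains g :: "nat \<Rightarrow> 'e \<Rightarrow> real" where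
    "\<And>i. continuous_on UNIV (g i)" "\<And>i x. 0 \<le> g i x" "\<And>i x. g i x \<le> 1"
    "\<And>P Q. P \<in> probs_on K \<Longrightarrow> Q \<in> probs_on K \<Longrightarrow> (\<And>i. (\<integral>x. g i x \<partial>P) = (\<integral>x. g i x \<partial>Q)) \<Longrightarrow> P = Q"
proof -
  obtain a :: "nat \<Rightarrow> 'e" and r where
    ar: "\<And>x e. x \<in> K \<Longrightarrow> e > 0 \<Longrightarrow> \<exists>m. x \<in> ball (a m) (r m) \<and> ball (a m) (r m) \<subseteq> ball x e"
    using compact_countable_balls[OF K] by metis
  define h :: "nat \<Rightarrow> nat list \<Rightarrow> 'e \<Rightarrow> real" where
    "h l js x = prod_list (map (\<lambda>m. 1 - min 1 (real l * max 0 (r m - dist (a m) x))) js)" for l js x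
  have h0: "h l [] x = 1" for l x unfolding h_def by simp
  have hC: "h l (m # js) x = (1 - min 1 (real l * max 0 (r m - dist (a m) x))) * h l js x" for l m js x
    unfolding h_def by simp
  have cont: "continuous_on UNIV (h l js)" for l js
  proof (induction js)
    case (Cons m js)
    then show ?case unfolding hC by (intro continuous_intros)
  qed (simp add: h0)
  have bnd: "0 \<le> h l js x \<and> h l js x \<le> 1" for l js x
  proof (induction js)
    case (Cons m js)
    then show ?case unfolding hC by (auto intro!: mult_le_one)
  qed (simp add: h0)
  have lim: "(\<lambda>l. h l js x) \<longlonglongrightarrow> indicator (- (\<Union>m\<in>set js. ball (a m) (r m))) x" for js x
  proof (induction js)
    case (Cons m js)
    have "(\<lambda>l. h l (m # js) x) \<longlonglongrightarrow> (1 - (if max 0 (r m - dist (a m) x) > 0 then 1 else 0)) *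
        indicator (- (\<Union>m\<in>set js. ball (a m) (r m))) x"
      unfolding hC by (intro tendsto_intros Cons ramp_tendsto_indicator) auto
    moreover have "(1 - (if max 0 (r m - dist (a m) x) > 0 then 1 else 0)) *
        indicator (- (\<Union>m\<in>set js. ball (a m) (r m))) x = (indicator (- (\<Union>m\<in>set (m # js). ball (a m) (r m))) x :: real)"
      by (auto simp: indicator_def)
    ultimately show ?case by simp
  qed (simp add: h0)
  define g where "g i = (case from_nat i of (l, js) \<Rightarrow> h l js)" for i
  have gh: "\<exists>i. g i = h l js" for l js
    unfolding g_def by (intro exI[of _ "to_nat (l, js)"]) simp
  show ?thesis
  proof
    show "continuous_on UNIV (g i)" for i unfolding g_def using cont by (auto split: prod.split)
    show "0 \<le> g i x" "g i x \<le> 1" for i x unfolding g_def using bnd by (auto split: prod.split)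
    fix P Q assume P: "P \<in> probs_on K" and Q: "Q \<in> probs_on K"
      and eq: "\<And>i. (\<integral>x. g i x \<partial>P) = (\<integral>x. g i x \<partial>Q)"
    have heq: "(\<integral>x. h l js x \<partial>P) = (\<integral>x. h l js x \<partial>Q)" for l js using gh eq by metis
    have fin: "measure P (\<Union>m\<in>set js. ball (a m) (r m)) = measure Q (\<Union>m\<in>set js. ball (a m) (r m))" for js
    proof -
      let ?A = "\<Union>m\<in>set js. ball (a m) (r m)"
      have A: "?A \<in> sets borel" by (intro borel_open) auto
      have l: "(\<lambda>l. \<integral>x. h l js x \<partial>R) \<longlonglongrightarrow> measure R (- ?A)" if "R \<in> probs_on K" for R
        using bnd borel_comp[OF A]
        by (intro integral_indicator_tendsto[OF probs_onD(1,2)[OF that] _ borel_measurable_continuous_onI[OF cont] _ _ lim]) blast+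
      have "measure P (- ?A) = measure Q (- ?A)"
        using LIMSEQ_unique[OF l[OF P]] l[OF Q] heq by simp
      moreover have "measure R (- ?A) = 1 - measure R ?A" if "R \<in> probs_on K" for R
        by (rule probs_on_compl[OF that A])
      ultimately show ?thesis using P Q by fastforce
    qed
    show "P = Q"
    proof (rule probs_on_eqI_open[OF P Q])
      fix V :: "'e set" assume V: "open V"
      define B where "B n = (\<Union>m\<in>set (filter (\<lambda>m. ball (a m) (r m) \<subseteq> V) [0..<n]). ball (a m) (r m))" for n
      have Bm: "B n \<in> sets borel" for n unfolding B_def by (intro borel_open) auto
      have Bi: "incseq B" by (rule incseq_SucI) (auto simp: B_def)
      have BV: "(\<Union>n. B n) \<subseteq> V" unfolding B_def by auto
      have VB: "V \<inter> K \<subseteq> (\<Union>n. B n)"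
      proof
        fix x assume x: "x \<in> V \<inter> K"
        then obtain e where e: "e > 0" "ball x e \<subseteq> V" using V unfolding open_contains_ball by blast
        then obtain m where m: "x \<in> ball (a m) (r m)" "ball (a m) (r m) \<subseteq> ball x e" using ar x by blast
        have "m \<in> set (filter (\<lambda>m. ball (a m) (r m) \<subseteq> V) [0..<Suc m])" using m e by auto
        then have "x \<in> B (Suc m)" unfolding B_def using m(1) by blast
        then show "x \<in> (\<Union>n. B n)" by auto
      qed
      have lim: "(\<lambda>n. measure R (B n)) \<longlonglongrightarrow> measure R V" if R: "R \<in> probs_on K" for R
      proof -
        interpret prob_space R using probs_onD[OF R] by auto
        have "(\<lambda>n. measure R (B n)) \<longlonglongrightarrow> measure R (\<Union>n. B n)"
          using Bm Bi probs_onD[OF R] by (intro finite_Lim_measure_incseq) auto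
        moreover have "measure R (\<Union>n. B n) = measure R V"
        proof (rule measure_eq_AE)
          show "AE x in R. (x \<in> (\<Union>n. B n)) = (x \<in> V)"
            using probs_on_AE[OF R compact_imp_closed[OF K]] by eventually_elim (use BV VB in auto)
        qed (use Bm V probs_onD[OF R] in \<open>auto intro!: sets.countable_UN\<close>)
        ultimately show ?thesis by simp
      qed
      have "measure P (B n) = measure Q (B n)" for n unfolding B_def by (rule fin)
      then show "measure P V = measure Q V"
        using LIMSEQ_unique[OF lim[OF P]] lim[OF Q] by simp
    qed
  qed
qed

text \<open>The portmanteau inequality for open sets, via continuous functions increasing to the
  indicator of \<open>V\<close>.\<close>

lemma weak_lim_open_le:
  assumes lim: "weak_lim P Q" and P: "\<And>n. P n \<in> probs_on K" and Q: "Q \<in> probs_on K"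
    and V: "open V" and b: "\<And>n. measure (P n) V \<le> b n" "b \<longlonglongrightarrow> c"
  shows "measure Q V \<le> c"
\<comment> \<open>For \<open>V = UNIV\<close> the complement is empty and \<open>infdist\<close> to
  it is 0, so the ramps would not see \<open>V\<close>.\<close>
proof (cases "V = UNIV")
  case True
  have "measure (P n) V = 1" for n
    using True probs_onD[OF P[of n]] prob_space.prob_space[of "P n"] by simp
  then have "1 \<le> c" using b by (intro LIMSEQ_le_const[OF b(2)]) auto
  then show ?thesis using prob_space.prob_le_1[OF probs_onD(1)[OF Q], of V] by simp
next
  case False
  define f where "f l x = min 1 (real l * infdist x (- V))" for l x
  have c: "continuous_on UNIV (f l)" for l unfolding f_def by (intro continuous_intros)
  have f01: "0 \<le> f l x" "f l x \<le> 1" for l x unfolding f_def by (auto intro!: mult_nonneg_nonneg infdist_nonneg)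
  have cl: "closed (- V)" "- V \<noteq> {}" using V False by auto
  have pos: "(infdist x (- V) > 0) = (x \<in> V)" for x
    using in_closed_iff_infdist_zero[OF cl, of x] infdist_nonneg[of x "- V"] by auto
  have fi: "f l x \<le> indicator V x" for l x
    using f01(2)[of l x] pos[of x] infdist_nonneg[of x "- V"] by (auto simp: indicator_def f_def)
  have lf: "(\<lambda>l. f l x) \<longlonglongrightarrow> indicator V x" for x
    using ramp_tendsto_indicator[of "infdist x (- V)"] infdist_nonneg[of x "- V"] pos[of x]
    by (auto simp: indicator_def f_def split: if_splits)
  have Vb: "V \<in> sets borel" using V by simp
  have "(\<lambda>l. \<integral>x. f l x \<partial>Q) \<longlonglongrightarrow> measure Q V"
    using integral_indicator_tendsto[of Q V f] probs_onD[OF Q] Vb f01 lf borel_measurable_continuous_onI[OF c] by auto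
  then show ?thesis
  proof (rule LIMSEQ_le_const2, intro exI[of _ 0] allI impI)
    fix l
    show "(\<integral>x. f l x \<partial>Q) \<le> c"
    proof -
    have "bounded (range (f l))" using f01 by (intro boundedI[of _ 1]) auto
    then have l: "(\<lambda>n. \<integral>x. f l x \<partial>P n) \<longlonglongrightarrow> (\<integral>x. f l x \<partial>Q)"
      using lim c unfolding weak_lim_def by auto
    have le: "(\<integral>x. f l x \<partial>P n) \<le> b n" for n
    proof -
      interpret prob_space "P n" using probs_onD[OF P] by auto
      have "(\<integral>x. f l x \<partial>P n) \<le> (\<integral>x. indicator V x \<partial>P n)"
        using f01 fi probs_onD[OF P] Vb borel_measurable_continuous_onI[OF c]
        by (intro integral_mono integrable_bounded_borel[of _ _ 1]) auto
      also have "\<dots> = measure (P n) V" using Vb probs_onD[OF P[of n]] by (simp add: sets.Int_space_eq2)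
      finally show ?thesis using b(1)[of n] by simp
    qed
    show ?thesis by (rule LIMSEQ_le[OF l b(2)]) (use le in auto)
  qed
  qed
qed

lemma weak_lim_clopen:
  assumes lim: "weak_lim P Q" and P: "\<And>n. P n \<in> probs_on K" and Q: "Q \<in> probs_on K"
    and V: "open V" "closed V"
  shows "(\<lambda>n. measure (P n) V) \<longlonglongrightarrow> measure Q V"
proof -
  have c: "continuous_on UNIV (indicator V :: _ \<Rightarrow> real)"
  proof -
    have "continuous_on (V \<union> - V) (indicator V :: _ \<Rightarrow> real)"
    proof (rule continuous_on_open_Un)
      show "continuous_on V (indicator V :: _ \<Rightarrow> real)"
        using continuous_on_cong[of V V "indicator V" "\<lambda>_. 1::real"] by simp
      show "continuous_on (- V) (indicator V :: _ \<Rightarrow> real)"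
        using continuous_on_cong[of "- V" "- V" "indicator V" "\<lambda>_. 0::real"] by simp
    qed (use V in auto)
    then show ?thesis by simp
  qed
  have m: "(\<integral>x. (indicator V x :: real) \<partial>R) = measure R V" if "R \<in> probs_on K" for R
    using V probs_onD[OF that] by (simp add: sets.Int_space_eq2)
  have "bounded (range (indicator V :: _ \<Rightarrow> real))" by (intro boundedI[of _ 1]) (auto simp: indicator_def)
  then have "(\<lambda>n. \<integral>x. (indicator V x :: real) \<partial>P n) \<longlonglongrightarrow> (\<integral>x. indicator V x \<partial>Q)"
    using lim[unfolded weak_lim_def, rule_format, of "indicator V"] c by blast
  then show ?thesis unfolding m[OF P] m[OF Q] .
qed

section \<open>Conditioning on a set, and extreme measures\<close>

lemma (in prob_space) integral_uniform_measure:
  fixes g :: "'a \<Rightarrow> real"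
  assumes "A \<in> sets M" "prob A > 0" "g \<in> borel_measurable M"
  shows "(\<integral>x. g x \<partial>uniform_measure M A) = (\<integral>x. indicator A x * g x \<partial>M) / prob A"
proof -
  have "indicator A x / emeasure M A = ennreal (indicator A x / prob A)" for x
    using assms(2) divide_ennreal[of 1 "prob A"] by (simp add: emeasure_eq_measure indicator_def)
  then have "uniform_measure M A = density M (\<lambda>x. ennreal (indicator A x / prob A))"
    unfolding uniform_measure_def by simp
  then have "(\<integral>x. g x \<partial>uniform_measure M A) = (\<integral>x. (indicator A x / prob A) *\<^sub>R g x \<partial>M)"
    using assms by (simp add: integral_density)
  also have "\<dots> = (\<integral>x. (indicator A x * g x) / prob A \<partial>M)" by simp
  finally show ?thesis by simp
qed

lemma (in prob_space) integral_split_uniform_measure: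
  fixes g :: "'a \<Rightarrow> real"
  assumes "A \<in> sets M" "0 < prob A" "prob A < 1" "integrable M g"
  shows "(\<integral>x. g x \<partial>M) = prob A * (\<integral>x. g x \<partial>uniform_measure M A)
           + (1 - prob A) * (\<integral>x. g x \<partial>uniform_measure M (space M - A))"
proof -
  have c: "prob (space M - A) = 1 - prob A" using assms(1) by (rule prob_compl)
  have i: "integrable M (\<lambda>x. indicator A x * g x)" "integrable M (\<lambda>x. indicator (space M - A) x * g x)"
    using assms by (auto intro: integrable_real_mult_indicator simp: mult.commute)
  have "(\<integral>x. g x \<partial>M) = (\<integral>x. indicator A x * g x + indicator (space M - A) x * g x \<partial>M)"
    by (intro Bochner_Integration.integral_cong) (auto simp: indicator_def)
  also have "\<dots> = (\<integral>x. indicator A x * g x \<partial>M) + (\<integral>x. indicator (space M - A) x * g x \<partial>M)"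
    using i by (rule Bochner_Integration.integral_add)
  finally show ?thesis
    using integral_uniform_measure[of A g] integral_uniform_measure[of "space M - A" g] assms c by simp
qed

text \<open>Extreme points through a strictly convex functional: \<open>J\<close>, a weighted sum of
  squares of the integrals of determining functions, is weakly continuous and so attains its
  supremum on \<open>C\<close>. If an invariant set split the maximizer, its two conditional
  measures would lie in \<open>C\<close> and differ, and one of them would have a larger
  \<open>J\<close>.\<close>

lemma ergodic_of_closed_face:
  fixes K :: "'e::metric_space set" and T :: "'e \<Rightarrow> 'e"
  assumes K: "compact K" and T: "T \<in> borel_measurable borel"
    and C: "C \<subseteq> probs_on K" "C \<noteq> {}"
    and closed: "\<And>P Q. (\<And>n::nat. P n \<in> C) \<Longrightarrow> Q \<in> probs_on K \<Longrightarrow> weak_lim P Q \<Longrightarrow> Q \<in> C"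
    and face: "\<And>P A. P \<in> C \<Longrightarrow> A \<in> sets borel \<Longrightarrow> T -` A = A \<Longrightarrow> 0 < measure P A \<Longrightarrow> uniform_measure P A \<in> C"
  obtains P where "P \<in> C" "\<And>A. A \<in> sets borel \<Longrightarrow> T -` A = A \<Longrightarrow> measure P A = 0 \<or> measure P A = 1"
proof -
  obtain g :: "nat \<Rightarrow> 'e \<Rightarrow> real" where g: "\<And>i. continuous_on UNIV (g i)" "\<And>i x. 0 \<le> g i x" "\<And>i x. g i x \<le> 1"
    "\<And>P Q. P \<in> probs_on K \<Longrightarrow> Q \<in> probs_on K \<Longrightarrow> (\<And>i. (\<integral>x. g i x \<partial>P) = (\<integral>x. g i x \<partial>Q)) \<Longrightarrow> P = Q"
    using countable_determining_class[OF K] by blast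
  define m where "m P i = (\<integral>x. g i x \<partial>P)" for P i
  define J where "J P = (\<Sum>i. (1/2)^i * (m P i)\<^sup>2)" for P
  have gi: "integrable P (g i)" if "P \<in> probs_on K" for P i
    using integrable_bounded_borel[of P "g i" 1] probs_onD[OF that] g borel_measurable_continuous_onI[OF g(1)] by auto
  have m01: "0 \<le> m P i" "m P i \<le> 1" if "P \<in> probs_on K" for P i
  proof -
    interpret prob_space P using probs_onD[OF that] by auto
    show "0 \<le> m P i" unfolding m_def using g by simp
    show "m P i \<le> 1" unfolding m_def using integral_le_const[OF gi[OF that]] g by simp
  qed
  have sm: "summable (\<lambda>i. (1/2::real)^i * a i)" if "\<And>i. \<bar>a i\<bar> \<le> 1" for a :: "nat \<Rightarrow> real"
    by (rule summable_comparison_test'[where g = "\<lambda>i. (1/2)^i"])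
       (use that in \<open>auto simp: abs_mult intro!: mult_left_le\<close>)
  have sq1: "\<bar>(m P i)\<^sup>2\<bar> \<le> 1" if "P \<in> probs_on K" for P i
    using m01[OF that, of i] by (simp add: power_le_one)
  have J2: "J P \<le> 2" if "P \<in> probs_on K" for P
  proof -
    have "J P \<le> (\<Sum>i. (1/2::real)^i)" unfolding J_def
      using sq1[OF that] by (intro suminf_le sm) (auto intro!: mult_left_le)
    then show ?thesis using suminf_geometric[of "1/2::real"] by simp
  qed
  define s where "s = (SUP P\<in>C. J P)"
  have bdd: "bdd_above (J ` C)" using J2 C(1) by (auto intro!: bdd_aboveI2)
  have "\<exists>P\<in>C. J P > s - 1 / Suc n" for n
    using less_cSUP_iff[OF C(2) bdd, of "s - 1 / Suc n"] unfolding s_def by simp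
  then obtain P where P: "\<And>n. P n \<in> C" "\<And>n. J (P n) > s - 1 / Suc n" by metis
  have PK: "P n \<in> probs_on K" for n using P(1) C(1) by auto
  obtain k Q where k: "strict_mono k" "Q \<in> probs_on K" "weak_lim (P \<circ> k) Q"
    by (rule weak_seq_compact[OF K PK])
  have QC: "Q \<in> C" using closed[of "P \<circ> k" Q] P(1) k by simp
  have "(\<lambda>n. m (P (k n)) i) \<longlonglongrightarrow> m Q i" for i
  proof -
    have "bounded (range (g i))" using g by (intro boundedI[of _ 1]) auto
    then show ?thesis using k(3) g(1) unfolding weak_lim_def m_def o_def by auto
  qed
  then have l1: "(\<lambda>n. (1/2)^i * (m (P (k n)) i)\<^sup>2) \<longlonglongrightarrow> (1/2)^i * (m Q i)\<^sup>2" for i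
    by (intro tendsto_intros)
  have "(\<lambda>n. J (P (k n))) \<longlonglongrightarrow> J Q" unfolding J_def
  proof (rule conjunct2[OF conjunct2[OF tannerys_theorem[where M = "\<lambda>i. (1/2)^i"]]])
    show "\<forall>\<^sub>F (i, n) in sequentially \<times>\<^sub>F sequentially. norm ((1/2)^i * (m (P (k n)) i)\<^sup>2) \<le> (1/2)^i"
      using sq1[OF PK] by (intro always_eventually) (auto intro!: mult_left_le simp: abs_mult)
  qed (use l1 in auto)
  moreover have "(\<lambda>n. s - 1 / Suc (k n)) \<longlonglongrightarrow> s - 0"
    using LIMSEQ_subseq_LIMSEQ[OF LIMSEQ_inverse_real_of_nat k(1)]
    by (intro tendsto_diff tendsto_const) (simp add: o_def inverse_eq_divide)
  ultimately have "s \<le> J Q" using P(2) by (intro LIMSEQ_le[of _ "s - 0" _ "J Q", simplified]) (auto intro: less_imp_le)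
  then have max: "J R \<le> J Q" if "R \<in> C" for R
    using cSUP_upper[OF that bdd] unfolding s_def by simp
  have "measure Q A = 0 \<or> measure Q A = 1" if A: "A \<in> sets borel" "T -` A = A" for A
  proof (rule ccontr)
    interpret prob_space Q using probs_onD[OF k(2)] by auto
    assume "\<not> ?thesis"
    then have t: "0 < prob A" "prob A < 1"
      using prob_le_1[of A] measure_nonneg[of Q A] by linarith+
    define t where "t = prob A"
    have Am: "A \<in> sets Q" "- A \<in> sets Q" "space Q - A = - A"
      using A probs_onD[OF k(2)] by auto
    have pc: "prob (- A) = 1 - t" using prob_compl[OF Am(1)] Am(3) unfolding t_def by simp
    define Q1 Q2 where "Q1 = uniform_measure Q A" and "Q2 = uniform_measure Q (- A)"
    have "T -` (- A) = - A" using A(2) by auto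
    then have Q12: "Q1 \<in> C" "Q2 \<in> C"
      unfolding Q1_def Q2_def using face[OF QC] A t pc unfolding t_def by auto
    then have QK: "Q1 \<in> probs_on K" "Q2 \<in> probs_on K" using C(1) by auto
    have mm: "m Q i = t * m Q1 i + (1 - t) * m Q2 i" for i
      unfolding m_def Q1_def Q2_def t_def
      using integral_split_uniform_measure[OF Am(1) t gi[OF k(2)]] Am(3) by simp
    \<comment> \<open>The defect of convexity of the square, \<open>t * (1 - t)\<close> times the
      squared difference, is what makes \<open>J\<close> strictly convex.\<close>
    have sq: "(1/2)^i * (m Q i)\<^sup>2 = t * ((1/2)^i * (m Q1 i)\<^sup>2) + (1 - t) * ((1/2)^i * (m Q2 i)\<^sup>2)
        - t * (1 - t) * ((1/2)^i * (m Q1 i - m Q2 i)\<^sup>2)" for i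
      unfolding mm by (simp add: power2_eq_square algebra_simps)
    have d1: "\<bar>(m Q1 i - m Q2 i)\<^sup>2\<bar> \<le> 1" for i
    proof -
      have "\<bar>m Q1 i - m Q2 i\<bar> \<le> 1"
        using m01[OF QK(1), of i] m01[OF QK(2), of i] by (simp add: abs_le_iff)
      then show ?thesis using abs_square_le_1[of "m Q1 i - m Q2 i"] by simp
    qed
    note s1 = sm[OF sq1[OF QK(1)]] and s2 = sm[OF sq1[OF QK(2)]] and s3 = sm[OF d1]
    have "J Q = t * J Q1 + (1 - t) * J Q2 - t * (1 - t) * (\<Sum>i. (1/2)^i * (m Q1 i - m Q2 i)\<^sup>2)"
      unfolding J_def sq
      by (intro sums_unique[symmetric] sums_diff sums_add sums_mult summable_sums s1 s2 s3)
    moreover have "t * J Q1 + (1 - t) * J Q2 \<le> t * J Q + (1 - t) * J Q"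
      using max Q12 t unfolding t_def by (intro add_mono mult_left_mono) auto
    ultimately have "t * (1 - t) * (\<Sum>i. (1/2)^i * (m Q1 i - m Q2 i)\<^sup>2) \<le> 0" by (simp add: algebra_simps)
    moreover have "t * (1 - t) > 0" using t unfolding t_def by simp
    ultimately have "(\<Sum>i. (1/2)^i * (m Q1 i - m Q2 i)\<^sup>2) \<le> 0"
      by (metis mult_pos_pos not_le)
    moreover have "0 \<le> (\<Sum>i. (1/2)^i * (m Q1 i - m Q2 i)\<^sup>2)" by (intro suminf_nonneg s3) simp
    ultimately have "\<forall>i. (1/2)^i * (m Q1 i - m Q2 i)\<^sup>2 = 0"
      using suminf_eq_zero_iff[OF s3] by simp
    then have "Q1 = Q2" using g(4)[OF QK] unfolding m_def by simp
    moreover have "measure Q1 A = 1"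
      unfolding Q1_def using t Am by (subst measure_uniform_measure) (auto simp: emeasure_eq_measure)
    moreover have "measure Q2 A = 0"
      unfolding Q2_def using t pc Am unfolding t_def by (subst measure_uniform_measure) (auto simp: emeasure_eq_measure)
    ultimately show False by simp
  qed
  with QC that show ?thesis by blast
qed

section \<open>Entropy of two-set partitions\<close>

text \<open>Nonnegativity of mutual information: \<open>ln x \<le> x - 1\<close> is applied to the
  ratio of the product law \<open>a s * b t\<close> to the joint law, and both laws have total mass
  1.\<close>

lemma finite_entropy_subadditive:
  fixes J :: "'s \<Rightarrow> 't \<Rightarrow> real"
  assumes S: "finite S" "finite T" and J: "\<And>s t. J s t \<ge> 0" and one: "(\<Sum>s\<in>S. \<Sum>t\<in>T. J s t) = 1"
    and a: "\<And>s. s \<in> S \<Longrightarrow> a s = (\<Sum>t\<in>T. J s t)" and b: "\<And>t. t \<in> T \<Longrightarrow> b t = (\<Sum>s\<in>S. J s t)"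
  shows "(\<Sum>s\<in>S. \<Sum>t\<in>T. - J s t * ln (J s t)) \<le> (\<Sum>s\<in>S. - a s * ln (a s)) + (\<Sum>t\<in>T. - b t * ln (b t))"
proof -
  have trm: "- J s t * ln (J s t) \<le> (- J s t * ln (a s)) + (- J s t * ln (b t)) + (a s * b t - J s t)"
    if "s \<in> S" "t \<in> T" for s t
  proof (cases "J s t = 0")
    case True
    have "a s \<ge> 0" "b t \<ge> 0" using a[OF that(1)] b[OF that(2)] J by (auto intro: sum_nonneg)
    then show ?thesis using True by simp
  next
    case False
    then have pos: "J s t > 0" using J[of s t] by simp
    have "J s t \<le> a s" "J s t \<le> b t"
      using a[OF that(1)] b[OF that(2)] member_le_sum[of t T "J s"] member_le_sum[of s S "\<lambda>s. J s t"] that S J by auto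
    then have ab: "a s > 0" "b t > 0" using pos by auto
    have "ln (a s * b t / J s t) \<le> a s * b t / J s t - 1"
      using ab pos by (intro ln_le_minus_one) auto
    then have "J s t * (ln (a s) + ln (b t) - ln (J s t)) \<le> J s t * (a s * b t / J s t - 1)"
      using ab pos by (intro mult_left_mono) (simp_all add: ln_div ln_mult)
    also have "\<dots> = a s * b t - J s t" using pos by (simp add: field_simps)
    finally show ?thesis by (simp add: algebra_simps)
  qed
  have sa: "(\<Sum>s\<in>S. a s) = 1" using one a by simp
  have sb: "(\<Sum>t\<in>T. b t) = 1" using one b sum.swap[of J T S] by simp
  have "(\<Sum>s\<in>S. \<Sum>t\<in>T. - J s t * ln (J s t))
      \<le> (\<Sum>s\<in>S. \<Sum>t\<in>T. (- J s t * ln (a s)) + (- J s t * ln (b t)) + (a s * b t - J s t))"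
    using trm by (intro sum_mono) auto
  also have "\<dots> = (\<Sum>s\<in>S. \<Sum>t\<in>T. - J s t * ln (a s)) + (\<Sum>s\<in>S. \<Sum>t\<in>T. - J s t * ln (b t))
      + ((\<Sum>s\<in>S. \<Sum>t\<in>T. a s * b t) - (\<Sum>s\<in>S. \<Sum>t\<in>T. J s t))"
    by (simp only: sum.distrib sum_subtractf)
  also have "(\<Sum>s\<in>S. \<Sum>t\<in>T. a s * b t) = (\<Sum>s\<in>S. a s) * (\<Sum>t\<in>T. b t)" by (rule sum_product[symmetric])
  also have "(\<Sum>s\<in>S. \<Sum>t\<in>T. - J s t * ln (a s)) = (\<Sum>s\<in>S. - a s * ln (a s))"
    using a by (intro sum.cong) (simp_all add: sum_distrib_right sum_negf)
  also have "(\<Sum>s\<in>S. \<Sum>t\<in>T. - J s t * ln (b t)) = (\<Sum>t\<in>T. - b t * ln (b t))"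
    unfolding sum.swap[of _ T S] using b by (intro sum.cong) (simp_all add: sum_distrib_right sum_negf)
  finally show ?thesis using sa sb one by simp
qed

text \<open>Fekete's lemma. A limit rather than mere bounds is wanted, since the entropy rate is
  defined as a \<open>lim\<close>; the shift by \<open>Suc\<close> matches that definition.\<close>

lemma subadditive_convergent:
  fixes u :: "nat \<Rightarrow> real"
  assumes sub: "\<And>m n. u (m + n) \<le> u m + u n" and nn: "\<And>n. u n \<ge> 0"
  shows "convergent (\<lambda>n. u (Suc n) / Suc n)"
proof -
  define L where "L = (INF n. u (Suc n) / Suc n)"
  have bdd: "bdd_below (range (\<lambda>n. u (Suc n) / Suc n))" using nn by (intro bdd_belowI2[of _ 0]) auto
  have lo: "L \<le> u (Suc n) / Suc n" for n unfolding L_def using bdd by (intro cINF_lower) auto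
  have mult: "u (q * m + r) \<le> q * u m + u r" for q m r
  proof (induction q)
    case (Suc q)
    have "u (m + (q * m + r)) \<le> u m + u (q * m + r)" by (rule sub)
    then show ?case using Suc by (simp add: algebra_simps)
  qed simp
  have "(\<lambda>n. u (Suc n) / Suc n) \<longlonglongrightarrow> L"
  proof (rule LIMSEQ_I)
    fix e :: real assume e: "e > 0"
    then have "\<exists>n. u (Suc n) / Suc n < L + e/2"
      using cINF_less_iff[OF _ bdd, of "L + e/2"] unfolding L_def by simp
    then obtain m where m: "m > 0" "u m / m < L + e/2" by blast
    \<comment> \<open>\<open>B\<close> bounds \<open>u\<close> on all remainders modulo
      \<open>m\<close>.\<close>
    define B where "B = (\<Sum>r<m. u r)"
    have B: "u r \<le> B" if "r < m" for r unfolding B_def using that nn by (intro member_le_sum) auto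
    obtain N :: nat where N: "N > 2 * B / e" using reals_Archimedean2 by blast
    have "norm (u (Suc n) / Suc n - L) < e" if "n \<ge> N" for n
    proof -
      let ?q = "Suc n div m" and ?r = "Suc n mod m"
      have "u (Suc n) \<le> ?q * u m + B" using mult[of ?q m ?r] B[of ?r] m(1) by simp
      also have "real ?q * u m = real ?q * m * (u m / m)" using m by simp
      also have "real ?q * m * (u m / m) \<le> real (Suc n) * (u m / m)"
        using nn[of m] of_nat_mono[OF div_times_less_eq_dividend[of "Suc n" m]]
        by (intro mult_right_mono) auto
      finally have "u (Suc n) / Suc n \<le> (Suc n * (u m / m) + B) / Suc n"
        by (intro divide_right_mono) auto
      also have "\<dots> = u m / m + B / Suc n" by (simp add: add_divide_distrib del: of_nat_Suc)
      finally have "u (Suc n) / Suc n \<le> u m / m + B / Suc n" .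
      moreover have "B / Suc n < e / 2"
      proof -
        have "2 * B / e < Suc n" using N that by linarith
        then show ?thesis using e by (simp add: field_simps)
      qed
      ultimately show ?thesis using lo[of n] m(2) unfolding real_norm_def by linarith
    qed
    then show "\<exists>no. \<forall>n\<ge>no. norm (u (Suc n) / Suc n - L) < e" by blast
  qed
  then show ?thesis by (auto simp: convergent_def)
qed

text \<open>Only the part \<open>q\<close> of the law is known to have small atoms. At most
  \<open>1 / e\<close> atoms have \<open>p s > e\<close>, and these carry at most \<open>e\<close>
  of the mass of \<open>q\<close>; on the rest \<open>- ln (p s)\<close> is at least
  \<open>- ln e\<close> and the mass is at least \<open>g - e\<close>.\<close>

lemma finite_entropy_lower_bound:
  fixes p q :: "'s \<Rightarrow> real"
  assumes S: "finite S" and p: "\<And>s. s \<in> S \<Longrightarrow> p s \<le> 1" and one: "(\<Sum>s\<in>S. p s) = 1"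
    and q: "\<And>s. s \<in> S \<Longrightarrow> 0 \<le> q s" "\<And>s. s \<in> S \<Longrightarrow> q s \<le> p s" "\<And>s. s \<in> S \<Longrightarrow> q s \<le> e\<^sup>2"
    and e: "0 < e" "e \<le> 1" and g: "g \<le> (\<Sum>s\<in>S. q s)"
  shows "(g - e) * (- ln e) \<le> (\<Sum>s\<in>S. - p s * ln (p s))"
proof -
  define B where "B = {s\<in>S. p s > e}"
  have p0: "0 \<le> p s" if "s \<in> S" for s using q that by force
  have "card B * e = (\<Sum>s\<in>B. e)" by simp
  also have "\<dots> \<le> (\<Sum>s\<in>B. p s)" by (intro sum_mono) (auto simp: B_def)
  also have "\<dots> \<le> (\<Sum>s\<in>S. p s)" using S p0 by (intro sum_mono2) (auto simp: B_def)
  finally have cB: "card B * e \<le> 1" using one by simp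
  have "(\<Sum>s\<in>B. q s) \<le> (\<Sum>s\<in>B. e\<^sup>2)" using q by (intro sum_mono) (auto simp: B_def)
  also have "\<dots> = (card B * e) * e" by (simp add: power2_eq_square)
  also have "\<dots> \<le> 1 * e" using cB e by (intro mult_right_mono) auto
  finally have qB: "(\<Sum>s\<in>B. q s) \<le> e" by simp
  have "(\<Sum>s\<in>S. q s) = (\<Sum>s\<in>B. q s) + (\<Sum>s\<in>S - B. q s)"
    using S by (subst sum.subset_diff[of B S]) (auto simp: B_def)
  then have "g - e \<le> (\<Sum>s\<in>S - B. q s)" using qB g by simp
  also have "\<dots> \<le> (\<Sum>s\<in>S - B. p s)" using q by (intro sum_mono) auto
  finally have "(g - e) * (- ln e) \<le> (\<Sum>s\<in>S - B. p s) * (- ln e)"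
    using e by (intro mult_right_mono) auto
  also have "\<dots> = (\<Sum>s\<in>S - B. p s * (- ln e))" by (rule sum_distrib_right)
  also have "\<dots> \<le> (\<Sum>s\<in>S - B. - p s * ln (p s))"
  proof (intro sum_mono)
    fix s assume s: "s \<in> S - B"
    then have "p s \<le> e" "0 \<le> p s" using p0 by (auto simp: B_def)
    then show "p s * (- ln e) \<le> - p s * ln (p s)"
      using mult_left_mono[of "- ln e" "- ln (p s)" "p s"] e by (cases "p s = 0") auto
  qed
  also have "\<dots> \<le> (\<Sum>s\<in>S. - p s * ln (p s))"
  proof (intro sum_mono2)
    fix s assume "s \<in> S - (S - B)"
    then have "s \<in> S" by auto
    then have "ln (p s) \<le> 0" using p[of s] p0[of s] by (cases "p s = 0") auto
    then show "0 \<le> - p s * ln (p s)" using p0[OF \<open>s \<in> S\<close>] by (simp add: mult_nonneg_nonpos)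
  qed (use S in auto)
  finally show ?thesis .
qed

section \<open>Entropy of a two-set partition along itineraries\<close>

lemma itinerary_add:
  "itinerary (\<lambda>i. (f ^^ i) -` A) (m + n) x
     = itinerary (\<lambda>i. (f ^^ i) -` A) n ((f ^^ m) x) @ itinerary (\<lambda>i. (f ^^ i) -` A) m x"
proof (induction n)
  case (Suc n)
  have "(f ^^ (m + n)) x = (f ^^ n) ((f ^^ m) x)" by (metis add.commute comp_apply funpow_add)
  then show ?case using Suc by simp
qed simp

lemma funpow_borel_measurable:
  fixes f :: "'a::topological_space \<Rightarrow> 'a"
  assumes "f \<in> borel_measurable borel"
  shows "(f ^^ i) \<in> borel_measurable borel"
proof (induction i)
  case 0
  then show ?case by (simp add: id_def)
next
  case (Suc i)
  then show ?case unfolding funpow.simps by (rule measurable_comp[OF _ assms])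
qed

lemma funpow_vimage_measurable:
  fixes f :: "'a::topological_space \<Rightarrow> 'a"
  assumes "f \<in> borel_measurable borel" "A \<in> sets borel"
  shows "(f ^^ i) -` A \<in> sets borel"
  using measurable_sets[OF funpow_borel_measurable[OF assms(1)] assms(2)] by simp

lemma iter_join_two_sets:
  "iter_join f {A, - A} n =
     (\<lambda>s. {x. itinerary (\<lambda>i. (f ^^ i) -` A) n x = s}) ` {s. length s = n} - {{}}"
proof -
  let ?U = "\<lambda>i. (f ^^ i) -` A"
  show ?thesis
  proof (intro set_eqI iffI)
    fix B assume "B \<in> iter_join f {A, - A} n"
    then obtain c where c: "B = (\<Inter>i<n. (f ^^ i) -` (c i))" "\<forall>i<n. c i \<in> {A, - A}" "B \<noteq> {}"
      unfolding iter_join_def by auto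
    then obtain x where x: "x \<in> B" by auto
    have "B = {y. itinerary ?U n y = itinerary ?U n x}"
      using c(1,2) x unfolding itinerary_eq_iff by (auto 4 3)
    moreover have "length (itinerary ?U n x) = n" by simp
    ultimately show "B \<in> (\<lambda>s. {x. itinerary ?U n x = s}) ` {s. length s = n} - {{}}" using c(3) by blast
  next
    fix B assume "B \<in> (\<lambda>s. {x. itinerary ?U n x = s}) ` {s. length s = n} - {{}}"
    then obtain s where s: "B = {x. itinerary ?U n x = s}" "B \<noteq> {}" by auto
    then obtain x where x: "x \<in> B" by auto
    define c where "c i = (if (f ^^ i) x \<in> A then A else - A)" for i
    have "B = (\<Inter>i<n. (f ^^ i) -` (c i))"
    proof -
      have "B = {y. itinerary ?U n y = itinerary ?U n x}" using s x by auto
      then show ?thesis unfolding itinerary_eq_iff c_def by (auto split: if_splits)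
    qed
    moreover have "\<forall>i<n. c i \<in> {A, - A}" unfolding c_def by auto
    ultimately show "B \<in> iter_join f {A, - A} n" using s(2) unfolding iter_join_def by blast
  qed
qed

lemma partition_entropy_iter_join:
  "partition_entropy \<mu> (iter_join f {A, - A} n) =
     (\<Sum>s | length s = n. - measure \<mu> {x. itinerary (\<lambda>i. (f ^^ i) -` A) n x = s}
        * ln (measure \<mu> {x. itinerary (\<lambda>i. (f ^^ i) -` A) n x = s}))"
proof -
  let ?c = "\<lambda>s. {x. itinerary (\<lambda>i. (f ^^ i) -` A) n x = s}"
  let ?S = "{s. length s = n}"
  let ?N = "{s \<in> ?S. ?c s \<noteq> {}}"
  have im: "?c ` ?S - {{}} = ?c ` ?N" by auto
  have inj: "inj_on ?c ?N" by (auto simp: inj_on_def)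
  have "partition_entropy \<mu> (iter_join f {A, - A} n) = (\<Sum>s\<in>?N. - measure \<mu> (?c s) * ln (measure \<mu> (?c s)))"
    unfolding partition_entropy_def iter_join_two_sets im sum.reindex[OF inj] by simp
  also have "\<dots> = (\<Sum>s\<in>?S. - measure \<mu> (?c s) * ln (measure \<mu> (?c s)))"
    by (rule sum.mono_neutral_left[OF finite_length_bool]) auto
  finally show ?thesis .
qed

text \<open>In the application \<open>q n s\<close> is the mass of the name \<open>s\<close> inside
  an event of measure at least \<open>g\<close>. That event changes with \<open>n\<close> and
  depends on bits or phases beyond the point of the space, so it is not a subset of the space and
  enters only through the numbers \<open>q n s\<close>.\<close>

lemma ks_entropy_pos:
  fixes \<mu> :: "'a::topological_space measure" and g c :: real
  assumes mu: "prob_space \<mu>" "sets \<mu> = sets borel" and f: "f \<in> borel_measurable borel"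
    and inv: "invariant_measure f \<mu>"
    and A: "A \<in> sets borel" "A \<noteq> {}" "A \<noteq> UNIV"
    and g: "g > 0" and c: "c > 0"
    and q: "\<And>n s. n \<ge> n0 \<Longrightarrow> 0 \<le> q n s"
      "\<And>n s. n \<ge> n0 \<Longrightarrow> q n s \<le> measure \<mu> {x. itinerary (\<lambda>i. (f ^^ i) -` A) n x = s}"
      "\<And>n s. n \<ge> n0 \<Longrightarrow> length s = n \<Longrightarrow> q n s \<le> exp (- c * n)"
      "\<And>n. n \<ge> n0 \<Longrightarrow> g \<le> (\<Sum>s | length s = n. q n s)"
  shows "ks_entropy \<mu> f > 0"
proof -
  interpret prob_space \<mu> by fact
  let ?U = "\<lambda>i. (f ^^ i) -` A"
  define p where "p n s = measure \<mu> {x. itinerary ?U n x = s}" for n s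
  have sp: "space \<mu> = UNIV" using sets_eq_imp_space_eq[OF mu(2)] by simp
  have Um: "?U i \<in> sets borel" for i by (rule funpow_vimage_measurable[OF f A(1)])
  have itm: "{x. itinerary ?U n x = s} \<in> sets borel" for n s by (rule itinerary_borel[OF Um])
  have inv_pow: "measure \<mu> ((f ^^ m) -` B) = measure \<mu> B" if "B \<in> sets borel" for m B
  proof (induction m)
    case (Suc m)
    have "(f ^^ Suc m) -` B = f -` ((f ^^ m) -` B)" by (auto simp: funpow_Suc_right simp del: funpow.simps)
    then have "measure \<mu> ((f ^^ Suc m) -` B) = measure \<mu> ((f ^^ m) -` B)"
      using inv[unfolded invariant_measure_def, rule_format, OF funpow_vimage_measurable[OF f that, of m]] by metis
    then show ?case using Suc by metis
  qed simp
  have fin_part: "(\<Sum>s | length s = n. measure \<mu> (B \<inter> {x. itinerary ?U n (h x) = s})) = measure \<mu> B"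
    if "B \<in> sets borel" "h \<in> borel_measurable borel" for B n h
  proof -
    have hm: "{x. itinerary ?U n (h x) = s} \<in> sets borel" for s
      using measurable_sets[OF that(2) itm[of n s]] by (simp add: vimage_def)
    have "(\<Sum>s | length s = n. measure \<mu> (B \<inter> {x. itinerary ?U n (h x) = s}))
        = measure \<mu> (\<Union>s\<in>{s. length s = n}. B \<inter> {x. itinerary ?U n (h x) = s})"
      using hm that mu(2) by (intro finite_measure_finite_Union[symmetric] finite_length_bool) (auto simp: disjoint_family_on_def)
    also have "(\<Union>s\<in>{s. length s = n}. B \<inter> {x. itinerary ?U n (h x) = s}) = B" by auto
    finally show ?thesis .
  qed
  have one: "(\<Sum>s | length s = n. p n s) = 1" for n
    using fin_part[of UNIV id n] prob_space sp unfolding p_def by simp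
  define H where "H n = partition_entropy \<mu> (iter_join f {A, - A} n)" for n
  have H: "H n = (\<Sum>s | length s = n. - p n s * ln (p n s))" for n
    unfolding H_def partition_entropy_iter_join p_def by simp
  have p01: "0 \<le> p n s" "p n s \<le> 1" for n s unfolding p_def by auto
  have nn: "H n \<ge> 0" for n
  proof -
    have "0 \<le> - p n s * ln (p n s)" for s
      using p01[of n s] by (cases "p n s = 0") (auto simp: mult_nonneg_nonpos)
    then show ?thesis unfolding H by (intro sum_nonneg) auto
  qed
  have sub: "H (m + n) \<le> H m + H n" for m n
  proof -
    let ?S = "{s :: bool list. length s = m}" and ?T = "{t :: bool list. length t = n}"
    define J where "J s t = measure \<mu> ({x. itinerary ?U m x = s} \<inter> {x. itinerary ?U n ((f ^^ m) x) = t})" for s t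
    have fm: "(f ^^ m) \<in> borel_measurable borel" by (rule funpow_borel_measurable[OF f])
    have a: "p m s = (\<Sum>t\<in>?T. J s t)" for s
      unfolding J_def p_def using fin_part[OF itm[of m s] fm, of n] by simp
    have b: "p n t = (\<Sum>s\<in>?S. J s t)" for t
    proof -
      have "(\<Sum>s\<in>?S. J s t) = (\<Sum>s\<in>?S. measure \<mu> ({x. itinerary ?U n ((f ^^ m) x) = t} \<inter> {x. itinerary ?U m (id x) = s}))"
        unfolding J_def by (simp add: Int_commute)
      also have "\<dots> = measure \<mu> ((f ^^ m) -` {x. itinerary ?U n x = t})"
        using fin_part[of "(f ^^ m) -` {x. itinerary ?U n x = t}" id m] funpow_vimage_measurable[OF f itm[of n t], of m]
        by (simp add: vimage_def)
      also have "\<dots> = p n t" unfolding p_def by (rule inv_pow[OF itm])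
      finally show ?thesis by simp
    qed
    have J: "p (m + n) (t @ s) = J s t" if "length s = m" "length t = n" for s t
      unfolding p_def J_def itinerary_add using that by (auto intro!: arg_cong[of _ _ "measure \<mu>"])
    have bij: "bij_betw (\<lambda>(s, t). t @ s) (?S \<times> ?T) {s. length s = m + n}"
    proof (rule bij_betwI[where g = "\<lambda>u. (drop n u, take n u)"])
    qed auto
    have "H (m + n) = (\<Sum>(s, t)\<in>?S \<times> ?T. - J s t * ln (J s t))"
      unfolding H sum.reindex_bij_betw[OF bij, symmetric] by (intro sum.cong refl) (simp add: J mem_Times_iff split_beta)
    also have "\<dots> = (\<Sum>s\<in>?S. \<Sum>t\<in>?T. - J s t * ln (J s t))" by (rule sum.cartesian_product[symmetric])
    also have "\<dots> \<le> H m + H n" unfolding H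
    proof (rule finite_entropy_subadditive[OF finite_length_bool finite_length_bool])
      show "(\<Sum>s\<in>?S. \<Sum>t\<in>?T. J s t) = 1" using a one[of m] by simp
      show "0 \<le> J s t" for s t unfolding J_def by simp
    qed (use a b in auto)
    finally show ?thesis .
  qed
  \<comment> \<open>The rate is defined with \<open>lim\<close>, which carries information only for
    convergent sequences.\<close>
  have conv: "convergent (\<lambda>n. H (Suc n) / Suc n)" by (rule subadditive_convergent[OF sub nn])
  obtain n1 :: nat where n1: "n1 > 2 * \<bar>ln (g / 2)\<bar> / c" using reals_Archimedean2 by blast
  define r where "r = g / 2 * (c / 2)"
  have r: "r > 0" unfolding r_def using g c by simp
  have low: "r \<le> H n / n" if n: "n \<ge> n0" "n \<ge> n1" "n > 0" for n
  proof -
    \<comment> \<open>The square of \<open>e\<close> is the assumed bound on the atoms;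
      \<open>n1\<close> was chosen so that \<open>e \<le> g / 2\<close>, which costs half of
      \<open>g\<close> and half of \<open>c\<close>.\<close>
    define e where "e = exp (- (c * n / 2))"
    have e: "0 < e" "e \<le> 1" unfolding e_def using c by auto
    have e2: "e\<^sup>2 = exp (- c * n)" unfolding e_def by (simp add: exp_double[symmetric])
    have "2 * \<bar>ln (g / 2)\<bar> / c < n" using n1 n(2) by linarith
    then have "\<bar>ln (g / 2)\<bar> < c * n / 2" using c by (simp add: field_simps)
    then have "- (c * n / 2) \<le> ln (g / 2)" by linarith
    then have eg: "e \<le> g / 2" unfolding e_def using g by (metis exp_le_cancel_iff exp_ln half_gt_zero)
    have "(g - e) * (- ln e) \<le> H n" unfolding H
      by (rule finite_entropy_lower_bound[where q = "q n"])
        (use finite_length_bool p01 one q n(1) e e2 in \<open>auto simp: p_def\<close>)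
    moreover have "g / 2 * (c * n / 2) \<le> (g - e) * (- ln e)"
      using eg g c unfolding e_def by (intro mult_mono) auto
    ultimately show ?thesis unfolding r_def using n(3) by (simp add: field_simps)
  qed
  have "r \<le> lim (\<lambda>n. H (Suc n) / Suc n)"
    by (rule LIMSEQ_le_const[OF convergent_LIMSEQ_iff[THEN iffD1, OF conv]])
       (intro exI[of _ "max n0 n1"] allI impI low, auto)
  then have rate: "partition_entropy_rate \<mu> f {A, - A} > 0"
    unfolding partition_entropy_rate_def H_def using r by simp
  have "finite_borel_partition {A, - A}"
    unfolding finite_borel_partition_def using A by auto
  then have "ereal (partition_entropy_rate \<mu> f {A, - A}) \<le> ks_entropy \<mu> f"
    unfolding ks_entropy_def by (intro SUP_upper) auto
  then show ?thesis using rate by (metis ereal_less(2) less_le_trans)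
qed

section \<open>Words of flip-flops and sojourns\<close>

text \<open>A word of \<open>p\<close> bits is a sequence that is \<open>False\<close> from
  \<open>p\<close> on, so that functions of infinite bit sequences can be averaged without
  conversion and averages of different lengths compared.\<close>

definition coin_words :: "nat \<Rightarrow> (nat \<Rightarrow> bool) set" where
  "coin_words p = {c. \<forall>i\<ge>p. \<not> c i}"

definition coin_avg :: "nat \<Rightarrow> ((nat \<Rightarrow> bool) \<Rightarrow> real) \<Rightarrow> real" where
  "coin_avg p h = (\<Sum>c\<in>coin_words p. h c) / 2 ^ p"

definition depends_below :: "nat \<Rightarrow> ((nat \<Rightarrow> bool) \<Rightarrow> 'b) \<Rightarrow> bool" where
  "depends_below p h \<longleftrightarrow> (\<forall>c c'. (\<forall>i<p. c i = c' i) \<longrightarrow> h c = h c')"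

lemma bij_coin_words: "bij_betw (\<lambda>A i. i \<in> A) (Pow {..<p}) (coin_words p)"
  by (rule bij_betwI[where g = Collect]) (auto simp: coin_words_def not_le)

lemma finite_coin_words [simp]: "finite (coin_words p)"
  using bij_betw_finite[OF bij_coin_words[of p]] by simp

lemma card_coin_words [simp]: "card (coin_words p) = 2 ^ p"
  using bij_betw_same_card[OF bij_coin_words[of p]] by (simp add: card_Pow)

lemma sum_coin_words_add:
  "(\<Sum>c\<in>coin_words (p + r). h c)
     = (\<Sum>a\<in>coin_words p. \<Sum>b\<in>coin_words r. h (\<lambda>i. if i < p then a i else b (i - p)))"
proof -
  have bij: "bij_betw (\<lambda>(a, b) i. if i < p then a i else b (i - p)) (coin_words p \<times> coin_words r) (coin_words (p + r))"
    by (rule bij_betwI[where g = "\<lambda>c. (\<lambda>i. i < p \<and> c i, \<lambda>i. c (i + p))"])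
       (auto simp: coin_words_def fun_eq_iff not_less[symmetric])
  show ?thesis
    unfolding sum.reindex_bij_betw[OF bij, symmetric] sum.cartesian_product
    by (intro sum.cong) auto
qed

lemma coin_avg_extend:
  assumes "depends_below p h"
  shows "coin_avg (p + r) h = coin_avg p h"
proof -
  have "h (\<lambda>i. if i < p then a i else b (i - p)) = h a" for a b
    using assms unfolding depends_below_def by (auto intro!: assms[unfolded depends_below_def, rule_format])
  then show ?thesis unfolding coin_avg_def sum_coin_words_add by (simp add: power_add sum_distrib_left[symmetric])
qed

lemma coin_avg_shift: "coin_avg (p + r) (\<lambda>c. h (\<lambda>i. c (i + p))) = coin_avg r h"
  unfolding coin_avg_def sum_coin_words_add by (simp add: power_add)

lemma coin_avg_mono: "(\<And>c. g c \<le> h c) \<Longrightarrow> coin_avg p g \<le> coin_avg p h"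
  unfolding coin_avg_def by (intro divide_right_mono sum_mono) auto

lemma coin_avg_add: "coin_avg p (\<lambda>c. g c + h c) = coin_avg p g + coin_avg p h"
  unfolding coin_avg_def by (simp add: sum.distrib add_divide_distrib)

lemma coin_avg_const [simp]: "coin_avg p (\<lambda>c. b) = b"
  unfolding coin_avg_def by simp

definition birkhoff_sum :: "('a \<Rightarrow> 'a) \<Rightarrow> ('a \<Rightarrow> real) \<Rightarrow> nat \<Rightarrow> 'a \<Rightarrow> real" where
  "birkhoff_sum f \<phi> n x = (\<Sum>i<n. \<phi> ((f ^^ i) x))"

lemma birkhoff_sum_add:
  "birkhoff_sum f \<phi> (m + n) x = birkhoff_sum f \<phi> m x + birkhoff_sum f \<phi> n ((f ^^ m) x)"
proof -
  have "(\<Sum>i<m+n. \<phi> ((f ^^ i) x)) = (\<Sum>i<m. \<phi> ((f ^^ i) x)) + (\<Sum>i<n. \<phi> ((f ^^ (i + m)) x))"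
    by (induction n) (auto simp: add.commute[of m])
  then show ?thesis unfolding birkhoff_sum_def by (simp add: funpow_add)
qed

lemma birkhoff_sum_bound:
  assumes "\<And>x. \<bar>\<phi> x\<bar> \<le> C"
  shows "\<bar>birkhoff_sum f \<phi> n x\<bar> \<le> C * n"
proof -
  have "\<bar>birkhoff_sum f \<phi> n x\<bar> \<le> (\<Sum>i<n. \<bar>\<phi> ((f ^^ i) x)\<bar>)" unfolding birkhoff_sum_def by (rule sum_abs)
  also have "\<dots> \<le> (\<Sum>i<n. C)" using assms by (intro sum_mono) auto
  finally show ?thesis by (simp add: mult.commute)
qed

section \<open>Words, the points following them and their Birkhoff sums\<close>

datatype op = Coin | Flip bool | Sojourn nat

locale flip_flop_sojourn =
  fixes f :: "'a::metric_space \<Rightarrow> 'a" and \<phi> :: "'a \<Rightarrow> real" and Y :: "'a set" and k :: nat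
    and Fp Fm :: "'a set set" and C \<alpha> :: real and N :: "nat \<Rightarrow> nat"
  assumes k_pos: "k > 0" and \<phi>_bound: "\<And>x. \<bar>\<phi> x\<bar> \<le> C" and \<alpha>_pos: "\<alpha> > 0"
    and Fp_avg: "\<And>D x. D \<in> Fp \<Longrightarrow> x \<in> D \<Longrightarrow> birkhoff_avg f \<phi> k x > \<alpha>"
    and Fm_avg: "\<And>D x. D \<in> Fm \<Longrightarrow> x \<in> D \<Longrightarrow> birkhoff_avg f \<phi> k x < - \<alpha>"
    and succ_p: "\<And>D. D \<in> Fp \<union> Fm \<Longrightarrow> \<exists>D'\<in>Fp. D' \<subseteq> (f ^^ k) ` D"
    and succ_m: "\<And>D. D \<in> Fp \<union> Fm \<Longrightarrow> \<exists>D'\<in>Fm. D' \<subseteq> (f ^^ k) ` D"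
    and F_ne: "Fp \<union> Fm \<noteq> {}" and plaque_ne: "\<And>D. D \<in> Fp \<union> Fm \<Longrightarrow> D \<noteq> {}"
    and N_pos: "\<And>n. N n > 0"
    and sojourn: "\<And>n D. D \<in> Fp \<union> Fm \<Longrightarrow> \<exists>D'\<subseteq>D. (f ^^ N n) ` D' \<in> Fp \<union> Fm \<and>
          (\<forall>x\<in>D'. \<forall>y\<in>Y. \<exists>i\<le>N n. dist ((f ^^ i) x) y < 1 / Suc n)"
begin

definition plaques :: "bool \<Rightarrow> 'a set set" where "plaques b = (if b then Fp else Fm)"

primrec duration :: "op \<Rightarrow> nat" where
  "duration Coin = k" | "duration (Flip b) = k" | "duration (Sojourn n) = N n"

text \<open>Measured in iterates of \<open>f\<close>, not in letters.\<close>

definition wlen :: "op list \<Rightarrow> nat" where "wlen w = sum_list (map duration w)"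

primrec target :: "op \<Rightarrow> bool \<Rightarrow> 'a set set" where
  "target Coin b = plaques b" | "target (Flip s) b = plaques s" | "target (Sojourn n) b = Fp \<union> Fm"

primrec visits :: "op \<Rightarrow> 'a \<Rightarrow> bool" where
  "visits Coin x = True" | "visits (Flip s) x = True"
| "visits (Sojourn n) x = (\<forall>y\<in>Y. \<exists>i\<le>N n. dist ((f ^^ i) x) y < 1 / Suc n)"

text \<open>Bits are indexed by time, not by coin steps: a \<open>Coin\<close> at time
  \<open>t\<close> reads \<open>c t\<close>. Hence one application of \<open>f\<close> goes with one
  shift of the bits, and concatenation shifts them by \<open>wlen\<close>. Besides the visits of the
  sojourns, a point only has to lie in the successive plaques; the inclusions between plaques and
  images serve to find such points.\<close>

primrec follows :: "op list \<Rightarrow> 'a set \<Rightarrow> (nat \<Rightarrow> bool) \<Rightarrow> 'a \<Rightarrow> bool" where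
  "follows [] D c x = (x \<in> D)"
| "follows (a # w) D c x = (x \<in> D \<and> visits a x \<and>
     (\<exists>D'\<in>target a (c 0). follows w D' (\<lambda>i. c (i + duration a)) ((f ^^ duration a) x)))"

definition followers :: "op list \<Rightarrow> (nat \<Rightarrow> bool) \<Rightarrow> 'a set" where
  "followers w c = {x. \<exists>D\<in>Fp \<union> Fm. follows w D c x}"

abbreviation S :: "nat \<Rightarrow> 'a \<Rightarrow> real" where "S \<equiv> birkhoff_sum f \<phi>"

lemma wlen_simps [simp]: "wlen [] = 0" "wlen (a # w) = duration a + wlen w" "wlen (w @ v) = wlen w + wlen v"
  unfolding wlen_def by auto

lemma wlen_concat_replicate [simp]: "wlen (concat (replicate q w)) = q * wlen w"
  by (induction q) auto

lemma duration_pos [simp]: "duration a > 0" using k_pos N_pos by (cases a) auto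

lemma plaques_subset: "plaques b \<subseteq> Fp \<union> Fm" unfolding plaques_def by auto

lemma target_subset: "target a b \<subseteq> Fp \<union> Fm" using plaques_subset by (cases a) auto

lemma follows_mem: "follows w D c x \<Longrightarrow> x \<in> D" by (cases w) auto

lemma follows_append:
  "D \<in> Fp \<union> Fm \<Longrightarrow> follows (w @ v) D c x \<Longrightarrow>
     follows w D c x \<and> (f ^^ wlen w) x \<in> followers v (\<lambda>i. c (i + wlen w))"
proof (induction w arbitrary: D c x)
  case Nil
  then show ?case using follows_mem unfolding followers_def by auto
next
  case (Cons a w)
  then obtain D' where D': "D' \<in> target a (c 0)" "x \<in> D" "visits a x"
    "follows (w @ v) D' (\<lambda>i. c (i + duration a)) ((f ^^ duration a) x)" by auto
  have "D' \<in> Fp \<union> Fm" using D'(1) target_subset by auto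
  from Cons.IH[OF this D'(4)] have ih: "follows w D' (\<lambda>i. c (i + duration a)) ((f ^^ duration a) x)"
    "(f ^^ wlen w) ((f ^^ duration a) x) \<in> followers v (\<lambda>i. c (i + wlen w + duration a))" by auto
  have "(f ^^ wlen (a # w)) x = (f ^^ wlen w) ((f ^^ duration a) x)"
    by (simp add: funpow_add add.commute[of "duration a"])
  then show ?case using D' ih by (auto simp: add.assoc add.commute[of "duration a"])
qed

lemma followers_append:
  assumes "x \<in> followers (w @ v) c"
  shows "x \<in> followers w c" "(f ^^ wlen w) x \<in> followers v (\<lambda>i. c (i + wlen w))"
  using assms follows_append unfolding followers_def by blast+

text \<open>Plaques are chosen forwards in time, the point backwards: \<open>D'\<close> lies in the
  image of \<open>D1\<close>, so a follower found in \<open>D'\<close> has a preimage in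
  \<open>D1\<close>.\<close>

lemma follows_nonempty: "D \<in> Fp \<union> Fm \<Longrightarrow> \<exists>x. follows w D c x"
proof (induction w arbitrary: D c)
  case Nil
  then show ?case using plaque_ne by auto
next
  case (Cons a w)
  have "\<exists>D1\<subseteq>D. \<exists>D'\<in>target a (c 0). D' \<subseteq> (f ^^ duration a) ` D1 \<and> (\<forall>x\<in>D1. visits a x)"
  proof (cases a)
    case Coin
    then show ?thesis using succ_p[OF Cons.prems] succ_m[OF Cons.prems]
      by (intro exI[of _ D]) (auto simp: plaques_def)
  next
    case (Flip s)
    then show ?thesis using succ_p[OF Cons.prems] succ_m[OF Cons.prems]
      by (intro exI[of _ D]) (auto simp: plaques_def)
  next
    case (Sojourn n)
    then show ?thesis using sojourn[OF Cons.prems, of n] by fastforce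
  qed
  then obtain D1 D' where D': "D1 \<subseteq> D" "D' \<in> target a (c 0)" "D' \<subseteq> (f ^^ duration a) ` D1" "\<forall>x\<in>D1. visits a x"
    by blast
  have "D' \<in> Fp \<union> Fm" using D'(2) target_subset by auto
  then obtain y where y: "follows w D' (\<lambda>i. c (i + duration a)) y" using Cons.IH by blast
  then obtain x where "x \<in> D1" "y = (f ^^ duration a) x" using D'(3) follows_mem by blast
  then show ?case using D' y by auto
qed

lemma followers_nonempty: "followers w c \<noteq> {}"
  using F_ne follows_nonempty unfolding followers_def by blast

lemma follows_cong: "(\<And>i. i < wlen w \<Longrightarrow> c i = c' i) \<Longrightarrow> follows w D c x = follows w D c' x"
proof (induction w arbitrary: D c c' x)
  case (Cons a w)
  have "c 0 = c' 0" using Cons.prems[of 0] by simp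
  moreover have "follows w D' (\<lambda>i. c (i + duration a)) y = follows w D' (\<lambda>i. c' (i + duration a)) y" for D' y
    using Cons.prems by (intro Cons.IH) auto
  ultimately show ?case by simp
qed simp

lemma followers_cong: "depends_below (wlen w) (followers w)"
  unfolding depends_below_def followers_def using follows_cong by blast

lemma C_nonneg: "C \<ge> 0" using \<phi>_bound[of undefined] by linarith

lemma S_bound: "\<bar>S n x\<bar> \<le> C * n"
  by (rule birkhoff_sum_bound[OF \<phi>_bound])

definition upper :: "op list \<Rightarrow> (nat \<Rightarrow> bool) \<Rightarrow> real" where
  "upper w c = (SUP x\<in>followers w c. S (wlen w) x)"

definition mean_upper :: "op list \<Rightarrow> real" where
  "mean_upper w = coin_avg (wlen w) (upper w)"

lemma upper_bdd: "bdd_above (S n ` A)"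
  using S_bound by (intro bdd_aboveI2[of _ _ "C * n"]) (meson abs_le_D1)

lemma le_upper: "x \<in> followers w c \<Longrightarrow> S (wlen w) x \<le> upper w c"
  unfolding upper_def by (rule cSUP_upper[OF _ upper_bdd])

lemma upper_le: "(\<And>x. x \<in> followers w c \<Longrightarrow> S (wlen w) x \<le> b) \<Longrightarrow> upper w c \<le> b"
  unfolding upper_def by (rule cSUP_least[OF followers_nonempty])

lemma upper_cong: "depends_below (wlen w) (upper w)"
  using followers_cong[of w] unfolding depends_below_def upper_def by metis

text \<open>A follower of \<open>w @ v\<close> follows \<open>w\<close> and then \<open>v\<close>
  with shifted bits, and \<open>upper w\<close> ignores the later bits, so the mean of the sum
  splits.\<close>

lemma mean_upper_append: "mean_upper (w @ v) \<le> mean_upper w + mean_upper v"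
proof -
  have "upper (w @ v) c \<le> upper w c + upper v (\<lambda>i. c (i + wlen w))" for c
  proof (rule upper_le)
    fix x assume "x \<in> followers (w @ v) c"
    from le_upper[OF followers_append(1)[OF this]] le_upper[OF followers_append(2)[OF this]]
    show "S (wlen (w @ v)) x \<le> upper w c + upper v (\<lambda>i. c (i + wlen w))"
      by (simp add: birkhoff_sum_add)
  qed
  then have "mean_upper (w @ v) \<le> coin_avg (wlen w + wlen v) (\<lambda>c. upper w c + upper v (\<lambda>i. c (i + wlen w)))"
    unfolding mean_upper_def wlen_simps by (rule coin_avg_mono)
  also have "\<dots> = mean_upper w + mean_upper v"
    unfolding mean_upper_def coin_avg_add coin_avg_shift coin_avg_extend[OF upper_cong] ..
  finally show ?thesis .
qed

lemma mean_upper_power: "mean_upper (concat (replicate q w)) \<le> q * mean_upper w"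
proof (induction q)
  case 0
  have "mean_upper [] \<le> 0" unfolding mean_upper_def
    using coin_avg_mono[of "upper []" "\<lambda>_. 0"] upper_le[of "[]" _ 0] by (simp add: birkhoff_sum_def)
  then show ?case by simp
next
  case (Suc q)
  then show ?case using mean_upper_append[of w "concat (replicate q w)"] by (simp add: algebra_simps)
qed

lemma mean_upper_le: "(\<And>c x. x \<in> followers w c \<Longrightarrow> S (wlen w) x \<le> b) \<Longrightarrow> mean_upper w \<le> b"
  unfolding mean_upper_def using coin_avg_mono[of "upper w" "\<lambda>_. b" "wlen w"] upper_le by simp

text \<open>A predicate instead of an infimum: the bound is carried along as a number, whose ratio
  to \<open>wlen w\<close> telescopes in the summability argument.\<close>

definition lower :: "op list \<Rightarrow> real \<Rightarrow> bool" where
  "lower w b \<longleftrightarrow> (\<forall>c. \<forall>x\<in>followers w c. b \<le> S (wlen w) x)"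

lemma lower_le_mean_upper: "lower w b \<Longrightarrow> b \<le> mean_upper w"
proof -
  assume l: "lower w b"
  have "b \<le> upper w c" for c
  proof -
    obtain x where x: "x \<in> followers w c" using followers_nonempty by blast
    then show ?thesis using l le_upper[OF x] unfolding lower_def by (meson order_trans)
  qed
  then show ?thesis
    unfolding mean_upper_def using coin_avg_mono[of "\<lambda>_. b" "upper w" "wlen w"] by simp
qed

lemma lower_append: "lower w b \<Longrightarrow> lower v d \<Longrightarrow> lower (w @ v) (b + d)"
  unfolding lower_def by (auto simp: birkhoff_sum_add intro!: add_mono dest: followers_append)

lemma lower_power: "lower w b \<Longrightarrow> lower (concat (replicate q w)) (q * b)"
proof (induction q)
  case 0
  then show ?case unfolding lower_def by (simp add: birkhoff_sum_def)
next
  case (Suc q)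
  then show ?case using lower_append[of w b "concat (replicate q w)" "q * b"] by (simp add: algebra_simps)
qed

lemma lower_trivial: "lower w (- (C * wlen w))"
  unfolding lower_def using S_bound[of "wlen w"] by (auto simp: abs_le_iff) (smt (verit))

lemma mean_upper_bound: "mean_upper w \<le> C * wlen w"
  using S_bound[of "wlen w"] by (intro mean_upper_le) (meson abs_le_D1)

section \<open>Fillers of definite sign\<close>

lemma plaque_sum:
  assumes "D \<in> plaques b" "x \<in> D"
  shows "(if b then 1 else - 1) * S k x \<ge> k * \<alpha>"
proof -
  have "S k x = k * birkhoff_avg f \<phi> k x"
    unfolding birkhoff_avg_def birkhoff_sum_def using k_pos by simp
  moreover have "(if b then 1 else - 1) * birkhoff_avg f \<phi> k x \<ge> \<alpha>"
    using Fp_avg[of D x] Fm_avg[of D x] assms by (cases b) (auto simp: plaques_def)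
  then have "k * ((if b then 1 else - 1) * birkhoff_avg f \<phi> k x) \<ge> k * \<alpha>" by (intro mult_left_mono) auto
  ultimately show ?thesis by (simp add: algebra_simps)
qed

text \<open>The plaque reached by a flip governs the \<open>k\<close> iterates after it. So
  \<open>m\<close> flips starting in a plaque of sign \<open>b\<close> have \<open>m\<close>
  controlled stretches, counted from the starting plaque on.\<close>

lemma flips_sum:
  "D \<in> plaques b \<Longrightarrow> follows (replicate m (Flip b)) D c x \<Longrightarrow>
     (if b then 1 else - 1) * S (m * k) x \<ge> m * (k * \<alpha>)"
proof (induction m arbitrary: D c x)
  case 0
  then show ?case by (simp add: birkhoff_sum_def)
next
  case (Suc m)
  then obtain D' where D': "D' \<in> plaques b" "x \<in> D"
    "follows (replicate m (Flip b)) D' (\<lambda>i. c (i + k)) ((f ^^ k) x)" by auto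
  have "(if b then 1 else - 1) * S (Suc m * k) x
      = (if b then 1 else - 1) * S k x + (if b then 1 else - 1) * S (m * k) ((f ^^ k) x)"
    by (simp add: birkhoff_sum_add)
  also have "\<dots> \<ge> k * \<alpha> + m * (k * \<alpha>)"
    using plaque_sum[OF Suc.prems(1) D'(2)] Suc.IH[OF D'(1,3)] by (intro add_mono)
  finally show ?case by (simp add: algebra_simps)
qed

text \<open>In a macro the first \<open>k\<close> iterates start in a plaque of unknown sign and the
  next \<open>k\<close> in one chosen by the coin, at a cost of at most \<open>2 * C * k\<close>.
  Each further stretch gains \<open>k * \<alpha>\<close>, and \<open>flips\<close> of them leave a
  surplus of at least 1. The separate \<open>Flip b\<close> in \<open>macro\<close> leads to the
  first plaque of sign \<open>b\<close>.\<close>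

definition flips :: nat where "flips = nat \<lceil>(2 * C * k + 1) / (k * \<alpha>)\<rceil>"

definition macro :: "bool \<Rightarrow> op list" where "macro b = Coin # Flip b # replicate flips (Flip b)"

definition mlen :: nat where "mlen = (flips + 2) * k"

lemma wlen_macro [simp]: "wlen (macro b) = mlen"
proof -
  have "wlen (replicate n (Flip b)) = n * k" for n by (induction n) auto
  then show ?thesis unfolding macro_def mlen_def by simp
qed

lemma mlen_pos: "mlen > 0" unfolding mlen_def using k_pos by simp

lemma macro_sum:
  assumes "x \<in> followers (macro b) c"
  shows "(if b then 1 else - 1) * S mlen x \<ge> 1"
proof -
  let ?s = "if b then 1 else - 1 :: real"
  obtain D'' where D: "D'' \<in> plaques b" "follows (replicate flips (Flip b)) D'' (\<lambda>i. c (i + k + k)) ((f ^^ k) ((f ^^ k) x))"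
    using assms unfolding followers_def macro_def by auto
  have "(2 * C * k + 1) / (k * \<alpha>) \<le> flips" unfolding flips_def by linarith
  then have fl: "2 * C * k + 1 \<le> flips * (k * \<alpha>)" using k_pos \<alpha>_pos by (simp add: field_simps)
  have m: "mlen = k + (k + flips * k)" unfolding mlen_def by (simp add: algebra_simps)
  have "?s * S mlen x = ?s * S k x + ?s * S k ((f ^^ k) x) + ?s * S (flips * k) ((f ^^ k) ((f ^^ k) x))"
    unfolding m birkhoff_sum_add by (simp add: algebra_simps)
  moreover have sk: "?s * S k z \<ge> - (C * k)" for z
    using S_bound[of k z] by (auto simp: abs_le_iff)
  ultimately show ?thesis
    using flips_sum[OF D] fl sk[of x] sk[of "(f ^^ k) x"] by linarith
qed

text \<open>The coin is visible \<open>k\<close> iterates after the start of the macro, in the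
  plaque it selected. This is what the entropy estimate reads.\<close>

lemma macro_coin:
  assumes "x \<in> followers (macro b) c"
  shows "if c 0 then birkhoff_avg f \<phi> k ((f ^^ k) x) > \<alpha> else birkhoff_avg f \<phi> k ((f ^^ k) x) < - \<alpha>"
proof -
  obtain D' where "D' \<in> plaques (c 0)" "(f ^^ k) x \<in> D'"
    using assms unfolding followers_def macro_def by auto
  then show ?thesis using Fp_avg[of D'] Fm_avg[of D'] by (auto simp: plaques_def)
qed

text \<open>The last inequality controls the proportion of time outside the copies of
  \<open>w\<close>. Each of the \<open>r * p\<close> copies of \<open>macro True\<close> raises the
  lower bound by 1, so their density is at most the increase of the lower bound per unit of time, up
  to an error from the sojourns and the copies of \<open>macro False\<close>.\<close>

lemma next_word:
  assumes p: "wlen w = p" "p > 0" and U: "mean_upper w \<le> 0" and L: "lower w b"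
  obtains q v w' b' where "w' = concat (replicate q w) @ Sojourn n # v" "q > 0" "p dvd wlen w'" "N n + q * p \<le> wlen w'"
    "mean_upper w' \<le> 0" "- ((1/2)^n * wlen w') \<le> mean_upper w'" "lower w' b'"
    "1 - real (q * p) / wlen w' \<le> (1/2)^n + mlen * (b' / wlen w' - b / p + (1/2)^n)"
proof -
  \<comment> \<open>\<open>m\<close> copies of \<open>macro False\<close> pay for one sojourn, whose
    sum is at most \<open>C * N n\<close>.\<close>
  define m where "m = nat \<lceil>C * N n\<rceil>"
  have m: "C * N n \<le> m" unfolding m_def by linarith
  \<comment> \<open>All filler counts are multiples of \<open>p\<close>, so that \<open>p\<close>
    divides the new length and the phases of the two levels are compatible.\<close>
  define so where "so = replicate p (Sojourn n)"
  define mi where "mi = concat (replicate (m * p) (macro False))"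
  define pl where "pl r = concat (replicate (r * p) (macro True))" for r
  define E0 where "E0 = p * N n + m * p * mlen"
  have "wlen (replicate p (Sojourn n)) = p * N n" by (induction p) auto
  then have wl: "wlen so = p * N n" "wlen mi = m * p * mlen" "wlen (pl r) = r * p * mlen" for r
    unfolding so_def mi_def pl_def by simp_all
  \<comment> \<open>Both the time and the sum of the fixed fillers, together with one batch of
    \<open>p\<close> copies of \<open>macro True\<close>, become at most the fraction
    \<open>(1/2)^n\<close> of the time spent in the copies of \<open>w\<close>.\<close>
  obtain q :: nat where q: "2 ^ n * ((1 + C) * (E0 + mlen * p)) < q * p"
  proof -
    obtain q :: nat where "2 ^ n * ((1 + C) * (E0 + mlen * p)) < q" using reals_Archimedean2 by blast
    also have "real q \<le> real (q * p)" using p(2) by (cases p) auto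
    finally show ?thesis using that by simp
  qed
  have nonneg: "0 \<le> (1 + C) * (E0 + mlen * p)" using C_nonneg by simp
  have "0 \<le> 2 ^ n * ((1 + C) * (E0 + mlen * p))" by (rule mult_nonneg_nonneg[OF _ nonneg]) simp
  then have qpos: "q > 0" using q by (cases "q = 0") auto
  have qh: "(1 + C) * (E0 + mlen * p) \<le> (1/2)^n * (q * p)"
    using q by (simp add: power_divide field_simps)
  define base where "base = concat (replicate q w) @ so @ mi"
  have lb: "wlen base = q * p + E0" unfolding base_def E0_def using wl p by simp
  have soU: "mean_upper so \<le> C * (p * N n)" using mean_upper_bound[of so] wl by simp
  have "mean_upper (macro False) \<le> - 1"
    using macro_sum[of _ False] by (intro mean_upper_le) fastforce
  then have "real (m * p) * mean_upper (macro False) \<le> real (m * p) * (- 1)" by (intro mult_left_mono) auto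
  then have miU: "mean_upper mi \<le> - real (m * p)" using mean_upper_power[of "m * p" "macro False"] unfolding mi_def by simp
  have wU: "mean_upper (concat (replicate q w)) \<le> 0"
    using mean_upper_power[of q w] U by (meson mult_nonneg_nonpos of_nat_0_le_iff order_trans)
  have "C * N n * p \<le> real m * p" using m by (intro mult_right_mono) auto
  then have baseU: "mean_upper base \<le> 0"
    using mean_upper_append[of "concat (replicate q w)" "so @ mi"] mean_upper_append[of so mi] soU miU wU
    unfolding base_def by (simp add: algebra_simps)
  have "lower (so @ mi) (- (C * E0))"
    using lower_trivial[of "so @ mi"] wl unfolding E0_def by simp
  then have baseL: "lower base (q * b - C * E0)"
    using lower_append[OF lower_power[OF L, of q]] unfolding base_def by fastforce
  have "lower (macro True) 1" using macro_sum[of _ True] unfolding lower_def by simp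
  then have plL: "lower (pl r) (r * p)" for r using lower_power[of "macro True" 1 "r * p"] unfolding pl_def by simp
  define W where "W r = base @ pl r" for r
  have WL: "lower (W r) (q * b - C * E0 + r * p)" for r
    unfolding W_def by (rule lower_append[OF baseL plL])
  have Wlen: "wlen (W r) = q * p + E0 + r * p * mlen" for r unfolding W_def using lb wl by simp
  \<comment> \<open>Here \<open>lower\<close> bounds \<open>mean_upper\<close> from below: enough
    copies of \<open>macro True\<close> make the mean positive, so there is a last \<open>r\<close>
    before this first happens.\<close>
  have "\<exists>r. \<not> mean_upper (W r) \<le> 0"
  proof -
    obtain r :: nat where r: "\<bar>q * b - C * E0\<bar> < r" using reals_Archimedean2 by blast
    have "real r \<le> real r * real p" using p(2) mult_left_mono[of 1 "real p" "real r"] by simp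
    then have "0 < q * b - C * E0 + r * p" using r by simp
    then show ?thesis using lower_le_mean_upper[OF WL[of r]] by (intro exI[of _ r]) simp
  qed
  then obtain r' where r': "\<not> mean_upper (W r') \<le> 0" "\<And>r. r < r' \<Longrightarrow> mean_upper (W r) \<le> 0"
    using exists_least_iff[of "\<lambda>r. \<not> mean_upper (W r) \<le> 0"] by blast
  have "mean_upper (W 0) \<le> 0" using baseU unfolding W_def pl_def by simp
  then obtain r where r: "r' = Suc r" using r'(1) by (cases r') auto
  have Ur: "mean_upper (W r) \<le> 0" using r'(2) r by simp
  have "Suc r * p = r * p + 1 * p" by simp
  then have "W r' = W r @ pl 1"
    unfolding W_def pl_def r by (simp only: replicate_add concat_append append_assoc)
  then have "mean_upper (W r') \<le> mean_upper (W r) + C * (p * mlen)"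
    using mean_upper_append[of "W r" "pl 1"] mean_upper_bound[of "pl 1"] wl(3)[of 1] by simp
  \<comment> \<open>The next batch makes the mean positive and adds at most
    \<open>C * (p * mlen)\<close>, so the mean was already close to 0.\<close>
  then have U1: "- (C * (p * mlen)) \<le> mean_upper (W r)" using r'(1) by simp
  let ?P = "wlen (W r)"
  have qP: "real (q * p) \<le> ?P" unfolding Wlen by simp
  have Ppos: "real ?P > 0" using qpos p(2) qP by (meson less_le_trans mult_pos_pos of_nat_0_less_iff)
  have E_le: "(1 + C) * E0 \<le> (1/2)^n * ?P" "C * (mlen * p) \<le> (1/2)^n * ?P"
  proof -
    have *: "(1/2)^n * real (q * p) \<le> (1/2)^n * ?P" using qP by (intro mult_left_mono) auto
    have a: "(1 + C) * E0 \<le> (1 + C) * (E0 + mlen * p)" using C_nonneg by (intro mult_left_mono) auto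
    have "C * (mlen * p) \<le> (1 + C) * (E0 + mlen * p)" using C_nonneg by (intro mult_mono) auto
    then show "C * (mlen * p) \<le> (1/2)^n * ?P" using * qh by linarith
    show "(1 + C) * E0 \<le> (1/2)^n * ?P" using * qh a by linarith
  qed
  show ?thesis
  proof (rule that)
    have "so = Sojourn n # replicate (p - 1) (Sojourn n)" unfolding so_def using p(2) by (cases p) auto
    then show "W r = concat (replicate q w) @ Sojourn n # (replicate (p - 1) (Sojourn n) @ mi @ pl r)"
      unfolding W_def base_def by simp
    show "q > 0" by (rule qpos)
    show "p dvd ?P" unfolding Wlen E0_def by simp
    show "N n + q * p \<le> ?P"
    proof -
      have "N n \<le> p * N n" using p(2) by (cases p) auto
      then show ?thesis unfolding Wlen E0_def by linarith
    qed
    show "mean_upper (W r) \<le> 0" by (rule Ur)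
    show "- ((1/2)^n * ?P) \<le> mean_upper (W r)" using U1 E_le(2) by (simp add: mult.commute mult.left_commute)
    show "lower (W r) (q * b - C * E0 + r * p)" by (rule WL)
    have b0: "b \<le> 0" using lower_le_mean_upper[OF L] U by simp
    have "b / p * ?P \<le> b / p * (q * p)" using b0 qP by (intro mult_left_mono_neg) (auto simp: divide_nonpos_nonneg)
    then have qb: "b / p * ?P \<le> q * b" using p(2) by (simp add: mult.commute)
    have "C * E0 \<le> (1/2)^n * ?P" using E_le(1) by (simp add: algebra_simps)
    then have "real (r * p) \<le> (q * b - C * E0 + r * p) - b / p * ?P + (1/2)^n * ?P" using qb by simp
    then have "real (r * p) / ?P \<le> ((q * b - C * E0 + r * p) - b / p * ?P + (1/2)^n * ?P) / ?P"
      using Ppos by (intro divide_right_mono) auto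
    also have "\<dots> = (q * b - C * E0 + r * p) / ?P - b / p + (1/2)^n"
      using Ppos by (simp add: add_divide_distrib diff_divide_distrib)
    finally have rp: "real (r * p) / ?P \<le> (q * b - C * E0 + r * p) / ?P - b / p + (1/2)^n" .
    have "real ?P = real (q * p) + E0 + mlen * real (r * p)" unfolding Wlen by simp
    then have "E0 + mlen * real (r * p) = ?P - real (q * p)" by simp
    then have "1 - real (q * p) / ?P = (E0 + mlen * real (r * p)) / ?P"
      using Ppos by (simp add: diff_divide_distrib)
    then have "1 - real (q * p) / ?P = E0 / ?P + mlen * (real (r * p) / ?P)"
      by (simp add: add_divide_distrib)
    moreover have "E0 / ?P \<le> (1/2)^n"
    proof -
      have "real E0 \<le> (1 + C) * E0" using C_nonneg by (simp add: algebra_simps)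
      then show ?thesis using E_le(1) Ppos by (simp add: divide_le_eq)
    qed
    moreover have "mlen * (real (r * p) / ?P) \<le> mlen * ((q * b - C * E0 + r * p) / ?P - b / p + (1/2)^n)"
      using rp by (intro mult_left_mono) auto
    ultimately show "1 - real (q * p) / ?P \<le> (1/2)^n + mlen * ((q * b - C * E0 + r * p) / ?P - b / p + (1/2)^n)"
      by linarith
  qed
qed

text \<open>The bounds of \<open>next_word\<close> telescope: with
  \<open>l n = b n / wlen (w n) \<le> 0\<close> the filler proportions add up to at most
  \<open>2 + mlen * (2 - l 0)\<close>. The first word is a macro because it begins with a coin, so
  that each of its copies carries a visible bit.\<close>

lemma word_hierarchy:
  obtains w :: "nat \<Rightarrow> op list" and q :: "nat \<Rightarrow> nat" and v where
    "w 0 = macro False"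
    "\<And>n. w (Suc n) = concat (replicate (q n) (w n)) @ Sojourn n # v n" "\<And>n. q n > 0"
    "\<And>n. wlen (w n) dvd wlen (w (Suc n))" "\<And>n. N n + q n * wlen (w n) \<le> wlen (w (Suc n))"
    "\<And>n. wlen (w n) > 0"
    "\<And>n. mean_upper (w n) \<le> 0" "\<And>n. - ((1/2)^n * wlen (w (Suc n))) \<le> mean_upper (w (Suc n))"
    "summable (\<lambda>n. 1 - real (q n * wlen (w n)) / wlen (w (Suc n)))"
proof -
  \<comment> \<open>\<open>q\<close> and \<open>v\<close> are stored in the state together with the
    word they produced; at stage 0 they are dummies.\<close>
  define good where "good n s \<longleftrightarrow> (case s of (w, b, q, v) \<Rightarrow> wlen w > 0 \<and> mean_upper w \<le> 0 \<and> lower w b)"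
    for n :: nat and s :: "op list \<times> real \<times> nat \<times> op list"
  define R where "R n s s' \<longleftrightarrow> (case s of (w, b, _, _) \<Rightarrow> case s' of (w', b', q, v) \<Rightarrow>
      w' = concat (replicate q w) @ Sojourn n # v \<and> q > 0 \<and> wlen w dvd wlen w' \<and> N n + q * wlen w \<le> wlen w' \<and>
      - ((1/2)^n * wlen w') \<le> mean_upper w' \<and>
      1 - real (q * wlen w) / wlen w' \<le> (1/2)^n + mlen * (b' / wlen w' - b / wlen w + (1/2)^n))"
    for n :: nat and s s' :: "op list \<times> real \<times> nat \<times> op list"
  have "mean_upper (macro False) \<le> 0"
    using macro_sum[of _ False] by (intro mean_upper_le) fastforce
  then have g0: "good 0 (macro False, - (C * mlen), 0, [])"
    unfolding good_def using mlen_pos lower_trivial[of "macro False"] by simp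
  have step: "\<exists>s'. good (Suc n) s' \<and> R n s s'" if "good n s" for n s
  proof -
    obtain w b q0 v0 where s: "s = (w, b, q0, v0)" by (cases s) auto
    have w: "wlen w > 0" "mean_upper w \<le> 0" "lower w b" using that unfolding good_def s by auto
    obtain q v w' b' where *: "w' = concat (replicate q w) @ Sojourn n # v" "q > 0" "wlen w dvd wlen w'" "N n + q * wlen w \<le> wlen w'"
      "mean_upper w' \<le> 0" "- ((1/2)^n * wlen w') \<le> mean_upper w'" "lower w' b'"
      "1 - real (q * wlen w) / wlen w' \<le> (1/2)^n + mlen * (b' / wlen w' - b / wlen w + (1/2)^n)"
      by (rule next_word[OF refl w])
    have "wlen w' > 0" using *(4) N_pos[of n] by simp
    then have "good (Suc n) (w', b', q, v) \<and> R n s (w', b', q, v)"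
      unfolding good_def R_def s using * by simp
    then show ?thesis by blast
  qed
  obtain s where s: "s 0 = (macro False, - (C * mlen), 0, [])" "\<And>n. good n (s n)" "\<And>n. R n (s n) (s (Suc n))"
  proof -
    have "\<exists>s. s 0 = (macro False, - (C * mlen), 0, []) \<and> (\<forall>n. good n (s n) \<and> R n (s n) (s (Suc n)))"
      using dependent_nat_choice[of "\<lambda>n s. good n s \<and> (n = 0 \<longrightarrow> s = (macro False, - (C * mlen), 0, []))" R]
        g0 step by blast
    then show ?thesis using that by blast
  qed
  define w where "w n = fst (s n)" for n
  define b where "b n = fst (snd (s n))" for n
  define q where "q n = fst (snd (snd (s (Suc n))))" for n
  define v where "v n = snd (snd (snd (s (Suc n))))" for n
  have G: "wlen (w n) > 0" "mean_upper (w n) \<le> 0" "lower (w n) (b n)" for n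
    using s(2)[of n] unfolding good_def w_def b_def by (auto simp: split_beta)
  have Rn: "w (Suc n) = concat (replicate (q n) (w n)) @ Sojourn n # v n" "q n > 0" "wlen (w n) dvd wlen (w (Suc n))"
    "N n + q n * wlen (w n) \<le> wlen (w (Suc n))" "- ((1/2)^n * wlen (w (Suc n))) \<le> mean_upper (w (Suc n))"
    "1 - real (q n * wlen (w n)) / wlen (w (Suc n)) \<le> (1/2)^n + mlen * (b (Suc n) / wlen (w (Suc n)) - b n / wlen (w n) + (1/2)^n)" for n
    using s(3)[of n] unfolding R_def w_def b_def q_def v_def by (auto simp: split_beta)
  define l where "l n = b n / wlen (w n)" for n
  have l: "l n \<le> 0" for n
    unfolding l_def using lower_le_mean_upper[OF G(3)[of n]] G(2)[of n] by (auto intro: divide_nonpos_nonneg)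
  have gn: "0 \<le> 1 - real (q n * wlen (w n)) / wlen (w (Suc n))" for n
    using Rn(4)[of n] G(1)[of "Suc n"] by (simp add: divide_le_eq flip: of_nat_mult)
  have "summable (\<lambda>n. 1 - real (q n * wlen (w n)) / wlen (w (Suc n)))"
  proof (rule bounded_imp_summable[OF gn])
    fix n
    have geo: "(\<Sum>i\<le>n. (1/2::real)^i) \<le> 2"
      using sum_le_suminf[of "\<lambda>i. (1/2::real)^i" "{..n}"] suminf_geometric[of "1/2::real"] by simp
    have tel: "(\<Sum>i\<le>n. l (Suc i) - l i) = l (Suc n) - l 0" by (induction n) auto
    have "(\<Sum>i\<le>n. 1 - real (q i * wlen (w i)) / wlen (w (Suc i)))
        \<le> (\<Sum>i\<le>n. (1/2)^i + mlen * (l (Suc i) - l i + (1/2)^i))"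
      using Rn(6) unfolding l_def by (intro sum_mono) auto
    also have "\<dots> = (\<Sum>i\<le>n. (1/2)^i) + mlen * ((\<Sum>i\<le>n. l (Suc i) - l i) + (\<Sum>i\<le>n. (1/2)^i))"
      by (simp only: sum.distrib sum_distrib_left distrib_left)
    also have "\<dots> \<le> 2 + mlen * (- l 0 + 2)"
      unfolding tel using geo l[of "Suc n"] by (intro add_mono mult_left_mono) auto
    finally show "(\<Sum>i\<le>n. 1 - real (q i * wlen (w i)) / wlen (w (Suc i))) \<le> 2 + mlen * (- l 0 + 2)" .
  qed
  moreover have "w 0 = macro False" unfolding w_def s(1) by simp
  ultimately show ?thesis using that[of w q v] Rn G by blast
qed

end

section \<open>Invariant measures of the coded system\<close>

text \<open>Discrete metrics make bit and phase sequences metric spaces, so that the results on weak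
  limits apply to states.\<close>

instantiation bool :: metric_space
begin

definition dist_bool :: "bool \<Rightarrow> bool \<Rightarrow> real" where
  "dist_bool x y = (if x = y then 0 else 1)"

definition uniformity_bool :: "(bool \<times> bool) filter" where
  "uniformity_bool = (INF e\<in>{0<..}. principal {(x, y). dist x y < e})"

instance
proof
  fix U :: "bool set"
  have "eventually (\<lambda>(x', y). x' = x \<longrightarrow> y \<in> U) uniformity" if "x \<in> U" for x
    unfolding uniformity_bool_def
    by (rule eventually_INF1[of 1]) (use that in \<open>auto simp: eventually_principal dist_bool_def split: if_splits\<close>)
  then show "open U \<longleftrightarrow> (\<forall>x\<in>U. \<forall>\<^sub>F (x', y) in uniformity. x' = x \<longrightarrow> y \<in> U)"
    using discrete_topology_class.open_discrete[of U] by blast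
qed (auto simp: dist_bool_def uniformity_bool_def)

end

instantiation nat :: metric_space
begin

definition dist_nat :: "nat \<Rightarrow> nat \<Rightarrow> real" where
  "dist_nat x y = (if x = y then 0 else 1)"

definition uniformity_nat :: "(nat \<times> nat) filter" where
  "uniformity_nat = (INF e\<in>{0<..}. principal {(x, y). dist x y < e})"

instance
proof
  fix U :: "nat set"
  have "eventually (\<lambda>(x', y). x' = x \<longrightarrow> y \<in> U) uniformity" if "x \<in> U" for x
    unfolding uniformity_nat_def
    by (rule eventually_INF1[of 1]) (use that in \<open>auto simp: eventually_principal dist_nat_def split: if_splits\<close>)
  then show "open U \<longleftrightarrow> (\<forall>x\<in>U. \<forall>\<^sub>F (x', y) in uniformity. x' = x \<longrightarrow> y \<in> U)"
    using discrete_topology_class.open_discrete[of U] by blast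
qed (auto simp: dist_nat_def uniformity_nat_def)

end

section \<open>The space of states and the block system on it\<close>

lemma compact_Pi_finite:
  fixes F :: "nat \<Rightarrow> 'b::topological_space set"
  assumes "\<And>n. finite (F n)"
  shows "compact {x. \<forall>n. x n \<in> F n}"
proof -
  have "compactin (product_topology (\<lambda>_::nat. euclidean :: 'b topology) UNIV) (PiE UNIV F)"
    unfolding compactin_PiE using assms by (auto simp: finite_imp_compact)
  moreover have "PiE UNIV F = {x. \<forall>n. x n \<in> F n}" by auto
  ultimately show ?thesis unfolding euclidean_product_topology compactin_euclidean_iff by simp
qed

type_synonym 'a state = "'a \<times> (nat \<Rightarrow> bool) \<times> (nat \<Rightarrow> nat)"

abbreviation coin :: "'a state \<Rightarrow> nat \<Rightarrow> bool" where "coin \<omega> \<equiv> fst (snd \<omega>)"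
abbreviation phase :: "'a state \<Rightarrow> nat \<Rightarrow> nat" where "phase \<omega> \<equiv> snd (snd \<omega>)"

lemma coin_cont: "continuous_on UNIV (\<lambda>\<omega>::'a::metric_space state. coin \<omega> i)"
  by (rule continuous_on_product_then_coordinatewise[OF continuous_on_fst[OF continuous_on_snd[OF continuous_on_id]]])

lemma phase_cont: "continuous_on UNIV (\<lambda>\<omega>::'a::metric_space state. phase \<omega> i)"
  by (rule continuous_on_product_then_coordinatewise[OF continuous_on_snd[OF continuous_on_snd[OF continuous_on_id]]])

lemma finite_coordinates_open:
  fixes A :: "'a::metric_space state set"
  assumes "\<forall>\<omega> \<omega>'. (\<forall>i<M. coin \<omega> i = coin \<omega>' i \<and> phase \<omega> i = phase \<omega>' i) \<longrightarrow> \<omega> \<in> A \<longrightarrow> \<omega>' \<in> A"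
  shows "open A"
proof -
  have o1: "open {\<omega>::'a state. coin \<omega> i = b}" for i b
    using open_vimage[OF discrete_topology_class.open_discrete[of "{b}"] coin_cont[of i]] by (simp add: vimage_def)
  have o2: "open {\<omega>::'a state. phase \<omega> i = b}" for i b
    using open_vimage[OF discrete_topology_class.open_discrete[of "{b}"] phase_cont[of i]] by (simp add: vimage_def)
  define box :: "'a state \<Rightarrow> 'a state set" where
    "box \<omega>0 = (\<Inter>i<M. {\<omega>. coin \<omega> i = coin \<omega>0 i} \<inter> {\<omega>. phase \<omega> i = phase \<omega>0 i})" for \<omega>0
  have box: "open (box \<omega>0)" for \<omega>0
    unfolding box_def by (intro open_INT open_Int o1 o2 ballI) simp
  have mem: "\<omega> \<in> box \<omega>0 \<longleftrightarrow> (\<forall>i<M. coin \<omega>0 i = coin \<omega> i \<and> phase \<omega>0 i = phase \<omega> i)" for \<omega> \<omega>0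
    unfolding box_def by auto
  have "A = (\<Union>\<omega>0\<in>A. box \<omega>0)" using assms mem by blast
  moreover have "open (\<Union>\<omega>0\<in>A. box \<omega>0)" using box by (rule open_UN[OF ballI])
  ultimately show ?thesis by simp
qed

lemma finite_coordinates_clopen:
  fixes A :: "'a::metric_space state set"
  assumes "\<forall>\<omega> \<omega>'. (\<forall>i<M. coin \<omega> i = coin \<omega>' i \<and> phase \<omega> i = phase \<omega>' i) \<longrightarrow> \<omega> \<in> A \<longrightarrow> \<omega>' \<in> A"
  shows "open A" "closed A"
proof -
  show "open A" by (rule finite_coordinates_open[OF assms])
  have "\<forall>\<omega> \<omega>'. (\<forall>i<M. coin \<omega> i = coin \<omega>' i \<and> phase \<omega> i = phase \<omega>' i) \<longrightarrow> \<omega> \<in> - A \<longrightarrow> \<omega>' \<in> - A"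
  proof (intro allI impI)
    fix \<omega> \<omega>' :: "'a state"
    assume eq: "\<forall>i<M. coin \<omega> i = coin \<omega>' i \<and> phase \<omega> i = phase \<omega>' i" and "\<omega> \<in> - A"
    have "\<forall>i<M. coin \<omega>' i = coin \<omega> i \<and> phase \<omega>' i = phase \<omega> i" using eq by metis
    then have "\<omega>' \<in> A \<longrightarrow> \<omega> \<in> A" using assms by blast
    then show "\<omega>' \<in> - A" using \<open>\<omega> \<in> - A\<close> by blast
  qed
  then have "open (- A)" by (rule finite_coordinates_open)
  then show "closed A" by (simp add: closed_def)
qed

text \<open>What is kept of the words: \<open>p n\<close> is the duration of the
  level-\<open>n\<close> word, \<open>W n c\<close> its followers with bits \<open>c\<close>, and
  the first \<open>q n * p n\<close> iterates of a level-\<open>Suc n\<close> word consist of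
  level-\<open>n\<close> words. The inequalities in \<open>W_coin\<close> and \<open>W_dense\<close>
  are weak ones because measures obtained as limits only see the closures of the sets
  \<open>W n c\<close>.\<close>

locale block_system =
  fixes f :: "'a::metric_space \<Rightarrow> 'a" and \<phi> \<psi> :: "'a \<Rightarrow> real" and Y :: "'a set" and k :: nat and \<alpha> :: real
    and p q :: "nat \<Rightarrow> nat" and W :: "nat \<Rightarrow> (nat \<Rightarrow> bool) \<Rightarrow> 'a set"
  assumes X: "compact (UNIV :: 'a set)" and f_cont: "continuous_on UNIV f"
    and \<phi>_cont: "continuous_on UNIV \<phi>" and \<psi>_cont: "continuous_on UNIV \<psi>" and \<alpha>: "\<alpha> > 0"
    and p_pos: "\<And>n. p n > 0" and p_strict: "\<And>n. p n < p (Suc n)" and p_dvd_Suc: "\<And>n. p n dvd p (Suc n)"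
    and q_pos: "\<And>n. q n > 0" and q_le: "\<And>n. q n * p n \<le> p (Suc n)"
    and filler: "summable (\<lambda>n. 1 - real (q n * p n) / p (Suc n))"
    and W_ne: "\<And>n c. W n c \<noteq> {}" and W_dep: "\<And>n. depends_below (p n) (W n)"
    and W_sub: "\<And>n c x i. x \<in> W (Suc n) c \<Longrightarrow> i < q n \<Longrightarrow> (f ^^ (i * p n)) x \<in> W n (\<lambda>j. c (j + i * p n))"
    and W_coin: "\<And>c x. x \<in> W 0 c \<Longrightarrow> if c 0 then \<psi> ((f ^^ k) x) \<ge> \<alpha> else \<psi> ((f ^^ k) x) \<le> - \<alpha>"
    and W_dense: "\<And>n c x y. x \<in> W (Suc n) c \<Longrightarrow> y \<in> Y \<Longrightarrow> \<exists>i\<le>p (Suc n). dist ((f ^^ i) x) y \<le> 1 / Suc n"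
    and W_avg_le: "\<And>n. coin_avg (p n) (\<lambda>c. SUP x\<in>W n c. birkhoff_sum f \<phi> (p n) x) \<le> 0"
    and W_avg_ge: "\<And>n. - ((1/2)^n * p (Suc n)) \<le> coin_avg (p (Suc n)) (\<lambda>c. SUP x\<in>W (Suc n) c. birkhoff_sum f \<phi> (p (Suc n)) x)"
begin

abbreviation "S \<equiv> birkhoff_sum f \<phi>"
abbreviation "u n c \<equiv> (SUP x\<in>W n c. S (p n) x)"

definition fill :: "nat \<Rightarrow> real" where "fill n = 1 - real (q n * p n) / p (Suc n)"

text \<open>The bits are shifted, the phases form an odometer: phase \<open>n\<close> is the position in the level-\<open>n\<close> word.\<close>

definition T :: "'a state \<Rightarrow> 'a state" where
  "T \<omega> = (f (fst \<omega>), \<lambda>i. coin \<omega> (Suc i), \<lambda>n. (phase \<omega> n + 1) mod p n)"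

definition K :: "'a state set" where "K = UNIV \<times> UNIV \<times> {\<theta>. \<forall>n. \<theta> n \<in> {..<p n}}"

definition bad :: "nat \<Rightarrow> 'a state set" where "bad n = {\<omega>. q n * p n \<le> phase \<omega> (Suc n)}"

text \<open>A phase is good at level \<open>n\<close> if a level-\<open>n\<close> word starts now and no higher level is in the filler
  part of its word. Only then does the level-\<open>n\<close> word constrain the point; for almost all phases of a
  coded measure this holds with positive frequency, since the fillers are summable.\<close>

definition good_upto :: "nat \<Rightarrow> nat \<Rightarrow> (nat \<Rightarrow> nat) set" where
  "good_upto n m = {\<theta>. \<theta> n = 0 \<and> (\<forall>j. n \<le> j \<and> j < m \<longrightarrow> \<theta> (Suc j) < q j * p j)}"

definition good :: "nat \<Rightarrow> (nat \<Rightarrow> nat) set" where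
  "good n = {\<theta>. \<theta> n = 0 \<and> (\<forall>j\<ge>n. \<theta> (Suc j) < q j * p j)}"

text \<open>The compatibility condition in the inverse limit of the cyclic groups of order
  \<open>p n\<close>.\<close>

definition consistent :: "nat \<Rightarrow> 'a state set" where
  "consistent n = {\<omega>. phase \<omega> n = phase \<omega> (Suc n) mod p n}"

text \<open>The closure makes this set open, as the passage to weak limits requires.\<close>

definition outside :: "nat \<Rightarrow> 'a state set" where
  "outside n = {\<omega>. fst \<omega> \<notin> closure (W n (coin \<omega>))}"

definition cyl :: "nat \<Rightarrow> nat \<Rightarrow> nat set \<Rightarrow> (nat \<Rightarrow> bool) \<Rightarrow> 'a state set" where
  "cyl m j I a = {\<omega>. phase \<omega> m = j \<and> (\<forall>i\<in>I. coin \<omega> i = a i)}"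

text \<open>The law is prescribed for the bits together with a single phase. As the phases are
  almost surely consistent, phase \<open>m\<close> determines all lower ones, and the joint law of
  bits and phases follows.\<close>

definition coded :: "'a state measure set" where
  "coded = {P \<in> probs_on K. distr P borel T = P \<and>
     (\<forall>m j I a. finite I \<longrightarrow> j < p m \<longrightarrow> measure P (cyl m j I a) = (1/2) ^ card I / p m) \<and>
     (\<forall>n. measure P (consistent n) = 1) \<and>
     (\<forall>n. measure P ({\<omega>. phase \<omega> \<in> good n} \<inter> outside n) = 0)}"

lemma p_mono: "n \<le> m \<Longrightarrow> p n \<le> p m"
  using lift_Suc_mono_le[of p] p_strict less_imp_le by metis

lemma p_ge: "n \<le> p n"
proof (induction n)
  case (Suc n)
  then show ?case using p_strict[of n] by simp
qed simp

lemma p_dvd: "n \<le> m \<Longrightarrow> p n dvd p m"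
  by (induction m rule: nat_induct_at_least) (auto intro: dvd_trans[OF _ p_dvd_Suc])

lemma fill_nonneg: "fill n \<ge> 0"
  unfolding fill_def using q_le[of n] p_pos[of "Suc n"] by (simp add: divide_le_eq flip: of_nat_mult)

lemma fill_summable: "summable fill" unfolding fill_def using filler .

lemma \<phi>_bounded: obtains C where "C \<ge> 0" "\<And>x. \<bar>\<phi> x\<bar> \<le> C"
proof -
  have "bounded (range \<phi>)" using compact_continuous_image[OF \<phi>_cont X] compact_imp_bounded by auto
  then obtain C where "\<And>x. \<bar>\<phi> x\<bar> \<le> C" by (auto simp: bounded_iff)
  then show ?thesis using that[of C] by (meson abs_ge_zero order_trans)
qed

lemma funpow_cont: "continuous_on UNIV (f ^^ n)"
proof (induction n)
  case (Suc n)
  then show ?case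
    unfolding funpow.simps by (intro continuous_on_compose continuous_on_subset[OF f_cont]) auto
qed (simp add: id_def)

lemma S_cont: "continuous_on UNIV (S n)"
  unfolding birkhoff_sum_def
  by (intro continuous_on_sum continuous_on_compose2[OF \<phi>_cont funpow_cont]) auto

lemma u_upper:
  assumes "x \<in> closure (W n c)"
  shows "S (p n) x \<le> u n c"
proof -
  obtain C where C: "\<And>x. \<bar>\<phi> x\<bar> \<le> C" using \<phi>_bounded by metis
  have "bdd_above (S (p n) ` W n c)"
    using birkhoff_sum_bound[of \<phi> C f "p n", OF C] by (intro bdd_aboveI2[of _ _ "C * p n"]) (meson abs_le_D1)
  then have "W n c \<subseteq> {x. S (p n) x \<le> u n c}" by (auto intro: cSUP_upper)
  moreover have "closed {x. S (p n) x \<le> u n c}"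
    by (intro closed_Collect_le S_cont continuous_on_const)
  ultimately show ?thesis using assms closure_minimal by blast
qed

lemma u_dep: "depends_below (p n) (u n)"
  using W_dep[of n] unfolding depends_below_def by metis

lemma K_compact: "compact K"
proof -
  have "compact (UNIV :: (nat \<Rightarrow> bool) set)" using compact_Pi_finite[of "\<lambda>_. UNIV :: bool set"] by simp
  moreover have "compact {\<theta>::nat \<Rightarrow> nat. \<forall>n. \<theta> n \<in> {..<p n}}" by (rule compact_Pi_finite) auto
  ultimately show ?thesis unfolding K_def using X by (intro compact_Times)
qed

lemma K_closed: "closed K" by (rule compact_imp_closed[OF K_compact])

lemma K_iff: "\<omega> \<in> K \<longleftrightarrow> (\<forall>n. phase \<omega> n < p n)"
  unfolding K_def by (auto simp: mem_Times_iff)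

lemma T_K: "\<omega> \<in> K \<Longrightarrow> T \<omega> \<in> K" unfolding K_iff T_def using p_pos by simp

lemma T_cont: "continuous_on UNIV T"
proof -
  have c1: "continuous_on UNIV (\<lambda>\<omega>::'a state. f (fst \<omega>))"
    by (rule continuous_on_compose2[OF f_cont continuous_on_fst[OF continuous_on_id]]) simp
  have c2: "continuous_on UNIV (\<lambda>\<omega>::'a state. \<lambda>i. coin \<omega> (Suc i))"
    by (rule continuous_on_coordinatewise_then_product[OF coin_cont])
  have c3: "continuous_on UNIV (\<lambda>\<omega>::'a state. \<lambda>n. (phase \<omega> n + 1) mod p n)"
  proof (rule continuous_on_coordinatewise_then_product)
    fix n
    have d: "continuous_on UNIV (\<lambda>j. (j + 1) mod p n)" by (simp add: continuous_on_open_vimage discrete_topology_class.open_discrete)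
    show "continuous_on UNIV (\<lambda>\<omega>::'a state. (phase \<omega> n + 1) mod p n)"
      by (rule continuous_on_compose2[OF d phase_cont]) simp
  qed
  show ?thesis unfolding T_def[abs_def] by (intro continuous_on_Pair c1 c2 c3)
qed

lemma T_measurable: "T \<in> borel_measurable borel" by (rule borel_measurable_continuous_onI[OF T_cont])

lemma fst_T_pow: "fst ((T ^^ i) \<omega>) = (f ^^ i) (fst \<omega>)"
  by (induction i) (simp_all add: T_def)

lemma coin_T_pow: "coin ((T ^^ i) \<omega>) l = coin \<omega> (l + i)"
  by (induction i arbitrary: l) (simp_all add: T_def)

lemma phase_T_pow: "\<omega> \<in> K \<Longrightarrow> phase ((T ^^ i) \<omega>) n = (phase \<omega> n + i) mod p n"
  by (induction i) (simp_all add: K_iff T_def mod_Suc_eq)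

section \<open>Topology of the events on states, and weak limits of coded measures\<close>

lemma cyl_clopen: assumes "finite I" shows "open (cyl m j I a)" "closed (cyl m j I a)"
proof -
  obtain M where M: "\<And>i. i \<in> insert m I \<Longrightarrow> i < M"
    using finite_nat_set_iff_bounded[of "insert m I"] assms by auto
  have "\<forall>\<omega> \<omega>'. (\<forall>i<M. coin \<omega> i = coin \<omega>' i \<and> phase \<omega> i = phase \<omega>' i) \<longrightarrow> \<omega> \<in> cyl m j I a \<longrightarrow> \<omega>' \<in> cyl m j I a"
  proof (intro allI impI)
    fix \<omega> \<omega>' :: "'a state" assume eq: "\<forall>i<M. coin \<omega> i = coin \<omega>' i \<and> phase \<omega> i = phase \<omega>' i" and mem: "\<omega> \<in> cyl m j I a"
    have "phase \<omega>' m = j" using eq M[of m] mem unfolding cyl_def by auto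
    moreover have "coin \<omega>' i = a i" if "i \<in> I" for i using eq M[of i] mem that unfolding cyl_def by auto
    ultimately show "\<omega>' \<in> cyl m j I a" unfolding cyl_def by blast
  qed
  from finite_coordinates_clopen[OF this] show "open (cyl m j I a)" "closed (cyl m j I a)" .
qed

lemma consistent_clopen: "open (consistent n)" "closed (consistent n)"
proof -
  have "\<forall>\<omega> \<omega>'. (\<forall>i<Suc (Suc n). coin \<omega> i = coin \<omega>' i \<and> phase \<omega> i = phase \<omega>' i) \<longrightarrow> \<omega> \<in> consistent n \<longrightarrow> \<omega>' \<in> consistent n"
  proof (intro allI impI)
    fix \<omega> \<omega>' :: "'a state" assume eq: "\<forall>i<Suc (Suc n). coin \<omega> i = coin \<omega>' i \<and> phase \<omega> i = phase \<omega>' i" and mem: "\<omega> \<in> consistent n"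
    have "phase \<omega> n = phase \<omega>' n" "phase \<omega> (Suc n) = phase \<omega>' (Suc n)" using eq by auto
    then show "\<omega>' \<in> consistent n" using mem unfolding consistent_def by simp
  qed
  from finite_coordinates_clopen[OF this] show "open (consistent n)" "closed (consistent n)" .
qed

lemma bad_clopen: "open (bad n)" "closed (bad n)"
proof -
  have "\<forall>\<omega> \<omega>'. (\<forall>i<Suc (Suc n). coin \<omega> i = coin \<omega>' i \<and> phase \<omega> i = phase \<omega>' i) \<longrightarrow> \<omega> \<in> bad n \<longrightarrow> \<omega>' \<in> bad n"
  proof (intro allI impI)
    fix \<omega> \<omega>' :: "'a state" assume eq: "\<forall>i<Suc (Suc n). coin \<omega> i = coin \<omega>' i \<and> phase \<omega> i = phase \<omega>' i" and mem: "\<omega> \<in> bad n"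
    have "phase \<omega> (Suc n) = phase \<omega>' (Suc n)" using eq by auto
    then show "\<omega>' \<in> bad n" using mem unfolding bad_def by simp
  qed
  from finite_coordinates_clopen[OF this] show "open (bad n)" "closed (bad n)" .
qed

lemma phase_set_clopen:
  assumes B: "\<forall>\<theta> \<theta>'. (\<forall>i\<le>m. \<theta> i = \<theta>' i) \<longrightarrow> \<theta> \<in> B \<longrightarrow> \<theta>' \<in> B"
  shows "open {\<omega>::'a state. phase \<omega> \<in> B}" "closed {\<omega>::'a state. phase \<omega> \<in> B}"
proof -
  have "\<forall>\<omega> \<omega>'. (\<forall>i<Suc m. coin \<omega> i = coin \<omega>' i \<and> phase \<omega> i = phase \<omega>' i) \<longrightarrow>
      \<omega> \<in> {\<omega>::'a state. phase \<omega> \<in> B} \<longrightarrow> \<omega>' \<in> {\<omega>::'a state. phase \<omega> \<in> B}"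
  proof (intro allI impI)
    fix \<omega> \<omega>' :: "'a state"
    assume eq: "\<forall>i<Suc m. coin \<omega> i = coin \<omega>' i \<and> phase \<omega> i = phase \<omega>' i"
      and mem: "\<omega> \<in> {\<omega>. phase \<omega> \<in> B}"
    have "\<forall>i\<le>m. phase \<omega> i = phase \<omega>' i" using eq by (simp add: less_Suc_eq_le)
    then show "\<omega>' \<in> {\<omega>. phase \<omega> \<in> B}" using B mem by blast
  qed
  from finite_coordinates_clopen[OF this]
  show "open {\<omega>::'a state. phase \<omega> \<in> B}" "closed {\<omega>::'a state. phase \<omega> \<in> B}" .
qed

lemma good_upto_dep: "\<forall>\<theta> \<theta>'. (\<forall>i\<le>n + m. \<theta> i = \<theta>' i) \<longrightarrow> \<theta> \<in> good_upto n m \<longrightarrow> \<theta>' \<in> good_upto n m"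
proof (intro allI impI)
  fix \<theta> \<theta>' :: "nat \<Rightarrow> nat" assume eq: "\<forall>i\<le>n + m. \<theta> i = \<theta>' i" and mem: "\<theta> \<in> good_upto n m"
  have "\<theta>' n = 0" using eq mem unfolding good_upto_def by auto
  moreover have "\<theta>' (Suc j) < q j * p j" if "n \<le> j" "j < m" for j
  proof -
    have "\<theta> (Suc j) = \<theta>' (Suc j)" using eq that by auto
    then show ?thesis using mem that unfolding good_upto_def by auto
  qed
  ultimately show "\<theta>' \<in> good_upto n m" unfolding good_upto_def by blast
qed

lemmas good_upto_clopen = phase_set_clopen[OF good_upto_dep]

lemma good_Inter: "good n = (\<Inter>m. good_upto n m)"
  unfolding good_def good_upto_def by auto

lemma good_closed: "closed {\<omega>::'a state. phase \<omega> \<in> good n}"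
proof -
  have eq: "{\<omega>::'a state. phase \<omega> \<in> good n} = (\<Inter>m. {\<omega>. phase \<omega> \<in> good_upto n m})"
    unfolding good_Inter by auto
  show ?thesis unfolding eq by (intro closed_INT ballI good_upto_clopen(2))
qed

lemma outside_open: "open (outside n)"
proof -
  have eq: "outside n = (\<Union>c. (fst -` (- closure (W n c))) \<inter> {\<omega>. \<forall>i<p n. coin \<omega> i = c i})" (is "_ = ?R")
  proof
    show "?R \<subseteq> outside n"
    proof
      fix \<omega> assume "\<omega> \<in> ?R"
      then obtain c where c: "fst \<omega> \<notin> closure (W n c)" "\<forall>i<p n. coin \<omega> i = c i" by auto
      then have "W n (coin \<omega>) = W n c" using W_dep[of n] unfolding depends_below_def by blast
      then show "\<omega> \<in> outside n" using c unfolding outside_def by simp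
    qed
  qed (auto simp: outside_def)
  have "open {\<omega>::'a state. \<forall>i<p n. coin \<omega> i = c i}" for c
    by (rule finite_coordinates_open[of "p n"]) simp
  moreover have "open (fst -` (- closure (W n c)) :: 'a state set)" for c
    by (intro open_vimage_fst) auto
  ultimately show ?thesis unfolding eq by (intro open_UN ballI open_Int)
qed

lemma finite_coordinates_measurable_bad:
  assumes P: "P \<in> probs_on K" and l: "\<And>j. j < p (Suc n) \<Longrightarrow> measure P (cyl (Suc n) j {} a) = 1 / p (Suc n)"
  shows "measure P (bad n) = fill n"
proof -
  interpret prob_space P using probs_onD[OF P] by auto
  have s: "cyl (Suc n) j {} a \<in> sets P" for j
    using cyl_clopen(1)[of "{}"] probs_onD[OF P] by auto
  have "measure P (- bad n) = measure P (\<Union>j\<in>{..<q n * p n}. cyl (Suc n) j {} a)"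
    by (rule arg_cong[of _ _ "measure P"]) (auto simp: bad_def cyl_def)
  also have "\<dots> = (\<Sum>j<q n * p n. measure P (cyl (Suc n) j {} a))"
    using s by (intro finite_measure_finite_Union) (auto simp: disjoint_family_on_def cyl_def)
  also have "\<dots> = (\<Sum>j<q n * p n. 1 / p (Suc n))"
    using q_le[of n] by (intro sum.cong l) auto
  finally have "measure P (- bad n) = real (q n * p n) / p (Suc n)" by simp
  moreover have "measure P (- bad n) = 1 - measure P (bad n)"
    using bad_clopen[of n] by (intro probs_on_compl[OF P]) auto
  ultimately show ?thesis unfolding fill_def by simp
qed

lemma probs_on_eqI_integral:
  assumes "P \<in> probs_on K" "Q \<in> probs_on K"
    and "\<And>g :: 'a state \<Rightarrow> real. continuous_on UNIV g \<Longrightarrow> bounded (range g) \<Longrightarrow> (\<integral>x. g x \<partial>P) = (\<integral>x. g x \<partial>Q)"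
  shows "P = Q"
proof -
  obtain g :: "nat \<Rightarrow> 'a state \<Rightarrow> real" where g: "\<And>i. continuous_on UNIV (g i)" "\<And>i x. 0 \<le> g i x" "\<And>i x. g i x \<le> 1"
    "\<And>P Q. P \<in> probs_on K \<Longrightarrow> Q \<in> probs_on K \<Longrightarrow> (\<And>i. (\<integral>x. g i x \<partial>P) = (\<integral>x. g i x \<partial>Q)) \<Longrightarrow> P = Q"
    using countable_determining_class[OF K_compact] by blast
  have "bounded (range (g i))" for i using g by (intro boundedI[of _ 1]) auto
  then show ?thesis using g(4)[OF assms(1,2)] assms(3) g(1) by blast
qed

lemma distr_T_probs_on:
  assumes P: "P \<in> probs_on K"
  shows "distr P borel T \<in> probs_on K"
proof -
  interpret prob_space P using probs_onD[OF P] by auto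
  have m: "T \<in> measurable P borel" using T_measurable measurable_cong_sets[OF probs_onD(2)[OF P] refl] by blast
  have "AE \<omega> in P. T \<omega> \<in> K" using probs_on_AE[OF P K_closed] by eventually_elim (rule T_K)
  then have "measure P (T -` K \<inter> space P) = 1"
    using prob_eq_1[of "T -` K \<inter> space P"] measurable_sets[OF m, of K] K_closed by auto
  then show ?thesis
    unfolding probs_on_def using prob_space_distr[OF m] measure_distr[OF m, of K] K_closed by simp
qed

text \<open>Stated with asymptotic hypotheses to serve both the finite approximations and sequences
  inside \<open>coded\<close>. All conditions but the last concern continuous functions or clopen
  sets. The last event is a closed set intersected with an open one, and its nullity does not pass
  to the limit directly: it is enlarged to the open event with \<open>good_upto n m\<close>, which
  exceeds it only inside the sets \<open>bad j\<close> with \<open>j \<ge> m\<close>. These have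
  measure at most the tail of \<open>fill\<close>, uniformly along the sequence. Then
  \<open>m\<close> tends to infinity.\<close>

lemma weak_lim_coded:
  assumes lim: "weak_lim P Q" and P: "\<And>n. P n \<in> probs_on K" and Q: "Q \<in> probs_on K"
    and inv: "\<And>g. continuous_on UNIV g \<Longrightarrow> bounded (range g) \<Longrightarrow>
          (\<lambda>n. (\<integral>x. g (T x) \<partial>P n) - (\<integral>x. g x \<partial>P n)) \<longlonglongrightarrow> (0::real)"
    and law: "\<And>m j I a. finite I \<Longrightarrow> j < p m \<Longrightarrow> (\<lambda>n. measure (P n) (cyl m j I a)) \<longlonglongrightarrow> (1/2) ^ card I / p m"
    and cons: "\<And>n m. measure (P n) (consistent m) = 1"
    and bad: "\<And>n m. measure (P n) (bad m) \<le> fill m"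
    and blocks: "\<And>m. \<forall>\<^sub>F n in sequentially. measure (P n) ({\<omega>. phase \<omega> \<in> good m} \<inter> outside m) = 0"
  shows "Q \<in> coded"
proof -
  have iT: "distr Q borel T = Q"
  proof (rule probs_on_eqI_integral[OF distr_T_probs_on[OF Q] Q])
    fix g :: "'a state \<Rightarrow> real" assume g: "continuous_on UNIV g" "bounded (range g)"
    have gT: "continuous_on UNIV (\<lambda>x. g (T x))"
      by (rule continuous_on_compose2[OF g(1) T_cont]) simp
    have bT: "bounded (range (\<lambda>x. g (T x)))"
      by (rule bounded_subset[OF g(2)]) blast
    have m: "T \<in> measurable Q borel" using T_measurable measurable_cong_sets[OF probs_onD(2)[OF Q] refl] by blast
    have "(\<lambda>n. (\<integral>x. g (T x) \<partial>P n) - (\<integral>x. g x \<partial>P n)) \<longlonglongrightarrow> (\<integral>x. g (T x) \<partial>Q) - (\<integral>x. g x \<partial>Q)"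
      by (intro tendsto_diff lim[unfolded weak_lim_def, rule_format] conjI g gT bT)
    then have "(\<integral>x. g (T x) \<partial>Q) - (\<integral>x. g x \<partial>Q) = 0" using inv[OF g] LIMSEQ_unique by blast
    then show "(\<integral>x. g x \<partial>distr Q borel T) = (\<integral>x. g x \<partial>Q)"
      using integral_distr[OF m borel_measurable_continuous_onI[OF g(1)]] by simp
  qed
  have l: "measure Q (cyl m j I a) = (1/2) ^ card I / p m" if "finite I" "j < p m" for m j I a
    using weak_lim_clopen[OF lim P Q cyl_clopen[OF that(1)]] law[OF that] LIMSEQ_unique by blast
  have c: "measure Q (consistent n) = 1" for n
    using weak_lim_clopen[OF lim P Q consistent_clopen[of n]] cons LIMSEQ_unique[OF tendsto_const] by fastforce
  have "measure Q ({\<omega>. phase \<omega> \<in> good n} \<inter> outside n) = 0" for n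
  proof -
    let ?H = "\<lambda>m. {\<omega>. phase \<omega> \<in> good_upto n m} \<inter> outside n"
    let ?G = "{\<omega>. phase \<omega> \<in> good n} \<inter> outside n"
    have tail: "measure Q (?H m) \<le> (\<Sum>i. fill (i + m))" if "n \<le> m" for m
    proof -
      obtain N where N: "\<And>i. i \<ge> N \<Longrightarrow> measure (P i) ?G = 0" using blocks[of n] by (auto simp: eventually_sequentially)
      have le: "measure (P (i + N)) (?H m) \<le> (\<Sum>i. fill (i + m))" for i
      proof -
        interpret prob_space "P (i + N)" using probs_onD[OF P] by auto
        have b: "bad j \<in> events" for j using bad_clopen probs_onD[OF P] by auto
        have Gm: "?G \<in> events" "?H m \<in> events"
          using good_closed good_upto_clopen outside_open probs_onD[OF P] by auto
        have sf: "summable (\<lambda>j. fill (j + m))" using fill_summable by (rule summable_ignore_initial_segment)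
        have sb: "summable (\<lambda>j. measure (P (i + N)) (bad (j + m)))"
          by (rule summable_comparison_test'[OF sf]) (use bad in auto)
        have "?H m \<subseteq> ?G \<union> (\<Union>j. bad (j + m))"
        proof
          fix \<omega> assume w: "\<omega> \<in> ?H m"
          show "\<omega> \<in> ?G \<union> (\<Union>j. bad (j + m))"
          proof (cases "\<omega> \<in> ?G")
            case False
            then obtain j where j: "j \<ge> n" "\<not> phase \<omega> (Suc j) < q j * p j" using w unfolding good_def good_upto_def by auto
            then have "j \<ge> m" using w unfolding good_upto_def by (auto simp: not_less[symmetric])
            then have "\<omega> \<in> bad (j - m + m)" using j unfolding bad_def by simp
            then show ?thesis by blast
          qed simp
        qed
        then have "prob (?H m) \<le> prob (?G \<union> (\<Union>j. bad (j + m)))" using Gm b by (intro finite_measure_mono) auto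
        also have "\<dots> \<le> prob ?G + prob (\<Union>j. bad (j + m))" using Gm b by (intro measure_Un_le) auto
        also have "\<dots> = prob (\<Union>j. bad (j + m))" using N[of "i + N"] by simp
        also have "\<dots> \<le> (\<Sum>j. prob (bad (j + m)))" using b sb by (intro finite_measure_subadditive_countably) auto
        also have "\<dots> \<le> (\<Sum>j. fill (j + m))" using sb sf bad by (intro suminf_le) auto
        finally show ?thesis .
      qed
      have "weak_lim (\<lambda>i. P (i + N)) Q"
        unfolding weak_lim_def
        by (intro allI impI LIMSEQ_ignore_initial_segment[OF lim[unfolded weak_lim_def, rule_format]])
      then show ?thesis
        by (rule weak_lim_open_le[OF _ P Q open_Int[OF good_upto_clopen(1) outside_open] le tendsto_const])
    qed
    interpret prob_space Q using probs_onD[OF Q] by auto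
    have "prob ?G \<le> (\<Sum>i. fill (i + m))" if "n \<le> m" for m
    proof -
      have "prob ?G \<le> prob (?H m)"
        using borel_open[OF open_Int[OF good_upto_clopen(1) outside_open], of n m n] probs_onD(2)[OF Q]
        by (intro finite_measure_mono) (auto simp only: good_Inter)
      then show ?thesis using tail[OF that] by linarith
    qed
    then have "prob ?G \<le> 0"
      by (intro LIMSEQ_le_const[OF suminf_exist_split2[OF fill_summable]]) blast
    then show ?thesis using measure_nonneg[of Q ?G] by linarith
  qed
  then show ?thesis unfolding coded_def by (intro CollectI conjI allI impI Q iT l c)
qed

end

section \<open>Independence of the bits from phases and invariant sets\<close>

lemma measure_tendsto_pointwise:
  fixes P :: "'e::topological_space measure"
  assumes P: "prob_space P" "sets P = sets borel" and A: "A \<in> sets borel" "\<And>m. B m \<in> sets borel"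
    and ev: "\<And>\<omega>. \<forall>\<^sub>F m in sequentially. \<omega> \<in> B m \<longleftrightarrow> \<omega> \<in> A"
  shows "(\<lambda>m::nat. measure P (B m)) \<longlonglongrightarrow> measure P A"
proof -
  have "(\<lambda>m. indicator (B m) \<omega> :: real) \<longlonglongrightarrow> indicator A \<omega>" for \<omega>
    by (rule tendsto_eventually[OF eventually_mono[OF ev[of \<omega>]]]) (auto simp: indicator_def)
  then have "(\<lambda>m. \<integral>x. indicator (B m) x \<partial>P) \<longlonglongrightarrow> measure P A"
    using A by (intro integral_indicator_tendsto[OF P]) (auto simp: indicator_def)
  moreover have "(\<integral>x. indicator (B m) x \<partial>P) = measure P (B m)" for m
    using A P sets_eq_imp_space_eq[OF P(2)] by (simp add: sets.Int_space_eq2)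
  ultimately show ?thesis by simp
qed

lemma mod_add_eq_iff:
  fixes a j p :: nat
  assumes "a < p" "j < p"
  shows "(a + j) mod p = j \<longleftrightarrow> a = 0"
proof (cases "a + j < p")
  case False
  then have "(a + j) mod p = a + j - p" using assms by (simp add: mod_if)
  then show ?thesis using assms False by auto
qed simp

context block_system
begin

lemma codedD:
  assumes "P \<in> coded"
  shows "P \<in> probs_on K" "distr P borel T = P"
    "\<And>m j I a. finite I \<Longrightarrow> j < p m \<Longrightarrow> measure P (cyl m j I a) = (1/2) ^ card I / p m"
    "\<And>n. measure P (consistent n) = 1" "\<And>n. measure P ({\<omega>. phase \<omega> \<in> good n} \<inter> outside n) = 0"
  using assms unfolding coded_def by auto

lemma distr_T_pow:
  assumes "sets P = sets borel" "distr P borel T = P"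
  shows "distr P borel (T ^^ i) = P"
proof (induction i)
  case 0
  show ?case using distr_id2[OF assms(1)[symmetric]] by (simp add: id_def)
next
  case (Suc i)
  have m: "T ^^ i \<in> measurable P borel"
    using funpow_borel_measurable[OF T_measurable, of i] measurable_cong_sets[OF assms(1) refl] by blast
  have "distr P borel (T ^^ Suc i) = distr (distr P borel (T ^^ i)) borel T"
    unfolding funpow.simps by (rule distr_distr[symmetric, OF T_measurable m])
  then show ?case unfolding Suc.IH assms(2) .
qed

lemma T_pow_invariant:
  assumes "P \<in> probs_on K" "distr P borel T = P"
  shows "B \<in> sets borel \<Longrightarrow> measure P ((T ^^ i) -` B) = measure P B"
    and "g \<in> borel_measurable borel \<Longrightarrow> (\<integral>x. g ((T ^^ i) x) \<partial>P) = (\<integral>x. (g x :: real) \<partial>P)"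
proof -
  note sP = probs_onD(2,4)[OF assms(1)]
  have m: "T ^^ i \<in> measurable P borel"
    using funpow_borel_measurable[OF T_measurable, of i] measurable_cong_sets[OF sP(1) refl] by blast
  show "measure P ((T ^^ i) -` B) = measure P B" if "B \<in> sets borel"
    using measure_distr[OF m that] distr_T_pow[OF sP(1) assms(2), of i] sP by simp
  show "(\<integral>x. g ((T ^^ i) x) \<partial>P) = (\<integral>x. (g x :: real) \<partial>P)" if "g \<in> borel_measurable borel"
    using integral_distr[OF m that] distr_T_pow[OF sP(1) assms(2), of i] by simp
qed

lemma phase_coherent:
  assumes "\<omega> \<in> K" "\<And>n. \<omega> \<in> consistent n" "i \<le> m"
  shows "phase \<omega> i = phase \<omega> m mod p i"
  using assms(3)
proof (induction m rule: nat_induct_at_least)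
  case base
  then show ?case using assms(1) by (simp add: K_iff)
next
  case (Suc m)
  have "phase \<omega> m = phase \<omega> (Suc m) mod p m" using assms(2)[of m] unfolding consistent_def by simp
  then show ?case using Suc p_dvd[OF Suc.hyps(1)] by (simp add: mod_mod_cancel)
qed

lemma coded_AE:
  assumes "P \<in> coded"
  shows "AE \<omega> in P. \<omega> \<in> K \<and> (\<forall>i m. i \<le> m \<longrightarrow> phase \<omega> i = phase \<omega> m mod p i)"
proof -
  note P = codedD[OF assms]
  interpret prob_space P using probs_onD[OF P(1)] by auto
  have "AE \<omega> in P. \<omega> \<in> consistent n" for n
    using P(4)[of n] AE_in_set_eq_1[of "consistent n"] consistent_clopen[of n] probs_onD[OF P(1)] by auto
  then have "AE \<omega> in P. \<forall>n. \<omega> \<in> consistent n" by (simp add: AE_all_countable)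
  with probs_on_AE[OF P(1) K_closed] show ?thesis
    by eventually_elim (use phase_coherent in auto)
qed

lemma coins_open: "finite I \<Longrightarrow> open {\<omega>::'a state. \<forall>i\<in>I. coin \<omega> i = a i}"
proof -
  assume "finite I"
  then obtain M where M: "\<And>i. i \<in> I \<Longrightarrow> i < M" using finite_nat_set_iff_bounded by auto
  show ?thesis
  proof (rule finite_coordinates_open[of M], intro allI impI)
    fix \<omega> \<omega>' :: "'a state"
    assume "\<forall>i<M. coin \<omega> i = coin \<omega>' i \<and> phase \<omega> i = phase \<omega>' i" "\<omega> \<in> {\<omega>. \<forall>i\<in>I. coin \<omega> i = a i}"
    then show "\<omega>' \<in> {\<omega>. \<forall>i\<in>I. coin \<omega> i = a i}" using M by auto
  qed
qed

lemma level_law: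
  assumes P: "P \<in> coded" and I: "finite I"
  shows "measure P ({\<omega>. phase \<omega> m \<in> J} \<inter> {\<omega>. \<forall>i\<in>I. coin \<omega> i = a i}) = card (J \<inter> {..<p m}) * ((1/2) ^ card I / p m)"
proof -
  note PD = codedD[OF P]
  interpret prob_space P using probs_onD[OF PD(1)] by auto
  have c: "cyl m j I a \<in> sets P" for j using cyl_clopen[OF I] probs_onD[OF PD(1)] by auto
  have "open {\<omega>::'a state. phase \<omega> m \<in> J}" by (rule finite_coordinates_open[of "Suc m"]) simp
  then have J: "{\<omega>. phase \<omega> m \<in> J} \<inter> {\<omega>. \<forall>i\<in>I. coin \<omega> i = a i} \<in> sets P"
    using coins_open[OF I] probs_onD[OF PD(1)] by auto
  have "measure P ({\<omega>. phase \<omega> m \<in> J} \<inter> {\<omega>. \<forall>i\<in>I. coin \<omega> i = a i}) = measure P (\<Union>j\<in>J \<inter> {..<p m}. cyl m j I a)"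
  proof (rule measure_eq_AE)
    show "AE \<omega> in P. (\<omega> \<in> {\<omega>. phase \<omega> m \<in> J} \<inter> {\<omega>. \<forall>i\<in>I. coin \<omega> i = a i}) = (\<omega> \<in> (\<Union>j\<in>J \<inter> {..<p m}. cyl m j I a))"
      using probs_on_AE[OF PD(1) K_closed] by eventually_elim (auto simp: K_iff cyl_def)
  qed (use c J in auto)
  also have "\<dots> = (\<Sum>j\<in>J \<inter> {..<p m}. measure P (cyl m j I a))"
    using c by (intro finite_measure_finite_Union) (auto simp: disjoint_family_on_def cyl_def)
  also have "\<dots> = (\<Sum>j\<in>J \<inter> {..<p m}. (1/2) ^ card I / p m)" using PD(3)[OF I] by (intro sum.cong) auto
  finally show ?thesis by simp
qed

text \<open>Almost surely the phases up to \<open>m\<close> are the residues of phase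
  \<open>m\<close>, so \<open>B\<close> amounts to a set of values of that one phase.\<close>

lemma coins_independent_finite:
  assumes P: "P \<in> coded" and I: "finite I" and B: "\<forall>\<theta> \<theta>'. (\<forall>i\<le>m. \<theta> i = \<theta>' i) \<longrightarrow> \<theta> \<in> B \<longrightarrow> \<theta>' \<in> B"
  shows "measure P ({\<omega>. phase \<omega> \<in> B} \<inter> {\<omega>. \<forall>i\<in>I. coin \<omega> i = a i}) = (1/2) ^ card I * measure P {\<omega>. phase \<omega> \<in> B}"
proof -
  note PD = codedD[OF P]
  define J where "J = {j. (\<lambda>i. j mod p i) \<in> B}"
  note Bo = phase_set_clopen(1)[OF B]
  have Jo: "open {\<omega>::'a state. phase \<omega> m \<in> J}" by (rule finite_coordinates_open[of "Suc m"]) simp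
  have eq: "phase \<omega> \<in> B \<longleftrightarrow> phase \<omega> m \<in> J" if h: "\<forall>i m. i \<le> m \<longrightarrow> phase \<omega> i = phase \<omega> m mod p i" for \<omega> :: "'a state"
  proof -
    define \<theta> where "\<theta> = (\<lambda>i. phase \<omega> m mod p i)"
    have e1: "\<forall>i\<le>m. phase \<omega> i = \<theta> i" unfolding \<theta>_def using h by blast
    then have e2: "\<forall>i\<le>m. \<theta> i = phase \<omega> i" by metis
    show ?thesis unfolding J_def mem_Collect_eq \<theta>_def[symmetric] using B e1 e2 by blast
  qed
  have "measure P ({\<omega>. phase \<omega> \<in> B} \<inter> {\<omega>. \<forall>i\<in>I'. coin \<omega> i = a i}) = measure P ({\<omega>. phase \<omega> m \<in> J} \<inter> {\<omega>. \<forall>i\<in>I'. coin \<omega> i = a i})"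
    if "finite I'" for I'
  proof (rule measure_eq_AE)
    show "AE \<omega> in P. (\<omega> \<in> {\<omega>. phase \<omega> \<in> B} \<inter> {\<omega>. \<forall>i\<in>I'. coin \<omega> i = a i})
        = (\<omega> \<in> {\<omega>. phase \<omega> m \<in> J} \<inter> {\<omega>. \<forall>i\<in>I'. coin \<omega> i = a i})"
      using coded_AE[OF P] by eventually_elim (use eq in auto)
  qed (use Bo Jo coins_open[OF that] probs_onD[OF PD(1)] in auto)
  from this[OF I] this[of "{}"] level_law[OF P I, of m J a] level_law[OF P, of "{}" m J a]
  show ?thesis by simp
qed

text \<open>Extension to events such as \<open>good n\<close> that depend on infinitely many phases,
  as pointwise limits of events depending on finitely many.\<close>

lemma coins_independent:
  assumes P: "P \<in> coded" and I: "finite I"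
    and B: "\<And>m. \<exists>d. \<forall>\<theta> \<theta>'. (\<forall>i\<le>d. \<theta> i = \<theta>' i) \<longrightarrow> \<theta> \<in> B m \<longrightarrow> \<theta>' \<in> B m"
    and ev: "\<And>\<theta>. \<forall>\<^sub>F m in sequentially. \<theta> \<in> B m \<longleftrightarrow> \<theta> \<in> B'"
    and B': "{\<omega>::'a state. phase \<omega> \<in> B'} \<in> sets borel"
  shows "measure P ({\<omega>. phase \<omega> \<in> B'} \<inter> {\<omega>. \<forall>i\<in>I. coin \<omega> i = a i}) = (1/2) ^ card I * measure P {\<omega>. phase \<omega> \<in> B'}"
proof -
  note PD = probs_onD[OF codedD(1)[OF P]]
  have Bo: "{\<omega>::'a state. phase \<omega> \<in> B m} \<in> sets borel" for m
  proof -
    obtain d where "\<forall>\<theta> \<theta>'. (\<forall>i\<le>d. \<theta> i = \<theta>' i) \<longrightarrow> \<theta> \<in> B m \<longrightarrow> \<theta>' \<in> B m" using B by blast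
    then have "open {\<omega>::'a state. phase \<omega> \<in> B m}" by (rule phase_set_clopen)
    then show ?thesis by simp
  qed
  have Io: "{\<omega>::'a state. \<forall>i\<in>I. coin \<omega> i = a i} \<in> sets borel" using coins_open[OF I] by auto
  have eq: "measure P ({\<omega>. phase \<omega> \<in> B m} \<inter> {\<omega>. \<forall>i\<in>I. coin \<omega> i = a i}) = (1/2) ^ card I * measure P {\<omega>. phase \<omega> \<in> B m}" for m
  proof -
    obtain d where "\<forall>\<theta> \<theta>'. (\<forall>i\<le>d. \<theta> i = \<theta>' i) \<longrightarrow> \<theta> \<in> B m \<longrightarrow> \<theta>' \<in> B m" using B by blast
    then show ?thesis by (rule coins_independent_finite[OF P I])
  qed
  have "(\<lambda>m. measure P ({\<omega>. phase \<omega> \<in> B m} \<inter> {\<omega>. \<forall>i\<in>I. coin \<omega> i = a i}))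
      \<longlonglongrightarrow> measure P ({\<omega>. phase \<omega> \<in> B'} \<inter> {\<omega>. \<forall>i\<in>I. coin \<omega> i = a i})"
  proof (rule measure_tendsto_pointwise[OF PD(1,2)])
    show "\<forall>\<^sub>F m in sequentially. (\<omega> \<in> {\<omega>. phase \<omega> \<in> B m} \<inter> {\<omega>. \<forall>i\<in>I. coin \<omega> i = a i})
        = (\<omega> \<in> {\<omega>. phase \<omega> \<in> B'} \<inter> {\<omega>. \<forall>i\<in>I. coin \<omega> i = a i})" for \<omega>
      by (rule eventually_mono[OF ev[of "phase \<omega>"]]) blast
  qed (use Bo B' Io in \<open>blast intro: sets.Int\<close>)+
  moreover have "(\<lambda>m. (1/2) ^ card I * measure P {\<omega>. phase \<omega> \<in> B m}) \<longlonglongrightarrow> (1/2) ^ card I * measure P {\<omega>. phase \<omega> \<in> B'}"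
    by (intro tendsto_mult tendsto_const measure_tendsto_pointwise[OF PD(1,2)]) (use Bo B' ev in auto)
  ultimately show ?thesis unfolding eq using LIMSEQ_unique by blast
qed

text \<open>\<open>T\<close> moves the phase by one step and keeps \<open>A\<close>, so the pieces
  of \<open>A\<close> with different phases have equal measure.\<close>

lemma invariant_phase_uniform:
  assumes P: "P \<in> coded" and A: "A \<in> sets borel" "T -` A = A" and j: "j < p m"
  shows "measure P (A \<inter> cyl m j {} a) = measure P A / p m"
proof -
  note PD = codedD[OF P]
  interpret prob_space P using probs_onD[OF PD(1)] by auto
  have Am: "A \<inter> cyl m i {} a \<in> sets borel" for i using A cyl_clopen(1)[of "{}"] by auto
  have TA: "(T ^^ i) \<omega> \<in> A \<longleftrightarrow> \<omega> \<in> A" for i \<omega>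
  proof (induction i)
    case (Suc i)
    have "T ((T ^^ i) \<omega>) \<in> A \<longleftrightarrow> (T ^^ i) \<omega> \<in> A" using A(2) by (metis vimage_eq)
    then show ?case using Suc by simp
  qed simp
  have eq0: "measure P (A \<inter> cyl m i {} a) = measure P (A \<inter> cyl m 0 {} a)" if "i < p m" for i
  proof -
    have "measure P (A \<inter> cyl m i {} a) = measure P ((T ^^ i) -` (A \<inter> cyl m i {} a))"
      using T_pow_invariant(1)[OF PD(1,2) Am] by simp
    also have "\<dots> = measure P (A \<inter> cyl m 0 {} a)"
    proof (rule measure_eq_AE)
      show "AE \<omega> in P. (\<omega> \<in> (T ^^ i) -` (A \<inter> cyl m i {} a)) = (\<omega> \<in> A \<inter> cyl m 0 {} a)"
        using probs_on_AE[OF PD(1) K_closed]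
        by eventually_elim (use that mod_add_eq_iff in \<open>auto simp: TA coin_T_pow phase_T_pow cyl_def K_iff\<close>)
    qed (use Am funpow_vimage_measurable[OF T_measurable Am] probs_onD[OF PD(1)] in auto)
    finally show ?thesis .
  qed
  have Um: "(\<Union>i\<in>{..<p m}. A \<inter> cyl m i {} a) \<in> sets borel" by (intro sets.finite_UN Am) simp
  have "measure P A = measure P (\<Union>i\<in>{..<p m}. A \<inter> cyl m i {} a)"
  proof (rule measure_eq_AE)
    show "AE \<omega> in P. (\<omega> \<in> A) = (\<omega> \<in> (\<Union>i\<in>{..<p m}. A \<inter> cyl m i {} a))"
      using probs_on_AE[OF PD(1) K_closed] by eventually_elim (auto simp: cyl_def K_iff)
  qed (use A Um probs_onD[OF PD(1)] in blast)+
  also have "\<dots> = (\<Sum>i<p m. measure P (A \<inter> cyl m i {} a))"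
    using Am probs_onD[OF PD(1)] by (intro finite_measure_finite_Union) (auto simp: disjoint_family_on_def cyl_def)
  also have "\<dots> = (\<Sum>i<p m. measure P (A \<inter> cyl m 0 {} a))" by (rule sum.cong[OF refl], rule eq0) simp
  finally have "measure P A = p m * measure P (A \<inter> cyl m 0 {} a)" by simp
  then show ?thesis unfolding eq0[OF j] using p_pos[of m] by simp
qed

text \<open>The centred pattern indicators \<open>Z i\<close>, translates of one another in time,
  are pairwise uncorrelated. By invariance all have the same correlation \<open>d\<close> with
  \<open>A\<close>, so \<open>d\<close> is the integral over \<open>A\<close> of an average of
  \<open>n\<close> translates, whose mean square is at most \<open>1 / n\<close>. Hence
  \<open>d = 0\<close>.\<close>

lemma invariant_set_law:
  assumes P: "P \<in> coded" and A: "A \<in> sets borel" "T -` A = A" and I: "finite I" and j: "j < p m"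
  shows "measure P (A \<inter> cyl m j I a) = measure P A * ((1/2) ^ card I / p m)"
proof -
  note PD = codedD[OF P]
  interpret prob_space P using probs_onD[OF PD(1)] by auto
  have TA: "(T ^^ i) \<omega> \<in> A \<longleftrightarrow> \<omega> \<in> A" for i \<omega>
  proof (induction i)
    case (Suc i)
    have "T ((T ^^ i) \<omega>) \<in> A \<longleftrightarrow> (T ^^ i) \<omega> \<in> A" using A(2) by (metis vimage_eq)
    then show ?case using Suc by simp
  qed simp
  obtain M where M: "\<And>i. i \<in> I \<Longrightarrow> i < M" using I finite_nat_set_iff_bounded by auto
  \<comment> \<open>A multiple of \<open>p m\<close>, so that a shift by \<open>s\<close> keeps
    phase \<open>m\<close>, and larger than all elements of \<open>I\<close>, so that the translates
    of \<open>I\<close> are disjoint.\<close>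
  define s where "s = p m * Suc M"
  have s: "s > 0" "p m dvd s" "\<And>i. i \<in> I \<Longrightarrow> i < s"
  proof -
    have "1 * Suc M \<le> s" unfolding s_def using p_pos[of m] by (intro mult_le_mono1) simp
    then show "s > 0" "\<And>i. i \<in> I \<Longrightarrow> i < s" using M by fastforce+
    show "p m dvd s" unfolding s_def by simp
  qed
  \<comment> \<open>The pattern is extended periodically, so that all translates of \<open>I\<close>
    carry the same prescription.\<close>
  define a' where "a' x = a (x mod s)" for x
  define c where "c J = cyl m j J a'" for J
  define b :: real where "b = (1/2) ^ card I"
  define Is where "Is i = (\<lambda>l. l + i * s) ` I" for i
  have Ifin: "finite (Is i)" and Icard: "card (Is i) = card I" for i
    unfolding Is_def using I by (auto intro!: card_image inj_onI)
  have Idisj: "Is i \<inter> Is l = {}" if "i \<noteq> l" for i l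
  proof -
    have "x div s = i" if "x \<in> Is i" for x i using that s unfolding Is_def by auto
    then show ?thesis using that by blast
  qed
  have cb: "c J \<in> sets borel" if "finite J" for J unfolding c_def using cyl_clopen(1)[OF that] by simp
  have cP: "measure P (c J) = (1/2) ^ card J / p m" if "finite J" for J
    unfolding c_def by (rule PD(3)[OF that j])
  have c0: "cyl m j I a = c (Is 0)" unfolding c_def cyl_def Is_def a'_def using s(3) by auto
  have cc: "c J \<inter> c J' = c (J \<union> J')" "c J \<subseteq> c {}" for J J' unfolding c_def cyl_def by auto
  \<comment> \<open>Centred relative to the phase: \<open>b\<close> is the conditional probability
    of the pattern given that phase \<open>m\<close> is \<open>j\<close>.\<close>
  define Z where "Z i \<omega> = indicator (c (Is i)) \<omega> - b * (indicator (c {}) \<omega> :: real)" for i \<omega>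
  have ind: "(\<integral>\<omega>. indicator B \<omega> \<partial>P) = measure P B" "integrable P (indicator B :: _ \<Rightarrow> real)"
    if "B \<in> sets borel" for B
    using that probs_onD[OF PD(1)] by (simp_all add: sets.Int_space_eq2 emeasure_eq_measure)
  have Zb: "Z i \<in> borel_measurable borel" for i
    unfolding Z_def[abs_def] using cb[OF Ifin] cb[of "{}"] by auto
  have b01: "0 \<le> b" "b \<le> 1" unfolding b_def by (auto simp: power_le_one)
  have Z1: "\<bar>Z i \<omega>\<bar> \<le> 1" for i \<omega>
    unfolding Z_def using b01 cc(2)[of "Is i"] by (auto simp: indicator_def)
  have ZZ: "Z i \<omega> * Z l \<omega> = indicator (c (Is i \<union> Is l)) \<omega> - b * indicator (c (Is i)) \<omega>
      - b * indicator (c (Is l)) \<omega> + b\<^sup>2 * indicator (c {}) \<omega>" for i l \<omega>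
    unfolding Z_def cc(1)[symmetric] using cc(2)[of "Is i"] cc(2)[of "Is l"]
    by (auto simp: indicator_def power2_eq_square algebra_simps)
  have orth: "(\<integral>\<omega>. Z i \<omega> * Z l \<omega> \<partial>P) = 0" if "i \<noteq> l" for i l
  proof -
    have U: "card (Is i \<union> Is l) = card I + card I"
      using card_Un_disjoint[OF Ifin Ifin Idisj[OF that]] Icard by simp
    have fU: "finite (Is i \<union> Is l)" using Ifin by simp
    have "(\<integral>\<omega>. Z i \<omega> * Z l \<omega> \<partial>P) = measure P (c (Is i \<union> Is l)) - b * measure P (c (Is i)) - b * measure P (c (Is l)) + b\<^sup>2 * measure P (c {})"
      unfolding ZZ using ind[OF cb[OF fU]] ind[OF cb[OF Ifin]] ind[OF cb[of "{}"]] by simp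
    also have "\<dots> = 0"
      unfolding cP[OF fU] cP[OF Ifin] cP[OF finite.emptyI] U Icard b_def by (simp add: power_add power2_eq_square)
    finally show ?thesis .
  qed
  define d where "d = measure P (A \<inter> cyl m j I a) - b * measure P (A \<inter> cyl m j {} a)"
  have c00: "c {} = cyl m j {} a" unfolding c_def cyl_def by simp
  have dZ: "d = (\<integral>\<omega>. indicator A \<omega> * Z i \<omega> \<partial>P)" for i
  proof -
    have "(\<integral>\<omega>. indicator A \<omega> * Z 0 \<omega> \<partial>P)
        = (\<integral>\<omega>. indicator (A \<inter> c (Is 0)) \<omega> - b * indicator (A \<inter> c {}) \<omega> \<partial>P)"
      unfolding Z_def by (intro Bochner_Integration.integral_cong) (auto simp: indicator_def)
    also have "\<dots> = d"
      unfolding d_def c00[symmetric] c0 using ind[of "A \<inter> c (Is 0)"] ind[of "A \<inter> c {}"] A cb[OF Ifin] cb[of "{}"] by simp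
    finally have "d = (\<integral>\<omega>. indicator A \<omega> * Z 0 \<omega> \<partial>P)" by simp
    also have "\<dots> = (\<integral>\<omega>. indicator A ((T ^^ (i * s)) \<omega>) * Z 0 ((T ^^ (i * s)) \<omega>) \<partial>P)"
      using T_pow_invariant(2)[OF PD(1,2), of "\<lambda>\<omega>. indicator A \<omega> * Z 0 \<omega>"] A Zb[of 0] by simp
    also have "\<dots> = (\<integral>\<omega>. indicator A \<omega> * Z i \<omega> \<partial>P)"
    proof (rule integral_cong_AE)
      show "AE \<omega> in P. indicator A ((T ^^ (i * s)) \<omega>) * Z 0 ((T ^^ (i * s)) \<omega>) = indicator A \<omega> * Z i \<omega>"
        using probs_on_AE[OF PD(1) K_closed]
      proof eventually_elim
        case (elim \<omega>)
        have ph: "phase ((T ^^ (i * s)) \<omega>) m = phase \<omega> m"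
        proof -
          obtain e where "s = p m * e" using s(2) by (rule dvdE)
          then have "(phase \<omega> m + i * s) mod p m = phase \<omega> m mod p m"
            by (metis mod_mult_self2 mult.left_commute)
          then show ?thesis unfolding phase_T_pow[OF elim] using elim by (simp add: K_iff)
        qed
        have ci: "((T ^^ (i * s)) \<omega> \<in> c (Is 0)) = (\<omega> \<in> c (Is i))" "((T ^^ (i * s)) \<omega> \<in> c {}) = (\<omega> \<in> c {})"
          unfolding c_def cyl_def Is_def a'_def using ph s(3) by (auto simp: coin_T_pow)
        show ?case unfolding Z_def indicator_def using ci TA by simp
      qed
      have tm: "T ^^ (i * s) \<in> borel_measurable P"
        using funpow_borel_measurable[OF T_measurable] measurable_cong_sets[OF probs_onD(2)[OF PD(1)] refl] by blast
      show "(\<lambda>\<omega>. indicator A ((T ^^ (i * s)) \<omega>) * Z 0 ((T ^^ (i * s)) \<omega>)) \<in> borel_measurable P"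
        by (rule measurable_compose[OF tm, of "\<lambda>\<omega>. indicator A \<omega> * Z 0 \<omega>"]) (use A Zb[of 0] in auto)
      show "(\<lambda>\<omega>. indicator A \<omega> * Z i \<omega>) \<in> borel_measurable P"
        using A Zb[of i] measurable_cong_sets[OF probs_onD(2)[OF PD(1)] refl, of borel] by auto
    qed
    finally show ?thesis .
  qed
  have small: "\<bar>d\<bar> \<le> e" if e: "e > 0" for e :: real
  proof -
    obtain n :: nat where n: "1 / e\<^sup>2 < n" using reals_Archimedean2 by blast
    have "0 < 1 / e\<^sup>2" using e by simp
    then have npos: "real n > 0" using n by linarith
    have ne: "1 / n \<le> e\<^sup>2" using n npos e by (simp add: field_simps)
    define V where "V \<omega> = (\<Sum>i<n. Z i \<omega>)" for \<omega>
    have iZ: "integrable P (\<lambda>\<omega>. indicator A \<omega> * Z i \<omega>)" for i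
      using A Zb[of i] Z1 probs_onD[OF PD(1)]
      by (intro integrable_bounded_borel[of _ _ 1]) (auto simp: prob_space_axioms abs_mult indicator_def)
    have iZZ: "integrable P (\<lambda>\<omega>. Z i \<omega> * Z l \<omega>)" for i l
      using Zb[of i] Zb[of l] Z1 probs_onD[OF PD(1)]
      by (intro integrable_bounded_borel[of _ _ 1]) (auto simp: prob_space_axioms abs_mult mult_le_one)
    have VV: "(V \<omega>)\<^sup>2 = (\<Sum>i<n. \<Sum>l<n. Z i \<omega> * Z l \<omega>)" for \<omega>
      unfolding V_def power2_eq_square by (rule sum_product)
    have iVV: "integrable P (\<lambda>\<omega>. (V \<omega>)\<^sup>2)" unfolding VV using iZZ by auto
    have "(\<integral>\<omega>. (V \<omega>)\<^sup>2 \<partial>P) = (\<Sum>i<n. \<Sum>l<n. \<integral>\<omega>. Z i \<omega> * Z l \<omega> \<partial>P)"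
      unfolding VV using iZZ by (simp add: Bochner_Integration.integral_sum)
    also have "\<dots> \<le> (\<Sum>i<n. \<Sum>l<n. if l = i then 1 else 0)"
    proof (intro sum_mono)
      fix i l
      have "(\<integral>\<omega>. Z i \<omega> * Z i \<omega> \<partial>P) \<le> 1"
        using Z1[of i] by (intro integral_le_const[OF iZZ] AE_I2) (metis abs_le_square_iff abs_one one_power2 power2_eq_square)
      then show "(\<integral>\<omega>. Z i \<omega> * Z l \<omega> \<partial>P) \<le> (if l = i then 1 else 0)" using orth[of i l] by auto
    qed
    also have "\<dots> = n" by simp
    finally have V2: "(\<integral>\<omega>. (V \<omega>)\<^sup>2 \<partial>P) \<le> n" .
    \<comment> \<open>The bound \<open>v \<le> e / 2 + v^2 / (2 * e)\<close> takes the place of the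
      Cauchy-Schwarz inequality; after integration each term contributes at most
      \<open>e / 2\<close>, because \<open>1 / n \<le> e^2\<close>.\<close>
    have pt: "\<bar>indicator A \<omega> * (V \<omega> / n)\<bar> \<le> e / 2 + (V \<omega>)\<^sup>2 / (2 * e * (real n)\<^sup>2)" for \<omega>
    proof -
      define v where "v = \<bar>V \<omega> / n\<bar>"
      have "0 \<le> (v - e)\<^sup>2 / (2 * e)" using e by simp
      also have "\<dots> = v\<^sup>2 / (2 * e) - v + e / 2" using e by (simp add: power2_eq_square field_simps)
      finally have "v \<le> e / 2 + v\<^sup>2 / (2 * e)" by simp
      moreover have "v\<^sup>2 / (2 * e) = (V \<omega>)\<^sup>2 / (2 * e * (real n)\<^sup>2)" unfolding v_def by (simp add: power_divide)
      moreover have "\<bar>indicator A \<omega> * (V \<omega> / n)\<bar> \<le> v" unfolding v_def by (simp add: indicator_def)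
      ultimately show ?thesis by linarith
    qed
    have "n * d = (\<Sum>i<n. \<integral>\<omega>. indicator A \<omega> * Z i \<omega> \<partial>P)" using dZ by simp
    also have "\<dots> = (\<integral>\<omega>. (\<Sum>i<n. indicator A \<omega> * Z i \<omega>) \<partial>P)"
      by (rule Bochner_Integration.integral_sum[symmetric]) (rule iZ)
    also have "\<dots> = (\<integral>\<omega>. indicator A \<omega> * V \<omega> \<partial>P)" by (simp only: V_def sum_distrib_left)
    finally have dV: "d = (\<integral>\<omega>. indicator A \<omega> * (V \<omega> / n) \<partial>P)" using npos by (simp add: field_simps)
    have "integrable P (\<lambda>\<omega>. indicator A \<omega> * V \<omega>)"
      unfolding V_def sum_distrib_left by (intro Bochner_Integration.integrable_sum iZ)
    then have iA: "integrable P (\<lambda>\<omega>. indicator A \<omega> * (V \<omega> / n))" by simp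
    have iR: "integrable P (\<lambda>\<omega>. e / 2 + (V \<omega>)\<^sup>2 / (2 * e * (real n)\<^sup>2))"
      using iVV by (intro Bochner_Integration.integrable_add) auto
    have "\<bar>d\<bar> \<le> (\<integral>\<omega>. \<bar>indicator A \<omega> * (V \<omega> / n)\<bar> \<partial>P)" unfolding dV by (rule integral_abs_bound)
    also have "\<dots> \<le> (\<integral>\<omega>. e / 2 + (V \<omega>)\<^sup>2 / (2 * e * (real n)\<^sup>2) \<partial>P)"
      by (rule integral_mono[OF integrable_abs[OF iA] iR pt])
    also have "\<dots> = e / 2 + (\<integral>\<omega>. (V \<omega>)\<^sup>2 \<partial>P) / (2 * e * (real n)\<^sup>2)"
      using iVV by (simp add: prob_space)
    also have "\<dots> \<le> e / 2 + n / (2 * e * (real n)\<^sup>2)"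
      using V2 e by (intro add_mono divide_right_mono) auto
    also have "n / (2 * e * (real n)\<^sup>2) = (1 / n) / (2 * e)" using npos by (simp add: power2_eq_square)
    also have "(1 / n) / (2 * e) \<le> e\<^sup>2 / (2 * e)" using ne e by (intro divide_right_mono) auto
    also have "e / 2 + e\<^sup>2 / (2 * e) = e" using e by (simp add: power2_eq_square)
    finally show ?thesis by simp
  qed
  have "d = 0"
  proof (rule ccontr)
    assume "d \<noteq> 0"
    then show False using small[of "\<bar>d\<bar> / 2"] by simp
  qed
  then show ?thesis
    unfolding d_def b_def invariant_phase_uniform[OF P A j] by simp
qed

text \<open>Invariance and the full or null events survive conditioning on an invariant set at once;
  the law of bits and phases does so by \<open>invariant_set_law\<close>.\<close>

lemma coded_face:
  assumes P: "P \<in> coded" and A: "A \<in> sets borel" "T -` A = A" "0 < measure P A"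
  shows "uniform_measure P A \<in> coded"
proof -
  note PD = codedD[OF P]
  interpret prob_space P using probs_onD[OF PD(1)] by auto
  define Q where "Q = uniform_measure P A"
  have A0: "emeasure P A \<noteq> 0" "emeasure P A \<noteq> \<infinity>" using A(3) by (auto simp: emeasure_eq_measure)
  have Qm: "measure Q B = measure P (A \<inter> B) / measure P A" if "B \<in> sets borel" for B
    unfolding Q_def using measure_uniform_measure[OF A0, of B] that probs_onD[OF PD(1)] by simp
  have Qs: "sets Q = sets borel" unfolding Q_def using probs_onD[OF PD(1)] by simp
  have Qp: "prob_space Q" unfolding Q_def by (rule prob_space_uniform_measure[OF A0])
  have full: "measure Q B = 1" if "B \<in> sets borel" "measure P B = 1" for B
  proof -
    have "measure P (A \<inter> B) = measure P A"
    proof (rule measure_eq_AE)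
      have "AE \<omega> in P. \<omega> \<in> B" using that probs_onD[OF PD(1)] AE_in_set_eq_1[of B] by auto
      then show "AE \<omega> in P. (\<omega> \<in> A \<inter> B) = (\<omega> \<in> A)" by eventually_elim auto
    qed (use that A probs_onD[OF PD(1)] in auto)
    then show ?thesis using Qm[OF that(1)] A(3) by simp
  qed
  have QK: "Q \<in> probs_on K"
    unfolding probs_on_def using Qs Qp full[of K] probs_onD[OF PD(1)] K_closed by auto
  have TQ: "T \<in> measurable Q borel" using T_measurable measurable_cong_sets[OF Qs refl] by blast
  have inv: "distr Q borel T = Q"
  proof (rule probs_on_eqI_open[OF distr_T_probs_on[OF QK] QK])
    fix V :: "'a state set" assume V: "open V"
    have TV: "T -` V \<in> sets borel" using measurable_sets[OF T_measurable, of V] V by simp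
    have "measure (distr Q borel T) V = measure Q (T -` V)"
      using measure_distr[OF TQ, of V] V probs_onD[OF QK] by simp
    also have "\<dots> = measure P (T -` (A \<inter> V)) / measure P A"
      using Qm[OF TV] A(2) by (metis vimage_Int)
    also have "measure P (T -` (A \<inter> V)) = measure P (A \<inter> V)"
      using T_pow_invariant(1)[OF PD(1,2), of "A \<inter> V" 1] A V by simp
    finally show "measure (distr Q borel T) V = measure Q V" using Qm[of V] V by simp
  qed
  have law: "measure Q (cyl m j I a) = (1/2) ^ card I / p m" if "finite I" "j < p m" for m j I a
    using Qm[of "cyl m j I a"] cyl_clopen[OF that(1)] invariant_set_law[OF P A(1,2) that] A(3) by simp
  have cons: "measure Q (consistent n) = 1" for n
    using full[OF _ PD(4)] consistent_clopen by simp
  have blocks: "measure Q ({\<omega>. phase \<omega> \<in> good n} \<inter> outside n) = 0" for n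
  proof -
    let ?B = "{\<omega>. phase \<omega> \<in> good n} \<inter> outside n"
    have B: "?B \<in> sets borel" using good_closed outside_open by auto
    then have "measure P (A \<inter> ?B) \<le> measure P ?B"
      using A probs_onD[OF PD(1)] by (intro finite_measure_mono) auto
    then have "measure P (A \<inter> ?B) = 0" using PD(5)[of n] measure_nonneg[of P "A \<inter> ?B"] by linarith
    then show ?thesis using Qm[OF B] by simp
  qed
  show ?thesis unfolding Q_def[symmetric] coded_def by (intro CollectI conjI allI impI QK inv law cons blocks)
qed

end

section \<open>Frequency of good phases and the sign of the mean\<close>

lemma card_mod_filter:
  assumes "(b::nat) > 0"
  shows "card {j. j < a * b \<and> Q (j mod b)} = a * card {r. r < b \<and> Q r}"
proof (induction a)
  case (Suc a)
  have "{j. j < Suc a * b \<and> Q (j mod b)} = {j. j < a * b \<and> Q (j mod b)} \<union> (\<lambda>r. a * b + r) ` {r. r < b \<and> Q r}" (is "?L = ?A \<union> ?B")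
  proof (intro set_eqI iffI)
    fix j assume j: "j \<in> ?L"
    show "j \<in> ?A \<union> ?B"
    proof (cases "j < a * b")
      case False
      define r where "r = j - a * b"
      have r: "j = a * b + r" "r < b" using j False unfolding r_def by auto
      then have "Q r" using j by simp
      then show ?thesis using r by blast
    qed (use j in auto)
  qed (use assms in auto)
  moreover have "card (?A \<union> ?B) = card ?A + card ?B"
    by (rule card_Un_disjoint) auto
  moreover have "card ?B = card {r. r < b \<and> Q r}" by (rule card_image) (auto simp: inj_on_def)
  ultimately show ?case using Suc by simp
qed simp

lemma card_coin_cylinder:
  assumes "I \<subseteq> {..<p}"
  shows "real (card {c \<in> coin_words p. \<forall>i\<in>I. c i = a i}) = 2 ^ p * (1/2) ^ card I"
proof -
  have fI: "finite I" "card I \<le> p" using assms finite_subset card_mono[OF _ assms] by auto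
  have "bij_betw (\<lambda>A i. if i \<in> I then a i else i \<in> A) (Pow ({..<p} - I)) {c \<in> coin_words p. \<forall>i\<in>I. c i = a i}"
    by (rule bij_betwI[where g = "\<lambda>c. {i. c i} - I"])
       (use assms in \<open>auto simp: coin_words_def fun_eq_iff not_less[symmetric]\<close>)
  from bij_betw_same_card[OF this] have "card {c \<in> coin_words p. \<forall>i\<in>I. c i = a i} = 2 ^ (p - card I)"
    using fI assms by (simp add: card_Pow card_Diff_subset)
  then have "real (card {c \<in> coin_words p. \<forall>i\<in>I. c i = a i}) = (2::real) ^ (p - card I)" by simp
  then show ?thesis using fI(2) by (simp only: power_diff) (simp add: power_diff power_one_over)
qed

context block_system
begin

definition tail :: "nat \<Rightarrow> real" where "tail n = (\<Sum>i. fill (i + n))"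

lemma tail_tendsto: "tail \<longlonglongrightarrow> 0"
  unfolding tail_def by (rule suminf_exist_split2[OF fill_summable])

text \<open>The factor \<open>1 / p n\<close> matters, since the event that phase \<open>n\<close>
  is 0 has only this measure altogether. It arises because \<open>p n\<close> divides both ends of
  the filler interval \<open>{q m * p m..<p (Suc m)}\<close>, so the multiples of \<open>p n\<close>
  make up exactly their share of it.\<close>

lemma measure_zero_bad:
  assumes P: "P \<in> coded" and nm: "n \<le> m"
  shows "measure P ({\<omega>. phase \<omega> n = 0} \<inter> bad m) \<le> fill m / p n"
proof -
  note PD = codedD[OF P]
  interpret prob_space P using probs_onD[OF PD(1)] by auto
  obtain A where A: "p m = p n * A" using p_dvd[OF nm] by (rule dvdE)
  obtain B where B: "p (Suc m) = p n * B" using p_dvd[of n "Suc m"] nm by (auto elim: dvdE)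
  define J where "J = {i. q m * p m \<le> i \<and> p n dvd i}"
  have Jo: "open {\<omega>::'a state. phase \<omega> (Suc m) \<in> J}" by (rule finite_coordinates_open[of "Suc (Suc m)"]) simp
  have "AE \<omega> in P. \<omega> \<in> {\<omega>. phase \<omega> n = 0} \<inter> bad m \<longrightarrow> \<omega> \<in> {\<omega>. phase \<omega> (Suc m) \<in> J}"
    using coded_AE[OF P]
  proof eventually_elim
    case (elim \<omega>)
    have "phase \<omega> n = phase \<omega> (Suc m) mod p n" using elim nm by (meson le_Suc_eq)
    then show ?case unfolding J_def bad_def by (auto simp: mod_eq_0_iff_dvd)
  qed
  then have "measure P ({\<omega>. phase \<omega> n = 0} \<inter> bad m) \<le> measure P {\<omega>. phase \<omega> (Suc m) \<in> J}"
    by (rule finite_measure_mono_AE) (use Jo probs_onD[OF PD(1)] in auto)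
  also have "\<dots> = card (J \<inter> {..<p (Suc m)}) / p (Suc m)"
    using level_law[OF P, of "{}" "Suc m" J] by simp
  also have "\<dots> \<le> real (B - q m * A) / p (Suc m)"
  proof -
    have "J \<inter> {..<p (Suc m)} \<subseteq> (\<lambda>i. p n * i) ` {q m * A..<B}"
    proof
      fix j assume j: "j \<in> J \<inter> {..<p (Suc m)}"
      then obtain i where i: "j = p n * i" unfolding J_def by (auto elim: dvdE)
      have "p n * (q m * A) \<le> p n * i" using j unfolding i J_def A by (simp add: mult.left_commute)
      moreover have "p n * i < p n * B" using j unfolding i B by simp
      ultimately have "q m * A \<le> i" "i < B" using p_pos[of n] by auto
      then show "j \<in> (\<lambda>i. p n * i) ` {q m * A..<B}" using i by auto
    qed
    then have "card (J \<inter> {..<p (Suc m)}) \<le> card ((\<lambda>i. p n * i) ` {q m * A..<B})" by (intro card_mono) auto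
    also have "\<dots> \<le> B - q m * A" using card_image_le[of "{q m * A..<B}" "\<lambda>i. p n * i"] by simp
    finally show ?thesis by (intro divide_right_mono) auto
  qed
  also have "real (B - q m * A) / p (Suc m) = fill m / p n"
  proof -
    have "p n * (q m * A) \<le> p n * B" using q_le[of m] unfolding A B by (simp add: mult.left_commute)
    then have le: "q m * A \<le> B" using p_pos[of n] by simp
    have Bp: "B > 0" using p_pos[of "Suc m"] unfolding B by simp
    have f: "fill m = 1 - real (q m * A) / B"
      unfolding fill_def A B using p_pos[of n] Bp by (simp add: field_simps)
    show ?thesis unfolding f B of_nat_diff[OF le] using Bp p_pos[of n] by (simp add: field_simps)
  qed
  finally show ?thesis .
qed

lemma good_borel: "{\<omega>::'a state. phase \<omega> \<in> good n} \<in> sets borel"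
  using good_closed by (rule borel_closed)

lemma phase_zero_open: "open {\<omega>::'a state. phase \<omega> n = j}"
  by (rule finite_coordinates_open[of "Suc n"]) simp

text \<open>So among the starts of level-\<open>n\<close> words a proportion of at most
  \<open>tail n\<close> leaves the point unconstrained.\<close>

lemma measure_zero_not_good:
  assumes P: "P \<in> coded"
  shows "measure P ({\<omega>. phase \<omega> n = 0} - {\<omega>. phase \<omega> \<in> good n}) \<le> tail n / p n"
proof -
  note PD = codedD[OF P]
  interpret prob_space P using probs_onD[OF PD(1)] by auto
  let ?B = "\<lambda>i. {\<omega>. phase \<omega> n = 0} \<inter> bad (i + n)"
  have B: "range ?B \<subseteq> sets P"
    using borel_open[OF open_Int[OF phase_zero_open bad_clopen(1)]] probs_onD(2)[OF PD(1)] by blast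
  have le: "measure P (?B i) \<le> fill (i + n) / p n" for i by (rule measure_zero_bad[OF P]) simp
  have sf: "summable (\<lambda>i. fill (i + n) / p n)"
    by (intro summable_divide summable_ignore_initial_segment fill_summable)
  have sB: "summable (\<lambda>i. measure P (?B i))"
    by (rule summable_comparison_test'[OF sf]) (use le in simp)
  have "{\<omega>. phase \<omega> n = 0} - {\<omega>. phase \<omega> \<in> good n} \<subseteq> (\<Union>i. ?B i)"
  proof
    fix \<omega> :: "'a state" assume w: "\<omega> \<in> {\<omega>. phase \<omega> n = 0} - {\<omega>. phase \<omega> \<in> good n}"
    then obtain j where j: "j \<ge> n" "\<not> phase \<omega> (Suc j) < q j * p j" unfolding good_def by auto
    then have "\<omega> \<in> ?B (j - n)" using w unfolding bad_def by simp
    then show "\<omega> \<in> (\<Union>i. ?B i)" by blast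
  qed
  then have "measure P ({\<omega>. phase \<omega> n = 0} - {\<omega>. phase \<omega> \<in> good n}) \<le> measure P (\<Union>i. ?B i)"
    by (rule finite_measure_mono[OF _ sets.countable_UN[OF B]])
  also have "\<dots> \<le> (\<Sum>i. measure P (?B i))" by (rule finite_measure_subadditive_countably[OF B sB])
  also have "\<dots> \<le> (\<Sum>i. fill (i + n) / p n)" by (rule suminf_le[OF le sB sf])
  also have "\<dots> = tail n / p n"
    unfolding tail_def by (rule suminf_divide[OF summable_ignore_initial_segment[OF fill_summable]])
  finally show ?thesis .
qed

lemma measure_phase_zero:
  assumes P: "P \<in> coded"
  shows "measure P {\<omega>. phase \<omega> n = 0} = 1 / p n"
  using codedD(3)[OF P, of "{}" 0 n] p_pos[of n] unfolding cyl_def by simp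

text \<open>Good starts occur as soon as \<open>tail n < 1\<close>.\<close>

lemma good_pos:
  assumes P: "P \<in> coded"
  obtains n0 where "\<And>n. n \<ge> n0 \<Longrightarrow> measure P {\<omega>. phase \<omega> \<in> good n} > 0"
proof -
  interpret prob_space P using probs_onD[OF codedD(1)[OF P]] by auto
  obtain n0 where n0: "\<And>n. n \<ge> n0 \<Longrightarrow> \<bar>tail n\<bar> < 1"
    using LIMSEQ_D[OF tail_tendsto, of 1] by auto
  have "measure P {\<omega>. phase \<omega> \<in> good n} > 0" if "n \<ge> n0" for n
  proof -
    have "{\<omega>::'a state. phase \<omega> \<in> good n} \<subseteq> {\<omega>. phase \<omega> n = 0}" unfolding good_def by auto
    then have "measure P ({\<omega>. phase \<omega> n = 0} - {\<omega>. phase \<omega> \<in> good n}) = 1 / p n - measure P {\<omega>. phase \<omega> \<in> good n}"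
      using finite_measure_Diff[of "{\<omega>. phase \<omega> n = 0}" "{\<omega>. phase \<omega> \<in> good n}"] measure_phase_zero[OF P]
        borel_open[OF phase_zero_open] good_borel probs_onD(2)[OF codedD(1)[OF P]] by simp
    then have "1 / p n - tail n / p n \<le> measure P {\<omega>. phase \<omega> \<in> good n}" using measure_zero_not_good[OF P, of n] by linarith
    moreover have "0 < (1 - tail n) / p n" using n0[OF that] p_pos[of n] by simp
    ultimately show ?thesis by (simp add: diff_divide_distrib)
  qed
  then show ?thesis using that by blast
qed

lemma good_upto_eventually: "\<forall>\<^sub>F m in sequentially. \<theta> \<in> good_upto n m \<longleftrightarrow> \<theta> \<in> good n"
proof (cases "\<theta> \<in> good n")
  case True
  then have "\<theta> \<in> good_upto n m" for m unfolding good_Inter by blast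
  then show ?thesis using True by simp
next
  case False
  then obtain m0 where m0: "\<theta> \<notin> good_upto n m0" unfolding good_Inter by blast
  have "\<theta> \<notin> good_upto n m" if "m \<ge> m0" for m
    using m0 that unfolding good_upto_def by auto
  then show ?thesis using False unfolding eventually_sequentially by blast
qed

lemma good_upper_integrable:
  assumes P: "P \<in> coded"
  shows "integrable P (\<lambda>\<omega>. indicator {\<omega>. phase \<omega> \<in> good n} \<omega> * u n (coin \<omega>))"
proof -
  note PD = codedD[OF P]
  obtain C where C: "C \<ge> 0" "\<And>x. \<bar>\<phi> x\<bar> \<le> C" using \<phi>_bounded by metis
  have um: "(\<lambda>\<omega>::'a state. u n (coin \<omega>)) \<in> borel_measurable borel"
  proof (rule borel_measurable_continuous_onI)
    show "continuous_on UNIV (\<lambda>\<omega>::'a state. u n (coin \<omega>))"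
      unfolding continuous_on_open_vimage[OF open_UNIV]
    proof (intro allI impI)
      fix B :: "real set"
      have "open ((\<lambda>\<omega>::'a state. u n (coin \<omega>)) -` B)"
      proof (rule finite_coordinates_open[of "p n"], intro allI impI)
        fix \<omega> \<omega>' :: "'a state"
        assume eq: "\<forall>i<p n. coin \<omega> i = coin \<omega>' i \<and> phase \<omega> i = phase \<omega>' i" and "\<omega> \<in> (\<lambda>\<omega>. u n (coin \<omega>)) -` B"
        moreover have "u n (coin \<omega>) = u n (coin \<omega>')" using u_dep[of n] eq unfolding depends_below_def by blast
        ultimately show "\<omega>' \<in> (\<lambda>\<omega>. u n (coin \<omega>)) -` B" by simp
      qed
      then show "open ((\<lambda>\<omega>::'a state. u n (coin \<omega>)) -` B \<inter> UNIV)" by simp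
    qed
  qed
  have ub: "\<bar>u n c\<bar> \<le> C * p n" for c
  proof -
    obtain x where x: "x \<in> W n c" using W_ne by blast
    have "S (p n) x \<le> u n c" using u_upper[of x n c] x closure_subset by blast
    moreover have "u n c \<le> C * p n"
      by (rule cSUP_least[OF W_ne]) (use birkhoff_sum_bound[of \<phi> C f "p n", OF C(2)] in \<open>meson abs_le_D1\<close>)
    moreover have "- (C * p n) \<le> S (p n) x" using birkhoff_sum_bound[of \<phi> C f "p n" x, OF C(2)] by linarith
    ultimately show ?thesis by linarith
  qed
  have "(\<lambda>\<omega>::'a state. indicator {\<omega>. phase \<omega> \<in> good n} \<omega> * u n (coin \<omega>)) \<in> borel_measurable borel"
    by (intro borel_measurable_times borel_measurable_indicator good_borel um)
  then show ?thesis
    by (rule integrable_bounded_borel[OF probs_onD(1,2)[OF PD(1)], of _ "C * p n"])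
       (use ub C(1) in \<open>simp add: indicator_def\<close>)
qed

text \<open>Here the independence of bits and phases is used: restricted to good phases the first
  \<open>p n\<close> bits remain uniform, so \<open>u n\<close> is averaged over all coin
  words.\<close>

lemma integral_good_upper:
  assumes P: "P \<in> coded"
  shows "(\<integral>\<omega>. indicator {\<omega>. phase \<omega> \<in> good n} \<omega> * u n (coin \<omega>) \<partial>P) = measure P {\<omega>. phase \<omega> \<in> good n} * coin_avg (p n) (u n)"
proof -
  note PD = codedD[OF P]
  interpret prob_space P using probs_onD[OF PD(1)] by auto
  let ?G = "{\<omega>::'a state. phase \<omega> \<in> good n}"
  let ?E = "\<lambda>a. {\<omega>::'a state. \<forall>i\<in>{..<p n}. coin \<omega> i = a i}"
  have E: "?G \<inter> ?E a \<in> sets P" for a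
    using good_borel[of n] borel_open[OF coins_open[of "{..<p n}" a]] probs_onD(2)[OF PD(1)] by auto
  have dec: "indicator ?G \<omega> * u n (coin \<omega>) = (\<Sum>a\<in>coin_words (p n). u n a * indicator (?G \<inter> ?E a) \<omega>)" for \<omega>
  proof -
    define a0 where "a0 i = (i < p n \<and> coin \<omega> i)" for i
    have a0: "a0 \<in> coin_words (p n)" unfolding a0_def coin_words_def by simp
    have "(\<forall>i\<in>{..<p n}. coin \<omega> i = a i) \<longleftrightarrow> a = a0" if "a \<in> coin_words (p n)" for a
    proof
      assume eq: "\<forall>i\<in>{..<p n}. coin \<omega> i = a i"
      show "a = a0"
      proof
        fix i show "a i = a0 i" using eq that unfolding a0_def coin_words_def by (cases "i < p n") auto
      qed
    qed (simp add: a0_def)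
    then have "(\<Sum>a\<in>coin_words (p n). u n a * indicator (?G \<inter> ?E a) \<omega>)
        = (\<Sum>a\<in>coin_words (p n). if a = a0 then u n a0 * indicator ?G \<omega> else 0)"
      by (intro sum.cong refl) (auto simp: indicator_def)
    also have "\<dots> = u n a0 * indicator ?G \<omega>" using a0 by simp
    also have "u n a0 = u n (coin \<omega>)"
    proof -
      have "\<forall>i<p n. a0 i = coin \<omega> i" by (simp add: a0_def)
      then show ?thesis using u_dep[of n] unfolding depends_below_def by blast
    qed
    finally show ?thesis by simp
  qed
  have "(\<integral>\<omega>. indicator ?G \<omega> * u n (coin \<omega>) \<partial>P) = (\<Sum>a\<in>coin_words (p n). u n a * measure P (?G \<inter> ?E a))"
    unfolding dec using E by (subst Bochner_Integration.integral_sum) (auto simp: emeasure_eq_measure sets.Int_space_eq2)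
  also have "\<dots> = (\<Sum>a\<in>coin_words (p n). u n a * ((1/2) ^ p n * measure P ?G))"
  proof (intro sum.cong refl arg_cong2[where f = "(*)"])
    fix a
    have "\<exists>d. \<forall>\<theta> \<theta>'. (\<forall>i\<le>d. \<theta> i = \<theta>' i) \<longrightarrow> \<theta> \<in> good_upto n m \<longrightarrow> \<theta>' \<in> good_upto n m" for m
      using good_upto_dep by blast
    from coins_independent[OF P _ this good_upto_eventually good_borel, of "{..<p n}" a]
    show "measure P (?G \<inter> ?E a) = (1/2) ^ p n * measure P ?G" by simp
  qed
  also have "\<dots> = measure P ?G * coin_avg (p n) (u n)"
    unfolding coin_avg_def by (simp add: sum_distrib_right[symmetric] sum_divide_distrib[symmetric] power_one_over)
  finally show ?thesis .
qed

lemma \<phi>_fst: "continuous_on UNIV (\<lambda>\<omega>::'a state. \<phi> (fst \<omega>))" "bounded (range (\<lambda>\<omega>::'a state. \<phi> (fst \<omega>)))"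
proof -
  show "continuous_on UNIV (\<lambda>\<omega>::'a state. \<phi> (fst \<omega>))"
    by (rule continuous_on_compose2[OF \<phi>_cont continuous_on_fst[OF continuous_on_id]]) simp
  obtain C where "\<And>x. \<bar>\<phi> x\<bar> \<le> C" using \<phi>_bounded by metis
  then show "bounded (range (\<lambda>\<omega>::'a state. \<phi> (fst \<omega>)))" by (intro boundedI[of _ C]) auto
qed

lemma S_fst: "(\<lambda>\<omega>::'a state. S n (fst \<omega>)) \<in> borel_measurable borel"
  by (rule borel_measurable_continuous_onI)
     (rule continuous_on_compose2[OF S_cont continuous_on_fst[OF continuous_on_id]], simp)

lemma blocks_AE:
  assumes P: "P \<in> coded"
  shows "AE \<omega> in P. phase \<omega> \<in> good n \<longrightarrow> fst \<omega> \<in> closure (W n (coin \<omega>))"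
proof -
  note PD = codedD[OF P]
  interpret prob_space P using probs_onD[OF PD(1)] by auto
  have "{\<omega>. phase \<omega> \<in> good n} \<inter> outside n \<in> sets P"
    using good_borel[of n] borel_open[OF outside_open[of n]] probs_onD(2)[OF PD(1)] by auto
  then have "{\<omega>. phase \<omega> \<in> good n} \<inter> outside n \<in> null_sets P"
    using PD(5)[of n] by (simp add: null_sets_def emeasure_eq_measure)
  from AE_not_in[OF this] show ?thesis by eventually_elim (simp add: outside_def)
qed

text \<open>By invariance the integral equals that of the Birkhoff sum \<open>S (p n)\<close> over
  the starts of level-\<open>n\<close> words. Good starts contribute at most a nonnegative multiple
  of the mean of \<open>u n\<close>, which is not positive; the others have measure at most
  \<open>tail n / p n\<close> and contribute at most \<open>C * tail n\<close>.\<close>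

lemma mean_nonpos:
  assumes P: "P \<in> coded"
  shows "(\<integral>\<omega>. \<phi> (fst \<omega>) \<partial>P) \<le> 0"
proof -
  note PD = codedD[OF P]
  interpret prob_space P using probs_onD[OF PD(1)] by auto
  obtain C where C: "C \<ge> 0" "\<And>x. \<bar>\<phi> x\<bar> \<le> C" using \<phi>_bounded by metis
  have "(\<integral>\<omega>. \<phi> (fst \<omega>) \<partial>P) \<le> C * tail n" for n
  proof -
    let ?F = "\<lambda>j. {\<omega>::'a state. phase \<omega> n = j}"
    let ?G = "{\<omega>::'a state. phase \<omega> \<in> good n}"
    have Fm: "?F j \<in> sets borel" for j by (rule borel_open[OF phase_zero_open])
    have \<phi>m: "(\<lambda>\<omega>::'a state. \<phi> (fst \<omega>)) \<in> borel_measurable borel"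
      by (rule borel_measurable_continuous_onI[OF \<phi>_fst(1)])
    have gm: "(\<lambda>\<omega>::'a state. \<phi> (fst \<omega>) * indicator (?F j) \<omega>) \<in> borel_measurable borel" for j
      using \<phi>m Fm[of j] by (intro borel_measurable_times borel_measurable_indicator)
    have gi: "integrable P (\<lambda>\<omega>. \<phi> (fst \<omega>) * indicator (?F j) \<omega>)" for j
      by (rule integrable_bounded_borel[OF prob_space_axioms probs_onD(2)[OF PD(1)] gm, of _ C])
         (use C in \<open>auto simp: indicator_def\<close>)
    have hm: "(\<lambda>\<omega>::'a state. \<phi> ((f ^^ j) (fst \<omega>)) * indicator (?F 0) \<omega>) \<in> borel_measurable borel" for j
    proof (intro borel_measurable_times borel_measurable_indicator Fm)
      have "continuous_on UNIV (\<lambda>\<omega>::'a state. \<phi> ((f ^^ j) (fst \<omega>)))"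
        by (rule continuous_on_compose2[OF \<phi>_cont continuous_on_compose2[OF funpow_cont continuous_on_fst[OF continuous_on_id]]]) auto
      then show "(\<lambda>\<omega>::'a state. \<phi> ((f ^^ j) (fst \<omega>))) \<in> borel_measurable borel" by (rule borel_measurable_continuous_onI)
    qed
    have hi: "integrable P (\<lambda>\<omega>. \<phi> ((f ^^ j) (fst \<omega>)) * indicator (?F 0) \<omega>)" for j
      by (rule integrable_bounded_borel[OF prob_space_axioms probs_onD(2)[OF PD(1)] hm, of _ C])
         (use C in \<open>auto simp: indicator_def\<close>)
    have meas: "h \<in> borel_measurable P" if "h \<in> borel_measurable borel" for h :: "'a state \<Rightarrow> real"
      using that measurable_cong_sets[OF probs_onD(2)[OF PD(1)] refl] by blast
    have shift: "(\<integral>\<omega>. \<phi> (fst \<omega>) * indicator (?F j) \<omega> \<partial>P) = (\<integral>\<omega>. \<phi> ((f ^^ j) (fst \<omega>)) * indicator (?F 0) \<omega> \<partial>P)"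
      if "j < p n" for j
    proof -
      have "(\<integral>\<omega>. \<phi> (fst \<omega>) * indicator (?F j) \<omega> \<partial>P)
          = (\<integral>\<omega>. \<phi> (fst ((T ^^ j) \<omega>)) * indicator (?F j) ((T ^^ j) \<omega>) \<partial>P)"
        by (rule T_pow_invariant(2)[OF PD(1,2) gm, symmetric])
      also have "\<dots> = (\<integral>\<omega>. \<phi> ((f ^^ j) (fst \<omega>)) * indicator (?F 0) \<omega> \<partial>P)"
      proof (rule integral_cong_AE)
        show "AE \<omega> in P. \<phi> (fst ((T ^^ j) \<omega>)) * indicator (?F j) ((T ^^ j) \<omega>) = \<phi> ((f ^^ j) (fst \<omega>)) * indicator (?F 0) \<omega>"
          using probs_on_AE[OF PD(1) K_closed]
        proof eventually_elim
          case (elim \<omega>)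
          have "phase ((T ^^ j) \<omega>) n = j \<longleftrightarrow> phase \<omega> n = 0"
            unfolding phase_T_pow[OF elim] using mod_add_eq_iff[OF _ that, of "phase \<omega> n"] elim by (simp add: K_iff)
          then show ?case unfolding fst_T_pow by (simp add: indicator_def)
        qed
        show "(\<lambda>\<omega>. \<phi> (fst ((T ^^ j) \<omega>)) * indicator (?F j) ((T ^^ j) \<omega>)) \<in> borel_measurable P"
          by (rule meas, rule measurable_compose[OF funpow_borel_measurable[OF T_measurable] gm])
        show "(\<lambda>\<omega>. \<phi> ((f ^^ j) (fst \<omega>)) * indicator (?F 0) \<omega>) \<in> borel_measurable P"
          by (rule meas[OF hm])
      qed
      finally show ?thesis .
    qed
    have "(\<integral>\<omega>. \<phi> (fst \<omega>) \<partial>P) = (\<integral>\<omega>. (\<Sum>j<p n. \<phi> (fst \<omega>) * indicator (?F j) \<omega>) \<partial>P)"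
    proof (rule integral_cong_AE)
      show "AE \<omega> in P. \<phi> (fst \<omega>) = (\<Sum>j<p n. \<phi> (fst \<omega>) * indicator (?F j) \<omega>)"
        using probs_on_AE[OF PD(1) K_closed]
      proof eventually_elim
        case (elim \<omega>)
        have "(\<Sum>j<p n. \<phi> (fst \<omega>) * indicator (?F j) \<omega>) = (\<Sum>j<p n. if j = phase \<omega> n then \<phi> (fst \<omega>) else 0)"
          by (intro sum.cong refl) (auto simp: indicator_def)
        then show ?case using elim by (simp add: K_iff)
      qed
      show "(\<lambda>\<omega>. \<phi> (fst \<omega>)) \<in> borel_measurable P" by (rule meas[OF \<phi>m])
      show "(\<lambda>\<omega>. \<Sum>j<p n. \<phi> (fst \<omega>) * indicator (?F j) \<omega>) \<in> borel_measurable P"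
        by (intro borel_measurable_sum meas gm)
    qed
    also have "\<dots> = (\<Sum>j<p n. \<integral>\<omega>. \<phi> (fst \<omega>) * indicator (?F j) \<omega> \<partial>P)"
      by (rule Bochner_Integration.integral_sum) (rule gi)
    also have "\<dots> = (\<Sum>j<p n. \<integral>\<omega>. \<phi> ((f ^^ j) (fst \<omega>)) * indicator (?F 0) \<omega> \<partial>P)"
      by (intro sum.cong refl shift) simp
    also have "\<dots> = (\<integral>\<omega>. (\<Sum>j<p n. \<phi> ((f ^^ j) (fst \<omega>)) * indicator (?F 0) \<omega>) \<partial>P)"
      by (rule Bochner_Integration.integral_sum[symmetric]) (rule hi)
    also have "\<dots> = (\<integral>\<omega>. S (p n) (fst \<omega>) * indicator (?F 0) \<omega> \<partial>P)"
      by (simp only: birkhoff_sum_def sum_distrib_right)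
    also have "\<dots> \<le> (\<integral>\<omega>. indicator ?G \<omega> * u n (coin \<omega>) + C * p n * indicator (?F 0 - ?G) \<omega> \<partial>P)"
    proof (rule integral_mono_AE)
      have FG: "?F 0 - ?G \<in> sets P" using Fm[of 0] good_borel[of n] probs_onD(2)[OF PD(1)] by auto
      show "integrable P (\<lambda>\<omega>. indicator ?G \<omega> * u n (coin \<omega>) + C * p n * indicator (?F 0 - ?G) \<omega>)"
        using FG by (intro Bochner_Integration.integrable_add good_upper_integrable[OF P] integrable_mult_right integrable_real_indicator) (auto simp: emeasure_eq_measure)
      have "(\<lambda>\<omega>. S (p n) (fst \<omega>) * indicator (?F 0) \<omega>) \<in> borel_measurable borel"
        by (intro borel_measurable_times borel_measurable_indicator Fm S_fst)
      then show "integrable P (\<lambda>\<omega>. S (p n) (fst \<omega>) * indicator (?F 0) \<omega>)"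
        by (rule integrable_bounded_borel[OF prob_space_axioms probs_onD(2)[OF PD(1)], of _ "C * p n"])
           (use birkhoff_sum_bound[of \<phi> C f "p n", OF C(2)] C(1) in \<open>simp add: indicator_def\<close>)
      have "AE \<omega> in P. phase \<omega> \<in> good n \<longrightarrow> fst \<omega> \<in> closure (W n (coin \<omega>))" by (rule blocks_AE[OF P])
      then show "AE \<omega> in P. S (p n) (fst \<omega>) * indicator (?F 0) \<omega> \<le> indicator ?G \<omega> * u n (coin \<omega>) + C * p n * indicator (?F 0 - ?G) \<omega>"
      proof eventually_elim
        case (elim \<omega>)
        have Sb: "S (p n) (fst \<omega>) \<le> C * p n" using birkhoff_sum_bound[of \<phi> C f "p n" "fst \<omega>", OF C(2)] by linarith
        show ?case
        proof (cases "\<omega> \<in> ?G")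
          case True
          then have "fst \<omega> \<in> closure (W n (coin \<omega>))" using elim by blast
          then have "S (p n) (fst \<omega>) \<le> u n (coin \<omega>)" by (rule u_upper)
          moreover have "\<omega> \<in> ?F 0" using True unfolding good_def by simp
          ultimately show ?thesis using True by simp
        next
          case False
          then show ?thesis using Sb C(1) by (simp add: indicator_def)
        qed
      qed
    qed
    also have "\<dots> = measure P ?G * coin_avg (p n) (u n) + C * p n * measure P (?F 0 - ?G)"
    proof -
      have FG: "?F 0 - ?G \<in> sets P" using Fm[of 0] good_borel[of n] probs_onD(2)[OF PD(1)] by auto
      note i1 = good_upper_integrable[OF P, of n]
      have i2: "integrable P (\<lambda>\<omega>. C * p n * indicator (?F 0 - ?G) \<omega>)"
        using FG by (intro integrable_mult_right integrable_real_indicator) (auto simp: emeasure_eq_measure)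
      show ?thesis
        unfolding Bochner_Integration.integral_add[OF i1 i2] integral_good_upper[OF P] using FG
        by (simp add: sets.Int_space_eq2)
    qed
    also have "\<dots> \<le> 0 + C * p n * (tail n / p n)"
      using W_avg_le[of n] measure_zero_not_good[OF P, of n] C(1)
      by (intro add_mono mult_nonneg_nonpos mult_left_mono) auto
    finally show ?thesis using p_pos[of n] by simp
  qed
  moreover have "(\<lambda>n. C * tail n) \<longlonglongrightarrow> C * 0" by (intro tendsto_intros tail_tendsto)
  ultimately show ?thesis by (intro LIMSEQ_le_const[of "\<lambda>n. C * tail n" 0]) auto
qed

end

section \<open>Approximating measures\<close>

context block_system
begin

text \<open>An additive loss of 1 per level-\<open>N\<close> word disappears after division by
  \<open>p N\<close>.\<close>

definition near_max :: "nat \<Rightarrow> (nat \<Rightarrow> bool) \<Rightarrow> 'a" where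
  "near_max N c = (SOME x. x \<in> W N c \<and> u N c - 1 \<le> S (p N) x)"

lemma near_max: "near_max N c \<in> W N c" "u N c - 1 \<le> S (p N) (near_max N c)"
proof -
  obtain C where C: "\<And>x. \<bar>\<phi> x\<bar> \<le> C" using \<phi>_bounded by metis
  have bdd: "bdd_above (S (p N) ` W N c)"
    using birkhoff_sum_bound[of \<phi> C f "p N", OF C] by (intro bdd_aboveI2[of _ _ "C * p N"]) (meson abs_le_D1)
  have "\<exists>x\<in>W N c. u N c - 1 < S (p N) x"
    using less_cSUP_iff[OF W_ne bdd, of "u N c - 1"] by simp
  then have "\<exists>x. x \<in> W N c \<and> u N c - 1 \<le> S (p N) x" by (auto intro: less_imp_le)
  from someI_ex[OF this] show "near_max N c \<in> W N c" "u N c - 1 \<le> S (p N) (near_max N c)"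
    unfolding near_max_def by auto
qed

text \<open>The state at time \<open>snd s\<close> of a level-\<open>N\<close> word with bits
  \<open>fst s\<close>. Bits beyond the word are \<open>False\<close>, which spoils their law only
  near its end.\<close>

definition point :: "nat \<Rightarrow> (nat \<Rightarrow> bool) \<times> nat \<Rightarrow> 'a state" where
  "point N s = ((f ^^ snd s) (near_max N (fst s)), \<lambda>i. fst s (i + snd s), \<lambda>m. snd s mod p m)"

definition seeds :: "nat \<Rightarrow> ((nat \<Rightarrow> bool) \<times> nat) set" where
  "seeds N = coin_words (p N) \<times> {..<p N}"

definition approx :: "nat \<Rightarrow> 'a state measure" where
  "approx N = distr (measure_pmf (pmf_of_set (seeds N))) borel (point N)"

lemma seeds: "finite (seeds N)" "seeds N \<noteq> {}" "card (seeds N) = 2 ^ p N * p N"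
proof -
  show "finite (seeds N)" unfolding seeds_def by simp
  show c: "card (seeds N) = 2 ^ p N * p N" unfolding seeds_def by (simp add: card_cartesian_product)
  show "seeds N \<noteq> {}" using c p_pos[of N] by (metis card.empty mult_is_0 not_gr0 power_not_zero zero_neq_numeral)
qed

lemma approx_integral:
  assumes "g \<in> borel_measurable borel"
  shows "(\<integral>\<omega>. (g \<omega> :: real) \<partial>approx N) = (\<Sum>s\<in>seeds N. g (point N s)) / (2 ^ p N * p N)"
proof -
  have "(\<integral>\<omega>. g \<omega> \<partial>approx N) = (\<integral>s. g (point N s) \<partial>measure_pmf (pmf_of_set (seeds N)))"
    unfolding approx_def by (rule integral_distr) (use assms in auto)
  also have "\<dots> = (\<Sum>s\<in>seeds N. g (point N s)) / card (seeds N)"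
    by (rule integral_pmf_of_set[OF seeds(2,1)])
  finally show ?thesis unfolding seeds(3) by simp
qed

lemma approx_measure:
  assumes "B \<in> sets borel"
  shows "measure (approx N) B = real (card {s \<in> seeds N. point N s \<in> B}) / (2 ^ p N * p N)"
proof -
  have "measure (approx N) B = measure (measure_pmf (pmf_of_set (seeds N))) (point N -` B)"
    unfolding approx_def using assms by (subst measure_distr) auto
  also have "\<dots> = card (seeds N \<inter> point N -` B) / card (seeds N)"
    by (rule measure_pmf_of_set[OF seeds(2,1)])
  also have "seeds N \<inter> point N -` B = {s \<in> seeds N. point N s \<in> B}" by auto
  finally show ?thesis unfolding seeds(3) by simp
qed

lemma approx_full:
  assumes "B \<in> sets borel" "\<And>s. s \<in> seeds N \<Longrightarrow> point N s \<in> B"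
  shows "measure (approx N) B = 1"
proof -
  have "{s \<in> seeds N. point N s \<in> B} = seeds N" using assms(2) by auto
  then show ?thesis unfolding approx_measure[OF assms(1)] seeds(3) using p_pos[of N] seeds(3)[of N] by simp
qed

lemma approx_probs_on: "approx N \<in> probs_on K"
proof -
  have "prob_space (approx N)"
    unfolding approx_def by (rule prob_space.prob_space_distr[OF prob_space_measure_pmf]) simp
  moreover have "measure (approx N) K = 1"
    using K_closed p_pos by (intro approx_full) (auto simp: K_iff point_def)
  ultimately show ?thesis unfolding probs_on_def by (simp add: approx_def)
qed

lemma T_point: "T (point N (c, j)) = point N (c, Suc j)"
  unfolding T_def point_def by (simp add: mod_Suc_eq)

lemma sum_seeds: "(\<Sum>s\<in>seeds N. h s) = (\<Sum>c\<in>coin_words (p N). \<Sum>j<p N. h (c, j))"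
  unfolding seeds_def by (simp add: sum.cartesian_product)

text \<open>The difference telescopes along each word; only the two ends remain.\<close>

lemma approx_invariance:
  assumes g: "continuous_on UNIV g" and B: "\<And>\<omega>. \<bar>g \<omega>\<bar> \<le> (B::real)"
  shows "\<bar>(\<integral>\<omega>. g (T \<omega>) \<partial>approx N) - (\<integral>\<omega>. g \<omega> \<partial>approx N)\<bar> \<le> 2 * B / p N"
proof -
  have gm: "g \<in> borel_measurable borel" using g by (rule borel_measurable_continuous_onI)
  have gT: "(\<lambda>\<omega>. g (T \<omega>)) \<in> borel_measurable borel" by (rule measurable_compose[OF T_measurable gm])
  have "(\<integral>\<omega>. g (T \<omega>) \<partial>approx N) - (\<integral>\<omega>. g \<omega> \<partial>approx N)
      = (\<Sum>c\<in>coin_words (p N). \<Sum>j<p N. g (point N (c, Suc j)) - g (point N (c, j))) / (2 ^ p N * p N)"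
    unfolding approx_integral[OF gm] approx_integral[OF gT] sum_seeds T_point
    by (simp add: diff_divide_distrib sum_subtractf)
  also have "\<dots> = (\<Sum>c\<in>coin_words (p N). g (point N (c, p N)) - g (point N (c, 0))) / (2 ^ p N * p N)"
    by (intro arg_cong2[where f = "(/)"] sum.cong refl sum_lessThan_telescope)
  finally have eq: "(\<integral>\<omega>. g (T \<omega>) \<partial>approx N) - (\<integral>\<omega>. g \<omega> \<partial>approx N)
      = (\<Sum>c\<in>coin_words (p N). g (point N (c, p N)) - g (point N (c, 0))) / (2 ^ p N * p N)" .
  have "\<bar>\<Sum>c\<in>coin_words (p N). g (point N (c, p N)) - g (point N (c, 0))\<bar>
      \<le> (\<Sum>c\<in>coin_words (p N). \<bar>g (point N (c, p N)) - g (point N (c, 0))\<bar>)" by (rule sum_abs)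
  also have "\<dots> \<le> (\<Sum>c\<in>coin_words (p N). 2 * B)"
  proof (rule sum_mono)
    fix c
    show "\<bar>g (point N (c, p N)) - g (point N (c, 0))\<bar> \<le> 2 * B"
      using B[of "point N (c, p N)"] B[of "point N (c, 0)"] by linarith
  qed
  also have "\<dots> = 2 ^ p N * (2 * B)" by simp
  finally have "\<bar>\<Sum>c\<in>coin_words (p N). g (point N (c, p N)) - g (point N (c, 0))\<bar> / (2 ^ p N * p N)
      \<le> 2 ^ p N * (2 * B) / (2 ^ p N * p N)"
    by (rule divide_right_mono) simp
  then have "\<bar>(\<integral>\<omega>. g (T \<omega>) \<partial>approx N) - (\<integral>\<omega>. g \<omega> \<partial>approx N)\<bar> \<le> 2 ^ p N * (2 * B) / (2 ^ p N * p N)"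
    by (simp only: eq abs_divide abs_of_nat)
  then show ?thesis by simp
qed

text \<open>The law is exact as long as the inspected bits lie inside the word; at most
  \<open>M\<close> of the \<open>p N\<close> times are too close to its end.\<close>

lemma approx_law:
  fixes M :: nat
  assumes I: "\<And>i. i \<in> I \<Longrightarrow> i < M" and j: "l < p m" and mN: "m \<le> N"
  shows "\<bar>measure (approx N) (cyl m l I a) - (1/2) ^ card I / p m\<bar> \<le> M / p N"
proof -
  have fI: "finite I" using I by (auto intro: finite_subset[of _ "{..<M}"])
  define b :: real where "b = (1/2) ^ card I"
  have b01: "0 \<le> b" "b \<le> 1" unfolding b_def by (auto simp: power_le_one)
  define J where "J = {j. j < p N \<and> j mod p m = l}"
  have JN: "J \<subseteq> {..<p N}" "finite J" unfolding J_def by auto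
  define h where "h j = real (card {c \<in> coin_words (p N). \<forall>i\<in>I. c (i + j) = a i}) / 2 ^ p N" for j
  have h01: "0 \<le> h j" "h j \<le> 1" for j
  proof -
    have "card {c \<in> coin_words (p N). \<forall>i\<in>I. c (i + j) = a i} \<le> card (coin_words (p N))" by (intro card_mono) auto
    then have "real (card {c \<in> coin_words (p N). \<forall>i\<in>I. c (i + j) = a i}) \<le> 2 ^ p N"
      using of_nat_mono[of _ "2 ^ p N :: nat", where 'a = real] by simp
    then show "h j \<le> 1" unfolding h_def by simp
  qed (simp add: h_def)
  have hb: "h j = b" if "j + M \<le> p N" for j
  proof -
    have "{c \<in> coin_words (p N). \<forall>i\<in>I. c (i + j) = a i} = {c \<in> coin_words (p N). \<forall>i\<in>(\<lambda>i. i + j) ` I. c i = a (i - j)}" by auto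
    moreover have "(\<lambda>i. i + j) ` I \<subseteq> {..<p N}" using I that by fastforce
    moreover have "card ((\<lambda>i. i + j) ` I) = card I" by (rule card_image) (auto simp: inj_on_def)
    ultimately show ?thesis unfolding h_def b_def using card_coin_cylinder[of "(\<lambda>i. i + j) ` I" "p N" "\<lambda>i. a (i - j)"] by simp
  qed
  obtain e where e: "p N = e * p m" using p_dvd[OF mN] by (metis dvdE mult.commute)
  have cJ: "card J = e"
  proof -
    have "{r. r < p m \<and> r = l} = {l}" using j by auto
    then show ?thesis unfolding J_def e using card_mod_filter[OF p_pos[of m], of e "\<lambda>r. r = l"] by simp
  qed
  have cb: "cyl m l I a \<in> sets borel" using cyl_clopen(1)[OF fI] by simp
  have "card {s \<in> seeds N. point N s \<in> cyl m l I a} = (\<Sum>j\<in>J. card {c \<in> coin_words (p N). \<forall>i\<in>I. c (i + j) = a i})"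
  proof -
    have "{s \<in> seeds N. point N s \<in> cyl m l I a} = (\<lambda>(j, c). (c, j)) ` (SIGMA j:J. {c \<in> coin_words (p N). \<forall>i\<in>I. c (i + j) = a i})"
      (is "?L = ?R")
    proof (intro set_eqI iffI)
      fix s assume s: "s \<in> ?L"
      obtain c j where cj: "s = (c, j)" by (cases s)
      have "(j, c) \<in> (SIGMA j:J. {c \<in> coin_words (p N). \<forall>i\<in>I. c (i + j) = a i})"
        using s unfolding cj seeds_def cyl_def point_def J_def by simp
      from imageI[OF this, of "\<lambda>(j, c). (c, j)"] show "s \<in> ?R" unfolding cj by simp
    next
      fix s assume "s \<in> ?R"
      then obtain c j where cj: "s = (c, j)" "j \<in> J" "c \<in> coin_words (p N)" "\<forall>i\<in>I. c (i + j) = a i" by auto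
      then show "s \<in> ?L" unfolding seeds_def cyl_def point_def J_def by simp
    qed
    also have "card \<dots> = card (SIGMA j:J. {c \<in> coin_words (p N). \<forall>i\<in>I. c (i + j) = a i})"
      by (rule card_image) (auto simp: inj_on_def)
    also have "\<dots> = (\<Sum>j\<in>J. card {c \<in> coin_words (p N). \<forall>i\<in>I. c (i + j) = a i})"
      using JN by (intro card_SigmaI) auto
    finally show ?thesis .
  qed
  then have m1: "measure (approx N) (cyl m l I a) = (\<Sum>j\<in>J. h j) / p N"
    unfolding approx_measure[OF cb] h_def by (simp add: sum_divide_distrib[symmetric])
  have m2: "(1/2) ^ card I / p m = (\<Sum>j\<in>J. b) / p N"
    unfolding b_def using cJ e p_pos[of N] by simp
  have "\<bar>(\<Sum>j\<in>J. h j) - (\<Sum>j\<in>J. b)\<bar> \<le> (\<Sum>j\<in>J. \<bar>h j - b\<bar>)"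
    unfolding sum_subtractf[symmetric] by (rule sum_abs)
  also have "\<dots> \<le> (\<Sum>j\<in>J. if p N < j + M then 1 else 0)"
  proof (rule sum_mono)
    fix j assume "j \<in> J"
    show "\<bar>h j - b\<bar> \<le> (if p N < j + M then 1 else 0)"
      using hb[of j] h01[of j] b01 by (auto simp: not_less abs_le_iff)
  qed
  also have "\<dots> = card {j \<in> J. p N < j + M}" using JN(2) by (simp add: sum.If_cases Int_def)
  also have "\<dots> \<le> real M"
  proof -
    have "{j \<in> J. p N < j + M} \<subseteq> {p N - M..<p N}" using JN(1) by auto
    then have "card {j \<in> J. p N < j + M} \<le> card {p N - M..<p N}" by (intro card_mono) auto
    then show ?thesis by simp
  qed
  finally have "\<bar>(\<Sum>j\<in>J. h j) - (\<Sum>j\<in>J. b)\<bar> / p N \<le> M / p N" by (intro divide_right_mono) auto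
  then show ?thesis unfolding m1 m2 diff_divide_distrib[symmetric] by (simp add: abs_divide)
qed

lemma approx_consistent: "measure (approx N) (consistent m) = 1"
proof (rule approx_full)
  show "consistent m \<in> sets borel" using consistent_clopen(1) by simp
  show "point N s \<in> consistent m" for s
    unfolding consistent_def point_def using mod_mod_cancel[OF p_dvd_Suc[of m]] by simp
qed

text \<open>For \<open>m < N\<close> the value is exactly \<open>fill m\<close>, as
  \<open>p (Suc m)\<close> divides \<open>p N\<close>. For \<open>m \<ge> N\<close> the whole word
  is no longer than the part of a level-\<open>Suc m\<close> word made of copies, so no time is
  bad.\<close>

lemma approx_bad: "measure (approx N) (bad m) \<le> fill m"
proof (cases "Suc m \<le> N")
  case True
  obtain e where e: "p N = e * p (Suc m)" using p_dvd[OF True] by (metis dvdE mult.commute)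
  have ep: "e > 0" using p_pos[of N] e by (cases e) auto
  let ?Q = "\<lambda>r. q m * p m \<le> r"
  have "{s \<in> seeds N. point N s \<in> bad m} = coin_words (p N) \<times> {j. j < e * p (Suc m) \<and> ?Q (j mod p (Suc m))}"
    unfolding seeds_def bad_def point_def e by auto
  then have "card {s \<in> seeds N. point N s \<in> bad m} = 2 ^ p N * (e * card {r. r < p (Suc m) \<and> ?Q r})"
    by (simp only: card_cartesian_product card_coin_words card_mod_filter[OF p_pos])
  also have "{r. r < p (Suc m) \<and> ?Q r} = {q m * p m..<p (Suc m)}" by auto
  finally have c: "card {s \<in> seeds N. point N s \<in> bad m} = 2 ^ p N * (e * (p (Suc m) - q m * p m))" by simp
  have bb: "bad m \<in> sets borel" using bad_clopen(1) by simp
  have "measure (approx N) (bad m) = fill m"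
    unfolding approx_measure[OF bb] c fill_def e using ep p_pos[of "Suc m"] q_le[of m]
    by (simp add: of_nat_diff field_simps)
  then show ?thesis by simp
next
  case False
  then have Nm: "N \<le> m" by simp
  have "point N s \<notin> bad m" if "s \<in> seeds N" for s
  proof -
    have s: "snd s < p N" using that unfolding seeds_def by auto
    have "p N \<le> p m" by (rule p_mono[OF Nm])
    moreover have "p m \<le> q m * p m" using q_pos[of m] by (cases "q m") auto
    moreover have "snd s mod p (Suc m) \<le> snd s" by simp
    ultimately have "snd s mod p (Suc m) < q m * p m" using s by linarith
    then show ?thesis unfolding bad_def point_def by simp
  qed
  then have e: "{s \<in> seeds N. point N s \<in> bad m} = {}" by blast
  have bb: "bad m \<in> sets borel" using bad_clopen(1) by simp
  show ?thesis unfolding approx_measure[OF bb] e using fill_nonneg by simp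
qed

text \<open>\<open>j - j mod p n\<close> is the start of the level-\<open>n\<close> interval
  containing time \<open>j\<close>. Descending from level \<open>N\<close>, the third hypothesis
  keeps \<open>j\<close> inside the copies at each level, where \<open>W_sub\<close>
  applies.\<close>

lemma subblock:
  assumes "n \<le> N" "j < p N" "\<And>i. n \<le> i \<Longrightarrow> i < N \<Longrightarrow> j mod p (Suc i) < q i * p i" "x \<in> W N c"
  shows "(f ^^ (j - j mod p n)) x \<in> W n (\<lambda>l. c (l + (j - j mod p n)))"
  using assms(1,3)
proof (induction n rule: inc_induct)
  case base
  then show ?case using assms(2,4) by simp
next
  case (step n)
  define r where "r = j mod p (Suc n)"
  define i where "i = r div p n"
  have "r < q n * p n" unfolding r_def using step.prems step.hyps by auto
  then have i: "i < q n" unfolding i_def by (simp add: less_mult_imp_div_less)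
  have "(f ^^ (j - r)) x \<in> W (Suc n) (\<lambda>l. c (l + (j - r)))"
    unfolding r_def using step by auto
  from W_sub[OF this i] have sub: "(f ^^ (i * p n + (j - r))) x \<in> W n (\<lambda>l. c (l + (i * p n + (j - r))))"
    by (simp add: funpow_add add.assoc)
  have "r mod p n = j mod p n" unfolding r_def by (rule mod_mod_cancel[OF p_dvd_Suc])
  then have "i * p n + j mod p n = r" unfolding i_def by (metis div_mult_mod_eq)
  moreover have "r \<le> j" unfolding r_def by simp
  ultimately have "i * p n + (j - r) = j - j mod p n" by linarith
  then show ?case using sub by simp
qed

lemma approx_blocks:
  assumes "m \<le> N"
  shows "measure (approx N) ({\<omega>. phase \<omega> \<in> good m} \<inter> outside m) = 0"
proof -
  have "point N (c, j) \<notin> {\<omega>. phase \<omega> \<in> good m} \<inter> outside m" if "j < p N" for c j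
  proof
    assume as: "point N (c, j) \<in> {\<omega>. phase \<omega> \<in> good m} \<inter> outside m"
    then have "j mod p m = 0" "\<And>i. m \<le> i \<Longrightarrow> j mod p (Suc i) < q i * p i"
      unfolding good_def point_def by auto
    then have "(f ^^ j) (near_max N c) \<in> W m (\<lambda>l. c (l + j))"
      using subblock[OF assms that _ near_max(1), of c] by simp
    then have "(f ^^ j) (near_max N c) \<in> closure (W m (\<lambda>l. c (l + j)))" using closure_subset by blast
    then show False using as unfolding outside_def point_def by simp
  qed
  then have "{s \<in> seeds N. point N s \<in> {\<omega>. phase \<omega> \<in> good m} \<inter> outside m} = {}"
    unfolding seeds_def by auto
  moreover have "{\<omega>::'a state. phase \<omega> \<in> good m} \<inter> outside m \<in> sets borel"
    using good_borel[of m] borel_open[OF outside_open[of m]] by auto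
  ultimately show ?thesis by (simp only: approx_measure card.empty)
qed

lemma approx_mean: "(\<integral>\<omega>. \<phi> (fst \<omega>) \<partial>approx N) \<ge> (coin_avg (p N) (u N) - 1) / p N"
proof -
  have m: "(\<lambda>\<omega>::'a state. \<phi> (fst \<omega>)) \<in> borel_measurable borel"
    by (rule borel_measurable_continuous_onI[OF \<phi>_fst(1)])
  have "coin_avg (p N) (u N) - 1 = coin_avg (p N) (\<lambda>c. u N c - 1)"
    unfolding coin_avg_def by (simp add: sum_subtractf diff_divide_distrib)
  also have "\<dots> \<le> coin_avg (p N) (\<lambda>c. S (p N) (near_max N c))"
    by (rule coin_avg_mono) (rule near_max(2))
  also have "\<dots> / p N = (\<integral>\<omega>. \<phi> (fst \<omega>) \<partial>approx N)"
    unfolding approx_integral[OF m] sum_seeds coin_avg_def birkhoff_sum_def point_def by simp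
  finally show ?thesis using p_pos[of N] by (simp add: divide_right_mono)
qed

text \<open>A weak limit of the measures \<open>approx (Suc n)\<close> has integral at least 0 by
  \<open>W_avg_ge\<close>, which speaks of successor levels, and at most 0 by
  \<open>mean_nonpos\<close>.\<close>

lemma exists_coded_mean_zero: "\<exists>P\<in>coded. (\<integral>\<omega>. \<phi> (fst \<omega>) \<partial>P) = 0"
proof -
  have "\<And>n. approx (Suc n) \<in> probs_on K" by (rule approx_probs_on)
  then obtain k Q where k: "strict_mono k" "Q \<in> probs_on K" "weak_lim ((\<lambda>n. approx (Suc n)) \<circ> k) Q"
    by (rule weak_seq_compact[OF K_compact])
  define P where "P n = approx (Suc (k n))" for n
  have lim: "weak_lim P Q" using k(3) unfolding P_def[abs_def] o_def .
  have kn: "n \<le> k n" for n by (rule seq_suble[OF k(1)])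
  have pl: "(\<lambda>n. B / p (Suc (k n))) \<longlonglongrightarrow> 0" for B :: real
  proof (rule Lim_null_comparison)
    show "\<forall>\<^sub>F n in sequentially. norm (B / p (Suc (k n))) \<le> \<bar>B\<bar> * inverse (real (Suc n))"
    proof (intro always_eventually allI)
      fix n
      have "real (Suc n) \<le> p (Suc (k n))" using p_ge[of "Suc (k n)"] kn[of n] by linarith
      then have "\<bar>B\<bar> / p (Suc (k n)) \<le> \<bar>B\<bar> / real (Suc n)" by (intro divide_left_mono) auto
      then show "norm (B / p (Suc (k n))) \<le> \<bar>B\<bar> * inverse (real (Suc n))" by (simp add: divide_inverse abs_mult)
    qed
    show "(\<lambda>n. \<bar>B\<bar> * inverse (real (Suc n))) \<longlonglongrightarrow> 0"
      using tendsto_mult[OF tendsto_const LIMSEQ_inverse_real_of_nat, of "\<bar>B\<bar>"] by simp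
  qed
  have "Q \<in> coded"
  proof (rule weak_lim_coded[OF lim _ k(2)])
    show "P n \<in> probs_on K" for n unfolding P_def by (rule approx_probs_on)
    fix g :: "'a state \<Rightarrow> real" assume g: "continuous_on UNIV g" "bounded (range g)"
    then obtain B where B: "\<And>\<omega>. \<bar>g \<omega>\<bar> \<le> B" by (auto simp: bounded_iff)
    show "(\<lambda>n. (\<integral>x. g (T x) \<partial>P n) - (\<integral>x. g x \<partial>P n)) \<longlonglongrightarrow> 0"
      unfolding P_def
      by (rule Lim_null_comparison[OF _ pl[of "2 * B"]])
         (use approx_invariance[OF g(1) B] in \<open>simp add: always_eventually\<close>)
  next
    fix m j I a assume I: "finite (I :: nat set)" "j < p m"
    obtain M where M: "\<And>i. i \<in> I \<Longrightarrow> i < M" using I finite_nat_set_iff_bounded by auto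
    have "(\<lambda>n. measure (P n) (cyl m j I a) - (1/2) ^ card I / p m) \<longlonglongrightarrow> 0"
    proof (rule Lim_null_comparison[OF _ pl[of M]])
      show "\<forall>\<^sub>F n in sequentially. norm (measure (P n) (cyl m j I a) - (1/2) ^ card I / p m) \<le> M / p (Suc (k n))"
        unfolding eventually_sequentially
      proof (intro exI[of _ m] allI impI)
        fix n assume "m \<le> n"
        then have "m \<le> Suc (k n)" using kn[of n] by linarith
        then show "norm (measure (P n) (cyl m j I a) - (1/2) ^ card I / p m) \<le> M / p (Suc (k n))"
          unfolding P_def real_norm_def by (intro approx_law M I(2))
      qed
    qed
    then show "(\<lambda>n. measure (P n) (cyl m j I a)) \<longlonglongrightarrow> (1/2) ^ card I / p m" by (rule LIM_zero_cancel)
  next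
    show "measure (P n) (consistent m) = 1" for n m unfolding P_def by (rule approx_consistent)
    show "measure (P n) (bad m) \<le> fill m" for n m unfolding P_def by (rule approx_bad)
    show "\<forall>\<^sub>F n in sequentially. measure (P n) ({\<omega>. phase \<omega> \<in> good m} \<inter> outside m) = 0" for m
      unfolding eventually_sequentially
    proof (intro exI[of _ m] allI impI)
      fix n assume "m \<le> n"
      then show "measure (P n) ({\<omega>. phase \<omega> \<in> good m} \<inter> outside m) = 0"
        unfolding P_def using kn[of n] by (intro approx_blocks) linarith
    qed
  qed
  moreover have "0 \<le> (\<integral>\<omega>. \<phi> (fst \<omega>) \<partial>Q)"
  proof -
    have l1: "(\<lambda>n. \<integral>\<omega>. \<phi> (fst \<omega>) \<partial>P n) \<longlonglongrightarrow> (\<integral>\<omega>. \<phi> (fst \<omega>) \<partial>Q)"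
      using lim[unfolded weak_lim_def, rule_format, OF conjI[OF \<phi>_fst]] .
    have l2: "(\<lambda>n. - ((1/2) ^ k n) - 1 / p (Suc (k n))) \<longlonglongrightarrow> - 0 - (0::real)"
      by (intro tendsto_diff tendsto_minus pl) (use LIMSEQ_subseq_LIMSEQ[OF LIMSEQ_power_zero[of "1/2::real"] k(1)] in \<open>simp add: o_def\<close>)
    have "- ((1/2) ^ k n) - 1 / p (Suc (k n)) \<le> (\<integral>\<omega>. \<phi> (fst \<omega>) \<partial>P n)" for n
    proof -
      let ?N = "Suc (k n)"
      have "- ((1/2) ^ k n) - 1 / p ?N = (- ((1/2) ^ k n * p ?N) - 1) / p ?N"
        using p_pos[of ?N] by (simp add: field_simps)
      also have "\<dots> \<le> (coin_avg (p ?N) (u ?N) - 1) / p ?N"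
        using W_avg_ge[of "k n"] by (intro divide_right_mono) auto
      also have "\<dots> \<le> (\<integral>\<omega>. \<phi> (fst \<omega>) \<partial>P n)" unfolding P_def by (rule approx_mean)
      finally show ?thesis .
    qed
    then show ?thesis using LIMSEQ_le[OF l2 l1] by simp
  qed
  ultimately show ?thesis using mean_nonpos[of Q] by (intro bexI[of _ Q] antisym) auto
qed

text \<open>As 0 is the largest possible integral on \<open>coded\<close>, the measures attaining it
  again form a closed face: if a combination with positive weights of two integrals that are at most
  0 vanishes, both of them vanish.\<close>

lemma exists_ergodic_coded:
  obtains P where "P \<in> coded" "(\<integral>\<omega>. \<phi> (fst \<omega>) \<partial>P) = 0"
    "\<And>A. A \<in> sets borel \<Longrightarrow> T -` A = A \<Longrightarrow> measure P A = 0 \<or> measure P A = 1"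
proof -
  define M where "M = {P \<in> coded. (\<integral>\<omega>. \<phi> (fst \<omega>) \<partial>P) = 0}"
  have sub: "M \<subseteq> probs_on K" unfolding M_def using codedD(1) by auto
  have ne: "M \<noteq> {}" using exists_coded_mean_zero unfolding M_def by auto
  have closed: "\<And>P Q. (\<And>n::nat. P n \<in> M) \<Longrightarrow> Q \<in> probs_on K \<Longrightarrow> weak_lim P Q \<Longrightarrow> Q \<in> M"
  proof -
    fix P :: "nat \<Rightarrow> 'a state measure" and Q
    assume P: "\<And>n. P n \<in> M" and Q: "Q \<in> probs_on K" and lim: "weak_lim P Q"
    have PC: "P n \<in> coded" for n using P[of n] unfolding M_def by simp
    note PD = codedD[OF PC]
    have "Q \<in> coded"
    proof (rule weak_lim_coded[OF lim PD(1) Q])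
      show "(\<lambda>n. (\<integral>x. g (T x) \<partial>P n) - (\<integral>x. g x \<partial>P n)) \<longlonglongrightarrow> 0"
        if "continuous_on UNIV g" for g :: "'a state \<Rightarrow> real"
        using T_pow_invariant(2)[OF PD(1,2) borel_measurable_continuous_onI[OF that], of _ 1] by simp
      show "(\<lambda>n. measure (P n) (cyl m j I a)) \<longlonglongrightarrow> (1/2) ^ card I / p m" if "finite I" "j < p m" for m j I a
        unfolding PD(3)[OF that] by (rule tendsto_const)
      show "measure (P n) (bad m) \<le> fill m" for n m
        by (rule eq_refl, rule finite_coordinates_measurable_bad[OF PD(1), where a = "\<lambda>_. False"])
           (simp add: PD(3))
    qed (use PD(4,5) in auto)
    moreover have "(\<integral>\<omega>. \<phi> (fst \<omega>) \<partial>Q) = 0"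
    proof -
      have "(\<lambda>n. \<integral>\<omega>. \<phi> (fst \<omega>) \<partial>P n) \<longlonglongrightarrow> (\<integral>\<omega>. \<phi> (fst \<omega>) \<partial>Q)"
        using lim[unfolded weak_lim_def, rule_format, OF conjI[OF \<phi>_fst]] .
      moreover have "(\<integral>\<omega>. \<phi> (fst \<omega>) \<partial>P n) = 0" for n using P[of n] unfolding M_def by simp
      ultimately show ?thesis using LIMSEQ_unique[OF _ tendsto_const] by fastforce
    qed
    ultimately show "Q \<in> M" unfolding M_def by simp
  qed
  have face: "\<And>P A. P \<in> M \<Longrightarrow> A \<in> sets borel \<Longrightarrow> T -` A = A \<Longrightarrow> 0 < measure P A \<Longrightarrow> uniform_measure P A \<in> M"
  proof -
    fix P A assume P: "P \<in> M" and A: "A \<in> sets borel" "T -` A = A" "0 < measure P A"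
    have PC: "P \<in> coded" and m0: "(\<integral>\<omega>. \<phi> (fst \<omega>) \<partial>P) = 0" using P unfolding M_def by auto
    note PD = codedD[OF PC]
    interpret prob_space P using probs_onD[OF PD(1)] by auto
    obtain C where "\<And>x. \<bar>\<phi> x\<bar> \<le> C" using \<phi>_bounded by metis
    then have i: "integrable P (\<lambda>\<omega>. \<phi> (fst \<omega>))"
      by (intro integrable_bounded_borel[OF prob_space_axioms probs_onD(2)[OF PD(1)] borel_measurable_continuous_onI[OF \<phi>_fst(1)]])
    have UA: "uniform_measure P A \<in> coded" by (rule coded_face[OF PC A])
    have As: "A \<in> sets P" using A probs_onD[OF PD(1)] by simp
    have "(\<integral>\<omega>. \<phi> (fst \<omega>) \<partial>uniform_measure P A) = 0"
    proof (cases "prob A < 1")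
      case True
      have c: "space P - A = - A" using probs_onD[OF PD(1)] by auto
      have "measure P (- A) = 1 - prob A" by (rule probs_on_compl[OF PD(1) A(1)])
      moreover have "T -` (- A) = - A" using A(2) by (simp add: vimage_Compl)
      ultimately have UB: "uniform_measure P (- A) \<in> coded" using A(1) True by (intro coded_face[OF PC]) auto
      have "0 = prob A * (\<integral>\<omega>. \<phi> (fst \<omega>) \<partial>uniform_measure P A) + (1 - prob A) * (\<integral>\<omega>. \<phi> (fst \<omega>) \<partial>uniform_measure P (- A))"
        using integral_split_uniform_measure[OF As A(3) True i] m0 unfolding c by simp
      moreover have "(1 - prob A) * (\<integral>\<omega>. \<phi> (fst \<omega>) \<partial>uniform_measure P (- A)) \<le> 0"
        using True mean_nonpos[OF UB] by (intro mult_nonneg_nonpos) auto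
      ultimately have "0 \<le> prob A * (\<integral>\<omega>. \<phi> (fst \<omega>) \<partial>uniform_measure P A)" by linarith
      then have "0 \<le> (\<integral>\<omega>. \<phi> (fst \<omega>) \<partial>uniform_measure P A)" using A(3) by (simp add: zero_le_mult_iff)
      then show ?thesis using mean_nonpos[OF UA] by linarith
    next
      case False
      then have "prob A = 1" using prob_le_1[of A] by linarith
      then have "AE \<omega> in P. \<omega> \<in> A" using AE_in_set_eq_1[OF As] by simp
      then have "(\<integral>\<omega>. indicator A \<omega> * \<phi> (fst \<omega>) \<partial>P) = (\<integral>\<omega>. \<phi> (fst \<omega>) \<partial>P)"
        using As i by (intro integral_cong_AE) (auto elim: eventually_mono)
      then show ?thesis using integral_uniform_measure[OF As A(3), of "\<lambda>\<omega>. \<phi> (fst \<omega>)"] i m0 by simp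
    qed
    then show "uniform_measure P A \<in> M" unfolding M_def using UA by simp
  qed
  show thesis
  proof (rule ergodic_of_closed_face[OF K_compact T_measurable sub ne])
    show "\<And>P Q. (\<And>n::nat. P n \<in> M) \<Longrightarrow> Q \<in> probs_on K \<Longrightarrow> weak_lim P Q \<Longrightarrow> Q \<in> M"
      by (rule closed)
    show "\<And>P A. P \<in> M \<Longrightarrow> A \<in> sets borel \<Longrightarrow> T -` A = A \<Longrightarrow> 0 < measure P A \<Longrightarrow> uniform_measure P A \<in> M"
      by (rule face)
    fix P assume "P \<in> M" "\<And>A. A \<in> sets borel \<Longrightarrow> T -` A = A \<Longrightarrow> measure P A = 0 \<or> measure P A = 1"
    then show thesis using that[of P] unfolding M_def by simp
  qed
qed

end

section \<open>Support and entropy\<close>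

lemma half_power_exp: "(1/2::real) ^ m = exp (- (real m * ln 2))"
proof -
  have e: "exp (- ln (2::real)) = 1/2" by (simp add: exp_minus)
  have "exp (- (real m * ln 2)) = exp (- ln (2::real)) ^ m" using exp_of_nat_mult[of m "- ln (2::real)"] by simp
  then show ?thesis unfolding e by simp
qed

context block_system
begin

lemma fst_measurable: "(fst :: 'a state \<Rightarrow> 'a) \<in> borel_measurable borel"
  by (rule borel_measurable_continuous_onI[OF continuous_on_fst[OF continuous_on_id]])

section \<open>Times at which bits can be read from the orbit\<close>

definition rot :: "nat \<Rightarrow> (nat \<Rightarrow> nat) \<Rightarrow> nat \<Rightarrow> nat" where
  "rot i \<theta> = (\<lambda>m. (\<theta> m + i) mod p m)"

text \<open>At these times a level-0 word starts that constrains the point, so that the bit of that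
  time shows in the orbit.\<close>

definition slots :: "nat \<Rightarrow> (nat \<Rightarrow> nat) \<Rightarrow> nat set" where
  "slots M \<theta> = {i \<in> {..<M}. rot i \<theta> \<in> good 0}"

definition slots_upto :: "nat \<Rightarrow> nat \<Rightarrow> (nat \<Rightarrow> nat) \<Rightarrow> nat set" where
  "slots_upto m M \<theta> = {i \<in> {..<M}. rot i \<theta> \<in> good_upto 0 m}"

lemma rot_good_upto_dep:
  "\<forall>\<theta> \<theta>'. (\<forall>j\<le>0 + m. \<theta> j = \<theta>' j) \<longrightarrow> \<theta> \<in> {\<theta>. rot i \<theta> \<in> good_upto 0 m} \<longrightarrow> \<theta>' \<in> {\<theta>. rot i \<theta> \<in> good_upto 0 m}"
proof (intro allI impI)
  fix \<theta> \<theta>' :: "nat \<Rightarrow> nat"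
  assume eq: "\<forall>j\<le>0 + m. \<theta> j = \<theta>' j" and mem: "\<theta> \<in> {\<theta>. rot i \<theta> \<in> good_upto 0 m}"
  have "\<forall>j\<le>0 + m. rot i \<theta> j = rot i \<theta>' j" using eq unfolding rot_def by auto
  then show "\<theta>' \<in> {\<theta>. rot i \<theta> \<in> good_upto 0 m}" using good_upto_dep[of 0 m] mem by blast
qed

lemma rot_good_borel: "{\<omega>::'a state. rot i (phase \<omega>) \<in> good 0} \<in> sets borel"
proof -
  have eq: "{\<omega>::'a state. rot i (phase \<omega>) \<in> good 0} = (\<Inter>m. {\<omega>. phase \<omega> \<in> {\<theta>. rot i \<theta> \<in> good_upto 0 m}})"
    unfolding good_Inter by blast
  show ?thesis
    unfolding eq by (intro borel_closed closed_INT ballI phase_set_clopen(2)[OF rot_good_upto_dep])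
qed

lemma slots_borel:
  assumes "I \<subseteq> {..<M}"
  shows "{\<omega>::'a state. phase \<omega> \<in> {\<theta>. slots M \<theta> = I}} \<in> sets borel"
proof -
  let ?E = "\<lambda>i. {\<omega>::'a state. rot i (phase \<omega>) \<in> good 0}"
  have eq: "{\<omega>::'a state. phase \<omega> \<in> {\<theta>. slots M \<theta> = I}}
      = (\<Inter>i\<in>{..<M}. if i \<in> I then ?E i else - ?E i) \<inter> UNIV"
    using assms unfolding slots_def by (auto split: if_splits)
  define F where "F i = (if i \<in> I then ?E i else - ?E i)" for i
  have F: "F i \<in> sets borel" for i
    unfolding F_def using rot_good_borel[of i] by auto
  have "(\<Inter>i\<in>{..<M}. F i) \<in> sets borel"
  proof (cases "M = 0")
    case False
    then show ?thesis by (intro sets.finite_INT F) auto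
  qed simp
  then show ?thesis unfolding eq F_def by simp
qed

text \<open>The set of slots is a function of the phases alone, so knowing it leaves the bits on it
  fair and independent. It depends on infinitely many phases and is therefore approximated by
  \<open>slots_upto\<close>.\<close>

lemma slots_coins:
  assumes P: "P \<in> coded" and I: "I \<subseteq> {..<M}"
  shows "measure P ({\<omega>. phase \<omega> \<in> {\<theta>. slots M \<theta> = I}} \<inter> {\<omega>. \<forall>i\<in>I. coin \<omega> i = a i})
      = (1/2) ^ card I * measure P {\<omega>. phase \<omega> \<in> {\<theta>. slots M \<theta> = I}}"
proof (rule coins_independent[OF P, where B = "\<lambda>m. {\<theta>. slots_upto m M \<theta> = I}"])
  show "finite I" using I finite_subset by blast
  show "{\<omega>::'a state. phase \<omega> \<in> {\<theta>. slots M \<theta> = I}} \<in> sets borel" by (rule slots_borel[OF I])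
  show "\<exists>d. \<forall>\<theta> \<theta>'. (\<forall>i\<le>d. \<theta> i = \<theta>' i) \<longrightarrow> \<theta> \<in> {\<theta>. slots_upto m M \<theta> = I} \<longrightarrow> \<theta>' \<in> {\<theta>. slots_upto m M \<theta> = I}" for m
  proof (intro exI[of _ m] allI impI)
    fix \<theta> \<theta>' :: "nat \<Rightarrow> nat"
    assume eq: "\<forall>i\<le>m. \<theta> i = \<theta>' i" and mem: "\<theta> \<in> {\<theta>. slots_upto m M \<theta> = I}"
    have eq': "\<forall>j\<le>0 + m. \<theta> j = \<theta>' j" "\<forall>j\<le>0 + m. \<theta>' j = \<theta> j" using eq by auto
    have "rot i \<theta> \<in> good_upto 0 m \<longleftrightarrow> rot i \<theta>' \<in> good_upto 0 m" for i
      using rot_good_upto_dep[of m i] eq' by blast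
    then have "slots_upto m M \<theta> = slots_upto m M \<theta>'" unfolding slots_upto_def by simp
    then show "\<theta>' \<in> {\<theta>. slots_upto m M \<theta> = I}" using mem by simp
  qed
  show "\<forall>\<^sub>F m in sequentially. (\<theta> \<in> {\<theta>. slots_upto m M \<theta> = I}) = (\<theta> \<in> {\<theta>. slots M \<theta> = I})" for \<theta>
  proof -
    have "\<forall>\<^sub>F m in sequentially. \<forall>i\<in>{..<M}. rot i \<theta> \<in> good_upto 0 m \<longleftrightarrow> rot i \<theta> \<in> good 0"
      by (intro eventually_ball_finite ballI good_upto_eventually) simp
    then show ?thesis
    proof eventually_elim
      case (elim m)
      then have "slots_upto m M \<theta> = slots M \<theta>" unfolding slots_upto_def slots_def by blast
      then show ?case by simp
    qed
  qed
qed

text \<open>A good start at a high level is almost surely also one at level 0: phase 0 at level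
  \<open>n\<close> forces all lower phases to be 0, and phase 0 lies in the copies because
  \<open>q j * p j > 0\<close>.\<close>

lemma slot_density_pos:
  assumes P: "P \<in> coded"
  shows "measure P {\<omega>. phase \<omega> \<in> good 0} > 0"
proof -
  note PD = codedD[OF P]
  interpret prob_space P using probs_onD[OF PD(1)] by auto
  obtain n where n: "measure P {\<omega>. phase \<omega> \<in> good n} > 0" using good_pos[OF P] by blast
  have "measure P {\<omega>. phase \<omega> \<in> good n} \<le> measure P {\<omega>. phase \<omega> \<in> good 0}"
  proof (rule finite_measure_mono_AE)
    show "AE \<omega> in P. \<omega> \<in> {\<omega>. phase \<omega> \<in> good n} \<longrightarrow> \<omega> \<in> {\<omega>. phase \<omega> \<in> good 0}"
      using coded_AE[OF P]
    proof eventually_elim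
      case (elim \<omega>)
      show ?case
      proof (intro impI)
        assume "\<omega> \<in> {\<omega>. phase \<omega> \<in> good n}"
        then have g: "phase \<omega> n = 0" "\<And>j. j \<ge> n \<Longrightarrow> phase \<omega> (Suc j) < q j * p j" unfolding good_def by auto
        have z: "phase \<omega> i = 0" if "i \<le> n" for i
        proof -
          have "phase \<omega> i = phase \<omega> n mod p i" using elim that by blast
          then show ?thesis using g(1) by simp
        qed
        have "phase \<omega> (Suc j) < q j * p j" for j
        proof (cases "j \<ge> n")
          case False
          then have "phase \<omega> (Suc j) = 0" by (intro z) simp
          then show ?thesis using q_pos[of j] p_pos[of j] by simp
        qed (rule g(2))
        then show "\<omega> \<in> {\<omega>. phase \<omega> \<in> good 0}" using z[of 0] unfolding good_def by simp
      qed
    qed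
    show "{\<omega>. phase \<omega> \<in> good 0} \<in> events" using good_borel probs_onD(2)[OF PD(1)] by simp
  qed
  then show ?thesis using n by linarith
qed

text \<open>The number of slots has mean \<open>d * M\<close> by invariance and never exceeds
  \<open>M\<close>, so it cannot stay below half its mean too often.\<close>

lemma many_slots:
  assumes P: "P \<in> coded" and M: "M > 0" and d: "d = measure P {\<omega>. phase \<omega> \<in> good 0}"
  shows "{\<omega>::'a state. d * M / 2 \<le> card (slots M (phase \<omega>))} \<in> sets borel"
    "d / 2 \<le> measure P {\<omega>. d * M / 2 \<le> card (slots M (phase \<omega>))}"
proof -
  note PD = codedD[OF P]
  interpret prob_space P using probs_onD[OF PD(1)] by auto
  let ?E = "\<lambda>i. {\<omega>::'a state. rot i (phase \<omega>) \<in> good 0}"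
  let ?G = "{\<omega>::'a state. d * M / 2 \<le> card (slots M (phase \<omega>))}"
  have Es: "?E i \<in> sets P" for i using rot_good_borel probs_onD(2)[OF PD(1)] by simp
  have Z: "real (card (slots M (phase \<omega>))) = (\<Sum>i<M. indicator (?E i) \<omega>)" for \<omega> :: "'a state"
  proof -
    have "(\<Sum>i<M. indicator (?E i) \<omega> :: real) = (\<Sum>i<M. if rot i (phase \<omega>) \<in> good 0 then 1 else 0)"
      by (intro sum.cong) (auto simp: indicator_def)
    also have "\<dots> = real (card {i \<in> {..<M}. rot i (phase \<omega>) \<in> good 0})"
      by (simp add: sum.If_cases Int_def)
    finally show ?thesis unfolding slots_def by simp
  qed
  have Zm: "(\<lambda>\<omega>::'a state. real (card (slots M (phase \<omega>)))) \<in> borel_measurable borel"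
    unfolding Z using rot_good_borel by (intro borel_measurable_sum borel_measurable_indicator)
  show Gb: "?G \<in> sets borel"
    using measurable_sets[OF Zm, of "{d * M / 2..}"] by (simp add: vimage_def)
  then have Gs: "?G \<in> sets P" using probs_onD(2)[OF PD(1)] by simp
  have Ed: "measure P (?E i) = d" for i
  proof -
    have "d = measure P ((T ^^ i) -` {\<omega>. phase \<omega> \<in> good 0})"
      unfolding d by (rule T_pow_invariant(1)[OF PD(1,2) good_borel, symmetric])
    also have "\<dots> = measure P (?E i)"
    proof (rule measure_eq_AE)
      show "AE \<omega> in P. (\<omega> \<in> (T ^^ i) -` {\<omega>. phase \<omega> \<in> good 0}) = (\<omega> \<in> ?E i)"
        using probs_on_AE[OF PD(1) K_closed]
      proof eventually_elim
        case (elim \<omega>)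
        have "phase ((T ^^ i) \<omega>) = rot i (phase \<omega>)"
          unfolding rot_def by (rule ext) (rule phase_T_pow[OF elim])
        then show ?case by simp
      qed
      show "(T ^^ i) -` {\<omega>. phase \<omega> \<in> good 0} \<in> events"
        using funpow_vimage_measurable[OF T_measurable good_borel] probs_onD(2)[OF PD(1)] by simp
    qed (rule Es)
    finally show ?thesis by simp
  qed
  have iE: "integrable P (indicator (?E i) :: _ \<Rightarrow> real)" for i
    using Es by (intro integrable_real_indicator) (auto simp: emeasure_eq_measure)
  have "M * d = (\<Sum>i<M. \<integral>\<omega>. indicator (?E i) \<omega> \<partial>P)"
    using Es Ed by (simp add: sets.Int_space_eq2)
  also have "\<dots> = (\<integral>\<omega>. (\<Sum>i<M. indicator (?E i) \<omega>) \<partial>P)"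
    by (rule Bochner_Integration.integral_sum[symmetric]) (rule iE)
  also have "\<dots> \<le> (\<integral>\<omega>. real M * indicator ?G \<omega> + d * M / 2 \<partial>P)"
  proof (rule integral_mono)
    show "integrable P (\<lambda>\<omega>. \<Sum>i<M. indicator (?E i) \<omega> :: real)"
      by (intro Bochner_Integration.integrable_sum iE)
    show "integrable P (\<lambda>\<omega>. real M * indicator ?G \<omega> + d * M / 2)"
      using Gs by (intro Bochner_Integration.integrable_add integrable_mult_right integrable_real_indicator)
        (auto simp: emeasure_eq_measure)
    fix \<omega> :: "'a state"
    have "card (slots M (phase \<omega>)) \<le> card {..<M}" unfolding slots_def by (intro card_mono) auto
    then have "real (card (slots M (phase \<omega>))) \<le> M" by simp
    moreover have "0 \<le> d * M / 2" unfolding d by simp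
    ultimately show "(\<Sum>i<M. indicator (?E i) \<omega>) \<le> real M * indicator ?G \<omega> + d * M / 2"
      unfolding Z[symmetric] by (auto simp: indicator_def)
  qed
  also have "\<dots> = M * measure P ?G + d * M / 2"
    using Gs by (subst Bochner_Integration.integral_add)
      (auto simp: emeasure_eq_measure sets.Int_space_eq2 prob_space intro!: integrable_mult_right integrable_real_indicator)
  finally have "M * (d / 2) \<le> M * measure P ?G" by (simp add: field_simps)
  then show "d / 2 \<le> measure P ?G" using M by simp
qed

text \<open>At a slot the point is in the closure of a level-0 set, where the value of
  \<open>\<psi>\<close> after \<open>k\<close> iterates is at least \<open>\<alpha>\<close> or at
  most \<open>- \<alpha>\<close> according to the bit.\<close>

lemma coins_read:
  assumes P: "P \<in> coded"
  shows "AE \<omega> in P. \<omega> \<in> K \<and> (\<forall>i. rot i (phase \<omega>) \<in> good 0 \<longrightarrow> coin \<omega> i = (\<psi> ((f ^^ (i + k)) (fst \<omega>)) > 0))"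
proof -
  note PD = codedD[OF P]
  interpret prob_space P using probs_onD[OF PD(1)] by auto
  let ?N = "{\<omega>. phase \<omega> \<in> good 0} \<inter> outside 0"
  have Nb: "?N \<in> sets borel" using good_borel[of 0] borel_open[OF outside_open[of 0]] by auto
  have "AE \<omega> in P. (T ^^ i) \<omega> \<notin> ?N" for i
  proof -
    have "(T ^^ i) -` ?N \<in> sets P"
      using funpow_vimage_measurable[OF T_measurable Nb] probs_onD(2)[OF PD(1)] by simp
    then have "(T ^^ i) -` ?N \<in> null_sets P"
      using T_pow_invariant(1)[OF PD(1,2) Nb, of i] PD(5)[of 0] by (simp add: null_sets_def emeasure_eq_measure)
    from AE_not_in[OF this] show ?thesis by eventually_elim simp
  qed
  then have "AE \<omega> in P. \<forall>i. (T ^^ i) \<omega> \<notin> ?N" by (simp only: AE_all_countable) simp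
  with probs_on_AE[OF PD(1) K_closed] show ?thesis
  proof eventually_elim
    case (elim \<omega>)
    have "coin \<omega> i = (\<psi> ((f ^^ (i + k)) (fst \<omega>)) > 0)" if "rot i (phase \<omega>) \<in> good 0" for i
    proof -
      have "phase ((T ^^ i) \<omega>) = rot i (phase \<omega>)"
        unfolding rot_def by (rule ext) (rule phase_T_pow[OF elim(1)])
      then have x: "fst ((T ^^ i) \<omega>) \<in> closure (W 0 (coin ((T ^^ i) \<omega>)))"
        using elim(2) that unfolding outside_def by auto
      define c where "c = coin ((T ^^ i) \<omega>)"
      have cont: "continuous_on UNIV (\<lambda>x. \<psi> ((f ^^ k) x))"
        by (rule continuous_on_compose2[OF \<psi>_cont funpow_cont]) simp
      have "W 0 c \<subseteq> {x. if c 0 then \<psi> ((f ^^ k) x) \<ge> \<alpha> else \<psi> ((f ^^ k) x) \<le> - \<alpha>}"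
        using W_coin[of _ c] by blast
      moreover have "closed {x. if c 0 then \<psi> ((f ^^ k) x) \<ge> \<alpha> else \<psi> ((f ^^ k) x) \<le> - \<alpha>}"
        by (cases "c 0") (simp_all add: closed_Collect_le cont)
      ultimately have "closure (W 0 c) \<subseteq> {x. if c 0 then \<psi> ((f ^^ k) x) \<ge> \<alpha> else \<psi> ((f ^^ k) x) \<le> - \<alpha>}"
        by (rule closure_minimal)
      then have "if c 0 then \<psi> ((f ^^ k) (fst ((T ^^ i) \<omega>))) \<ge> \<alpha> else \<psi> ((f ^^ k) (fst ((T ^^ i) \<omega>))) \<le> - \<alpha>"
        using x unfolding c_def[symmetric] by blast
      moreover have "(f ^^ k) (fst ((T ^^ i) \<omega>)) = (f ^^ (i + k)) (fst \<omega>)"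
        unfolding fst_T_pow by (simp add: funpow_add add.commute[of i])
      moreover have "c 0 = coin \<omega> i" unfolding c_def coin_T_pow by simp
      ultimately show ?thesis using \<alpha> by (auto split: if_splits)
    qed
    then show ?case using elim(1) by blast
  qed
qed

text \<open>A name of length \<open>n\<close> fixes the bits at all slots before \<open>M\<close>,
  as these show \<open>k\<close> iterates later. Given any one set of slots with at least
  \<open>D\<close> elements, these bits have conditional probability at most \<open>1/2\<close> to
  the power \<open>D\<close>, and different sets of slots are disjoint events.\<close>

lemma name_bound:
  fixes D :: real
  assumes P: "P \<in> coded" and M: "M + k \<le> n" and D: "D \<ge> 0"
  shows "measure P ({\<omega>. itinerary (\<lambda>i. (f ^^ i) -` {x. \<psi> x > 0}) n (fst \<omega>) = s}
      \<inter> {\<omega>. D \<le> card (slots M (phase \<omega>))}) \<le> exp (- (D * ln 2))" (is "measure P ?L \<le> _")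
proof (cases "\<exists>y. itinerary (\<lambda>i. (f ^^ i) -` {x. \<psi> x > 0}) n y = s")
  case False
  then have "?L = {}" by blast
  then show ?thesis by simp
next
  case True
  then obtain y where y: "itinerary (\<lambda>i. (f ^^ i) -` {x. \<psi> x > 0}) n y = s" by blast
  note PD = codedD[OF P]
  interpret prob_space P using probs_onD[OF PD(1)] by auto
  \<comment> \<open>The bits that every coded orbit with the name \<open>s\<close> must show at its
    slots; \<open>y\<close> merely realizes the name.\<close>
  define b where "b i = (\<psi> ((f ^^ (i + k)) y) > 0)" for i
  define Is where "Is = {I \<in> Pow {..<M}. D \<le> card I}"
  let ?S = "\<lambda>I. {\<omega>::'a state. phase \<omega> \<in> {\<theta>. slots M \<theta> = I}}"
  let ?R = "\<lambda>I. ?S I \<inter> {\<omega>. \<forall>i\<in>I. coin \<omega> i = b i}"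
  have Ifin: "finite Is" and Isub: "\<And>I. I \<in> Is \<Longrightarrow> I \<subseteq> {..<M}" unfolding Is_def by auto
  have Ss: "?S I \<in> sets P" if "I \<in> Is" for I
    using slots_borel[OF Isub[OF that]] probs_onD(2)[OF PD(1)] by simp
  have Rs: "?R I \<in> sets P" if "I \<in> Is" for I
  proof -
    have "{\<omega>::'a state. \<forall>i\<in>I. coin \<omega> i = b i} \<in> sets P"
      using borel_open[OF coins_open[of I b]] Isub[OF that] finite_subset probs_onD(2)[OF PD(1)] by blast
    then show ?thesis using Ss[OF that] by (rule sets.Int[rotated])
  qed
  have UR: "(\<Union>I\<in>Is. ?R I) \<in> sets P" using Rs Ifin by (intro sets.finite_UN) auto
  have "measure P ?L \<le> measure P (\<Union>I\<in>Is. ?R I)"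
  proof (rule finite_measure_mono_AE[OF _ UR])
    show "AE \<omega> in P. \<omega> \<in> ?L \<longrightarrow> \<omega> \<in> (\<Union>I\<in>Is. ?R I)"
      using coins_read[OF P]
    proof eventually_elim
      case (elim \<omega>)
      show ?case
      proof
        assume L: "\<omega> \<in> ?L"
        define I where "I = slots M (phase \<omega>)"
        have I: "I \<in> Is" using L unfolding Is_def I_def slots_def by auto
        have "itinerary (\<lambda>i. (f ^^ i) -` {x. \<psi> x > 0}) n (fst \<omega>) = itinerary (\<lambda>i. (f ^^ i) -` {x. \<psi> x > 0}) n y"
          using L y by simp
        then have same: "(\<psi> ((f ^^ i) (fst \<omega>)) > 0) = (\<psi> ((f ^^ i) y) > 0)" if "i < n" for i
          using that unfolding itinerary_eq_iff by simp
        have "coin \<omega> i = b i" if "i \<in> I" for i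
        proof -
          have "i < M" "rot i (phase \<omega>) \<in> good 0" using that unfolding I_def slots_def by auto
          then show ?thesis using elim same[of "i + k"] M unfolding b_def by auto
        qed
        then have "\<omega> \<in> ?R I" unfolding I_def by simp
        then show "\<omega> \<in> (\<Union>I\<in>Is. ?R I)" using I by blast
      qed
    qed
  qed
  also have "\<dots> \<le> (\<Sum>I\<in>Is. measure P (?R I))"
    by (rule finite_measure_subadditive_finite[OF Ifin]) (use Rs in blast)
  also have "\<dots> \<le> (\<Sum>I\<in>Is. exp (- (D * ln 2)) * measure P (?S I))"
  proof (rule sum_mono)
    fix I assume I: "I \<in> Is"
    have "D \<le> card I" using I unfolding Is_def by simp
    then have "(1/2::real) ^ card I \<le> exp (- (D * ln 2))"
      unfolding half_power_exp by (simp add: mult_right_mono)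
    then show "measure P (?R I) \<le> exp (- (D * ln 2)) * measure P (?S I)"
      unfolding slots_coins[OF P Isub[OF I]] by (intro mult_right_mono) auto
  qed
  also have "\<dots> = exp (- (D * ln 2)) * measure P (\<Union>I\<in>Is. ?S I)"
  proof -
    have "measure P (\<Union>I\<in>Is. ?S I) = (\<Sum>I\<in>Is. measure P (?S I))"
    proof (rule finite_measure_finite_Union[OF Ifin])
      show "?S ` Is \<subseteq> events" using Ss by blast
      show "disjoint_family_on ?S Is" unfolding disjoint_family_on_def by auto
    qed
    then show ?thesis by (simp add: sum_distrib_left)
  qed
  also have "\<dots> \<le> exp (- (D * ln 2)) * 1" by (intro mult_left_mono) auto
  finally show ?thesis by simp
qed

text \<open>The projection of an ergodic measure on states inherits invariance and ergodicity, since
  \<open>fst\<close> intertwines \<open>T\<close> with \<open>f\<close>. Support and entropy need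
  the coding.\<close>

theorem exists_ergodic_measure:
  "\<exists>\<mu> :: 'a measure. sets \<mu> = sets borel \<and> prob_space \<mu> \<and> invariant_measure f \<mu> \<and>
     ergodic_measure f \<mu> \<and> ks_entropy \<mu> f > 0 \<and> Y \<subseteq> measure_support \<mu> \<and> integral\<^sup>L \<mu> \<phi> = 0"
proof -
  obtain P where P: "P \<in> coded" and mean: "(\<integral>\<omega>. \<phi> (fst \<omega>) \<partial>P) = 0"
    and erg: "\<And>A. A \<in> sets borel \<Longrightarrow> T -` A = A \<Longrightarrow> measure P A = 0 \<or> measure P A = 1"
    by (rule exists_ergodic_coded) blast
  note PD = codedD[OF P]
  interpret prob_space P using probs_onD[OF PD(1)] by auto
  have fm: "fst \<in> measurable P borel"
    using fst_measurable measurable_cong_sets[OF probs_onD(2)[OF PD(1)] refl] by blast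
  define \<mu> where "\<mu> = distr P borel fst"
  have \<mu>s: "sets \<mu> = sets borel" unfolding \<mu>_def by simp
  have \<mu>p: "prob_space \<mu>" unfolding \<mu>_def by (rule prob_space_distr[OF fm])
  have vb: "fst -` A \<in> sets (borel :: 'a state measure)" if "A \<in> sets borel" for A
    using measurable_sets[OF fst_measurable that] by simp
  have \<mu>m: "measure \<mu> A = measure P (fst -` A)" if "A \<in> sets borel" for A
    unfolding \<mu>_def using measure_distr[OF fm that] probs_onD(4)[OF PD(1)] by simp
  have fT: "T -` (fst -` A) = fst -` (f -` A)" for A unfolding T_def by auto
  have f_meas: "f \<in> borel_measurable borel" using f_cont by (rule borel_measurable_continuous_onI)
  have inv: "invariant_measure f \<mu>"
    unfolding invariant_measure_def
  proof
    fix A :: "'a set" assume A: "A \<in> sets borel"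
    have "f -` A \<in> sets borel" using measurable_sets[OF f_meas A] by simp
    then have "measure \<mu> (f -` A) = measure P (T -` (fst -` A))" unfolding fT by (rule \<mu>m)
    also have "\<dots> = measure P (fst -` A)" using T_pow_invariant(1)[OF PD(1,2) vb[OF A], of 1] by simp
    finally show "measure \<mu> (f -` A) = measure \<mu> A" unfolding \<mu>m[OF A] .
  qed
  have ergodic: "ergodic_measure f \<mu>"
    unfolding ergodic_measure_def
  proof (intro ballI impI)
    fix A :: "'a set" assume A: "A \<in> sets borel" "f -` A = A"
    have "T -` (fst -` A) = fst -` A" unfolding fT A(2) ..
    then show "measure \<mu> A = 0 \<or> measure \<mu> A = 1" unfolding \<mu>m[OF A(1)] by (rule erg[OF vb[OF A(1)]])
  qed
  have "integral\<^sup>L \<mu> \<phi> = 0"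
    unfolding \<mu>_def using integral_distr[OF fm borel_measurable_continuous_onI[OF \<phi>_cont]] mean by simp
  moreover have "Y \<subseteq> measure_support \<mu>"
    unfolding measure_support_def
  proof (intro subsetI CollectI allI impI)
    fix y and e :: real assume y: "y \<in> Y" and e: "e > 0"
    show "emeasure \<mu> (ball y e) > 0"
    proof (rule ccontr)
      assume "\<not> emeasure \<mu> (ball y e) > 0"
      then have "measure \<mu> (ball y e) = 0" by (simp add: measure_def)
      then have z: "measure P (fst -` ball y e) = 0" using \<mu>m[of "ball y e"] by simp
      \<comment> \<open>A null ball is avoided by almost every whole orbit, whereas a good phase at
        a high level forces an approach to \<open>y\<close> by less than \<open>e\<close>.\<close>
      have "AE \<omega> in P. fst ((T ^^ i) \<omega>) \<notin> ball y e" for i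
      proof -
        have b: "fst -` ball y e \<in> sets (borel :: 'a state measure)" by (rule vb) simp
        have "(T ^^ i) -` (fst -` ball y e) \<in> sets P"
          using funpow_vimage_measurable[OF T_measurable b] probs_onD(2)[OF PD(1)] by simp
        then have "(T ^^ i) -` (fst -` ball y e) \<in> null_sets P"
          using T_pow_invariant(1)[OF PD(1,2) b, of i] z by (simp add: null_sets_def emeasure_eq_measure)
        from AE_not_in[OF this] show ?thesis by eventually_elim simp
      qed
      then have far: "AE \<omega> in P. \<forall>i. fst ((T ^^ i) \<omega>) \<notin> ball y e" by (simp only: AE_all_countable) simp
      obtain n0 where n0: "\<And>n. n \<ge> n0 \<Longrightarrow> measure P {\<omega>. phase \<omega> \<in> good n} > 0" by (rule good_pos[OF P]) blast
      obtain n1 :: nat where n1: "1 / real (Suc n1) < e"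
        using reals_Archimedean[OF e] by (auto simp: inverse_eq_divide)
      define n where "n = max n0 n1"
      have "1 / real (Suc n) \<le> 1 / real (Suc n1)" unfolding n_def by (intro divide_left_mono) auto
      then have ne: "1 / real (Suc n) < e" using n1 by linarith
      have "AE \<omega> in P. \<omega> \<notin> {\<omega>. phase \<omega> \<in> good (Suc n)}"
        using far blocks_AE[OF P, of "Suc n"]
      proof eventually_elim
        case (elim \<omega>)
        show ?case
        proof
          assume "\<omega> \<in> {\<omega>. phase \<omega> \<in> good (Suc n)}"
          then have x: "fst \<omega> \<in> closure (W (Suc n) (coin \<omega>))" using elim by simp
          define F where "F = (\<Union>i\<in>{..p (Suc n)}. {x. dist ((f ^^ i) x) y \<le> 1 / Suc n})"
          have "closed F" unfolding F_def
          proof (rule closed_UN)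
            show "\<forall>i\<in>{..p (Suc n)}. closed {x. dist ((f ^^ i) x) y \<le> 1 / real (Suc n)}"
              by (intro ballI closed_Collect_le continuous_on_dist funpow_cont continuous_on_const)
          qed simp
          moreover have "W (Suc n) (coin \<omega>) \<subseteq> F" unfolding F_def using W_dense[OF _ y] by fastforce
          ultimately have "fst \<omega> \<in> F" using x closure_minimal by blast
          then obtain i where "dist ((f ^^ i) (fst \<omega>)) y \<le> 1 / Suc n" unfolding F_def by auto
          then have "fst ((T ^^ i) \<omega>) \<in> ball y e" unfolding fst_T_pow using ne by (simp add: dist_commute)
          then show False using elim by blast
        qed
      qed
      then have "measure P {\<omega>. phase \<omega> \<in> good (Suc n)} = 0"
        using good_borel[of "Suc n"] probs_onD(2)[OF PD(1)]
        by (subst measure_eq_0_null_sets) (auto simp: AE_iff_null_sets)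
      moreover have "n0 \<le> Suc n" unfolding n_def by (intro le_SucI max.cobounded1)
      ultimately show False using n0[of "Suc n"] by simp
    qed
  qed
  moreover have "ks_entropy \<mu> f > 0"
  proof -
    let ?A = "{x. \<psi> x > 0}"
    let ?U = "\<lambda>i. (f ^^ i) -` ?A"
    define d where "d = measure P {\<omega>. phase \<omega> \<in> good 0}"
    have d: "d > 0" unfolding d_def by (rule slot_density_pos[OF P])
    have A: "?A \<in> sets borel"
      by (intro borel_open open_Collect_less continuous_on_const \<psi>_cont)
    have itm: "{x. itinerary ?U n x = s} \<in> sets borel" for n s
      by (rule itinerary_borel) (rule funpow_vimage_measurable[OF f_meas A])
    define G where "G M = {\<omega>::'a state. d * M / 2 \<le> card (slots M (phase \<omega>))}" for M :: nat
    define Q where "Q n s = measure P ({\<omega>. itinerary ?U n (fst \<omega>) = s} \<inter> G (n - k))" for n s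
    \<comment> \<open>Bits show with delay \<open>k\<close>, so only \<open>n - k\<close> times
      count; for \<open>n \<ge> 2 * k + 1\<close> these are at least half of all.\<close>
    have M: "n - k > 0" "n / 2 \<le> real (n - k)" if "n \<ge> Suc (2 * k)" for n
      using that by (auto simp: of_nat_diff)
    have Gb: "G (n - k) \<in> sets borel" "d / 2 \<le> measure P (G (n - k))" if "n \<ge> Suc (2 * k)" for n
      unfolding G_def using many_slots[OF P M(1)[OF that] d_def] by auto
    have iP: "{\<omega>. itinerary ?U n (fst \<omega>) = s} \<in> sets P" for n s
      using vb[OF itm[of n s]] probs_onD(2)[OF PD(1)] by (simp add: vimage_def)
    \<comment> \<open>Both values of the first bit are realized, so \<open>?A\<close> and its
      complement are nonempty.\<close>
    obtain x where "x \<in> W 0 (\<lambda>_. True)" using W_ne by blast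
    from W_coin[OF this] have A_ne: "(f ^^ k) x \<in> ?A" using \<alpha> by simp
    obtain y where "y \<in> W 0 (\<lambda>_. False)" using W_ne by blast
    from W_coin[OF this] have A_un: "(f ^^ k) y \<notin> ?A" using \<alpha> by simp
    show ?thesis
    \<comment> \<open>With at least \<open>d * (n - k) / 2\<close> slots and
      \<open>n - k \<ge> n / 2\<close>, a name carries at least \<open>d * n / 4\<close> independent
      bits; this gives the value of \<open>c\<close>.\<close>
    proof (rule ks_entropy_pos[OF \<mu>p \<mu>s f_meas inv A, where g = "d / 2" and c = "ln 2 * d / 4" and q = Q and ?n0.0 = "Suc (2 * k)"])
      show "?A \<noteq> {}" "?A \<noteq> UNIV" using A_ne A_un by auto
      show "d / 2 > 0" "ln 2 * d / 4 > 0" using d by auto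
      fix n s assume n: "n \<ge> Suc (2 * k)"
      show "0 \<le> Q n s" unfolding Q_def by simp
      have "Q n s \<le> measure P {\<omega>. itinerary ?U n (fst \<omega>) = s}"
        unfolding Q_def using iP by (intro finite_measure_mono) auto
      also have "\<dots> = measure \<mu> {x. itinerary ?U n x = s}" using \<mu>m[OF itm[of n s]] by (simp add: vimage_def)
      finally show "Q n s \<le> measure \<mu> {x. itinerary ?U n x = s}" .
      have "Q n s \<le> exp (- (d * real (n - k) / 2 * ln 2))"
        unfolding Q_def G_def
        by (rule name_bound[OF P, of "n - k" n "d * real (n - k) / 2" s]) (use n d in auto)
      also have "\<dots> \<le> exp (- (ln 2 * d / 4) * n)"
      proof -
        have "ln 2 * d / 2 * (n / 2) \<le> ln 2 * d / 2 * real (n - k)"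
          using M(2)[OF n] d by (intro mult_left_mono) auto
        then show ?thesis by (simp add: field_simps)
      qed
      finally show "Q n s \<le> exp (- (ln 2 * d / 4) * n)" .
    next
      fix n assume n: "n \<ge> Suc (2 * k)"
      have "(\<Sum>s | length s = n. Q n s) = measure P (\<Union>s\<in>{s. length s = n}. {\<omega>. itinerary ?U n (fst \<omega>) = s} \<inter> G (n - k))"
        unfolding Q_def using iP Gb(1)[OF n] probs_onD(2)[OF PD(1)]
        by (intro finite_measure_finite_Union[symmetric] finite_length_bool) (auto simp: disjoint_family_on_def)
      also have "(\<Union>s\<in>{s. length s = n}. {\<omega>. itinerary ?U n (fst \<omega>) = s} \<inter> G (n - k)) = G (n - k)" by auto
      finally show "d / 2 \<le> (\<Sum>s | length s = n. Q n s)" using Gb(2)[OF n] by simp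
    qed
  qed
  ultimately show ?thesis using \<mu>s \<mu>p inv ergodic by blast
qed

end

section \<open>From flip-flops with sojourns to a block system\<close>

theorem theorem8:
  fixes f :: "'a::metric_space \<Rightarrow> 'a" and \<phi> :: "'a \<Rightarrow> real" and Y :: "'a set"
    and k :: nat and Fp Fm :: "'a set set"
  assumes "compact (UNIV :: 'a set)"
    and "compact Y"
    and "\<exists>g. homeomorphism UNIV UNIV f g"
    and "continuous_on UNIV \<phi>"
    and "k \<ge> 1"
    and "flip_flop_family (f ^^ k) (birkhoff_avg f \<phi> k) Fp Fm"
    and "has_sojourns f Y Fp Fm"
  shows "\<exists>\<mu> :: 'a measure. sets \<mu> = sets borel \<and> prob_space \<mu> \<and>
           invariant_measure f \<mu> \<and> ergodic_measure f \<mu> \<and>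
           ks_entropy \<mu> f > 0 \<and> Y \<subseteq> measure_support \<mu> \<and>
           integral\<^sup>L \<mu> \<phi> = 0"
proof -
  have fc: "continuous_on UNIV f" using assms(3) unfolding homeomorphism_def by blast
  have fpc: "continuous_on UNIV (f ^^ n)" for n
  proof (induction n)
    case (Suc n)
    then show ?case unfolding funpow.simps by (intro continuous_on_compose continuous_on_subset[OF fc]) auto
  qed (simp add: id_def)
  have avg_cont: "continuous_on UNIV (birkhoff_avg f \<phi> k)"
    unfolding birkhoff_avg_def
    by (intro continuous_on_mult continuous_on_const continuous_on_sum continuous_on_compose2[OF assms(4) fpc]) auto
  have "bounded (range \<phi>)" using compact_continuous_image[OF assms(4,1)] compact_imp_bounded by auto
  then obtain C where C: "\<And>x. \<bar>\<phi> x\<bar> \<le> C" by (auto simp: bounded_iff)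
  obtain \<alpha> \<zeta> where "\<alpha> > 0 \<and> (\<forall>n. \<zeta> n > (0::real)) \<and> \<zeta> \<longlonglongrightarrow> 0 \<and>
      (\<forall>D\<in>Fp. \<forall>x\<in>D. birkhoff_avg f \<phi> k x > \<alpha>) \<and> (\<forall>D\<in>Fm. \<forall>x\<in>D. birkhoff_avg f \<phi> k x < - \<alpha>) \<and>
      (\<forall>D \<in> Fp \<union> Fm. (\<exists>Dp\<in>Fp. Dp \<subseteq> (f ^^ k) ` D) \<and> (\<exists>Dm\<in>Fm. Dm \<subseteq> (f ^^ k) ` D))"
    using assms(6) unfolding flip_flop_family_def by (elim conjE exE) (rule that, intro conjI, assumption+)
  then have \<alpha>: "\<alpha> > 0" "\<And>D x. D \<in> Fp \<Longrightarrow> x \<in> D \<Longrightarrow> birkhoff_avg f \<phi> k x > \<alpha>"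
    "\<And>D x. D \<in> Fm \<Longrightarrow> x \<in> D \<Longrightarrow> birkhoff_avg f \<phi> k x < - \<alpha>"
    "\<And>D. D \<in> Fp \<union> Fm \<Longrightarrow> \<exists>D'\<in>Fp. D' \<subseteq> (f ^^ k) ` D" "\<And>D. D \<in> Fp \<union> Fm \<Longrightarrow> \<exists>D'\<in>Fm. D' \<subseteq> (f ^^ k) ` D"
    by blast+
  have F: "Fp \<inter> Fm = {}" "Fp \<union> Fm \<noteq> {}" using assms(6) unfolding flip_flop_family_def by auto
  \<comment> \<open>An empty plaque has an empty image, so the empty set would belong to both of the
    disjoint families.\<close>
  have ne: "D \<noteq> {}" if "D \<in> Fp \<union> Fm" for D
  proof
    assume "D = {}"
    then have "{} \<in> Fp" "{} \<in> Fm" using \<alpha>(4,5)[OF that] by auto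
    then show False using F(1) by auto
  qed
  have "\<exists>N. \<forall>D\<in>Fp \<union> Fm. \<exists>Dp Dm. Dp \<subseteq> D \<and> Dm \<subseteq> D \<and>
      (\<forall>x\<in>Dp \<union> Dm. \<forall>y\<in>Y. \<exists>i\<le>N. dist ((f ^^ i) x) y < 1 / real (Suc n)) \<and> (f ^^ N) ` Dp \<in> Fp \<and> (f ^^ N) ` Dm \<in> Fm" for n
  proof -
    have "1 / real (Suc n) > 0" by simp
    moreover obtain \<eta> :: "nat \<Rightarrow> real" where "\<forall>\<delta>>0. \<exists>N. \<forall>D \<in> Fp \<union> Fm. \<exists>Dp Dm. Dp \<subseteq> D \<and> Dm \<subseteq> D \<and>
          (\<forall>x \<in> Dp \<union> Dm. \<forall>y\<in>Y. \<exists>i\<le>N. dist ((f ^^ i) x) y < \<delta>) \<and>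
          (f ^^ N) ` Dp \<in> Fp \<and> (f ^^ N) ` Dm \<in> Fm \<and>
          (\<forall>i\<le>N. diameter ((f ^^ i) -` ((f ^^ N) ` Dp)) \<le> \<eta> i \<and>
                  diameter ((f ^^ i) -` ((f ^^ N) ` Dm)) \<le> \<eta> i)"
      using assms(7) unfolding has_sojourns_def by (elim conjE exE) (rule that)
    ultimately obtain N where N: "\<forall>D \<in> Fp \<union> Fm. \<exists>Dp Dm. Dp \<subseteq> D \<and> Dm \<subseteq> D \<and>
          (\<forall>x \<in> Dp \<union> Dm. \<forall>y\<in>Y. \<exists>i\<le>N. dist ((f ^^ i) x) y < 1 / real (Suc n)) \<and>
          (f ^^ N) ` Dp \<in> Fp \<and> (f ^^ N) ` Dm \<in> Fm \<and>
          (\<forall>i\<le>N. diameter ((f ^^ i) -` ((f ^^ N) ` Dp)) \<le> \<eta> i \<and>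
                  diameter ((f ^^ i) -` ((f ^^ N) ` Dm)) \<le> \<eta> i)" by presburger
    show ?thesis
    proof (intro exI[of _ N] ballI)
      fix D assume "D \<in> Fp \<union> Fm"
      from N[rule_format, OF this] show "\<exists>Dp Dm. Dp \<subseteq> D \<and> Dm \<subseteq> D \<and>
        (\<forall>x\<in>Dp \<union> Dm. \<forall>y\<in>Y. \<exists>i\<le>N. dist ((f ^^ i) x) y < 1 / real (Suc n)) \<and> (f ^^ N) ` Dp \<in> Fp \<and> (f ^^ N) ` Dm \<in> Fm"
        by (elim exE conjE) (intro exI conjI; assumption)
    qed
  qed
  then obtain N where N: "\<And>n. \<forall>D\<in>Fp \<union> Fm. \<exists>Dp Dm. Dp \<subseteq> D \<and> Dm \<subseteq> D \<and>
      (\<forall>x\<in>Dp \<union> Dm. \<forall>y\<in>Y. \<exists>i\<le>N n. dist ((f ^^ i) x) y < 1 / real (Suc n)) \<and>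
      (f ^^ N n) ` Dp \<in> Fp \<and> (f ^^ N n) ` Dm \<in> Fm" by metis
  \<comment> \<open>With \<open>N n = 0\<close> a single plaque would contain nonempty plaques of
    both families and hence take values of both signs.\<close>
  have Npos: "N n > 0" for n
  proof (rule ccontr)
    assume "\<not> N n > 0"
    then have N0: "N n = 0" by simp
    obtain D where D: "D \<in> Fp \<union> Fm" using F(2) by auto
    obtain Dp Dm where pm: "Dp \<subseteq> D" "Dm \<subseteq> D" "(f ^^ N n) ` Dp \<in> Fp" "(f ^^ N n) ` Dm \<in> Fm" using N[of n] D by meson
    then have "Dp \<in> Fp" "Dm \<in> Fm" unfolding N0 by auto
    then obtain x y where "x \<in> Dp" "y \<in> Dm" using ne[of Dp] ne[of Dm] by auto
    then have "birkhoff_avg f \<phi> k x > \<alpha>" "birkhoff_avg f \<phi> k y < - \<alpha>" "x \<in> D" "y \<in> D"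
      using \<alpha>(2)[OF \<open>Dp \<in> Fp\<close>] \<alpha>(3)[OF \<open>Dm \<in> Fm\<close>] pm by auto
    then show False using D \<alpha>(1) \<alpha>(2)[of D y] \<alpha>(3)[of D x] by auto
  qed
  interpret ff: flip_flop_sojourn f \<phi> Y k Fp Fm C \<alpha> N
  proof
    show "k > 0" using assms(5) by simp
    show "\<exists>D'\<subseteq>D. (f ^^ N n) ` D' \<in> Fp \<union> Fm \<and> (\<forall>x\<in>D'. \<forall>y\<in>Y. \<exists>i\<le>N n. dist ((f ^^ i) x) y < 1 / real (Suc n))"
      if D: "D \<in> Fp \<union> Fm" for D n
    proof -
      obtain Dp Dm where pm: "Dp \<subseteq> D" "(f ^^ N n) ` Dp \<in> Fp"
        "\<forall>x\<in>Dp \<union> Dm. \<forall>y\<in>Y. \<exists>i\<le>N n. dist ((f ^^ i) x) y < 1 / real (Suc n)"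
        using bspec[OF N[of n] D] by blast
      show ?thesis
      proof (intro exI[of _ Dp] conjI)
        show "\<forall>x\<in>Dp. \<forall>y\<in>Y. \<exists>i\<le>N n. dist ((f ^^ i) x) y < 1 / real (Suc n)" using pm(3) by blast
      qed (use pm in blast)+
    qed
  qed (use C \<alpha> F(2) ne Npos in auto)
  obtain w q v where w: "w 0 = ff.macro False"
    "\<And>n. w (Suc n) = concat (replicate (q n) (w n)) @ Sojourn n # v n" "\<And>n. q n > 0"
    "\<And>n. ff.wlen (w n) dvd ff.wlen (w (Suc n))" "\<And>n. N n + q n * ff.wlen (w n) \<le> ff.wlen (w (Suc n))"
    "\<And>n. ff.wlen (w n) > 0"
    "\<And>n. ff.mean_upper (w n) \<le> 0" "\<And>n. - ((1/2)^n * ff.wlen (w (Suc n))) \<le> ff.mean_upper (w (Suc n))"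
    "summable (\<lambda>n. 1 - real (q n * ff.wlen (w n)) / ff.wlen (w (Suc n)))"
    by (rule ff.word_hierarchy) blast
  interpret block_system f \<phi> "birkhoff_avg f \<phi> k" Y k \<alpha> "\<lambda>n. ff.wlen (w n)" q "\<lambda>n. ff.followers (w n)"
  proof
    \<comment> \<open>Strictly, because the new word also contains a sojourn of duration
      \<open>N n > 0\<close>.\<close>
    show "ff.wlen (w n) < ff.wlen (w (Suc n))" for n
    proof -
      have "ff.wlen (w n) \<le> q n * ff.wlen (w n)" using w(3)[of n] by (cases "q n") auto
      then show ?thesis using w(5)[of n] Npos[of n] by linarith
    qed
    show "q n * ff.wlen (w n) \<le> ff.wlen (w (Suc n))" for n using w(5)[of n] by linarith
    show "depends_below (ff.wlen (w n)) (ff.followers (w n))" for n by (rule ff.followers_cong)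
    show "(f ^^ (i * ff.wlen (w n))) x \<in> ff.followers (w n) (\<lambda>j. c (j + i * ff.wlen (w n)))"
      if x: "x \<in> ff.followers (w (Suc n)) c" and i: "i < q n" for n c x i
    proof -
      \<comment> \<open>The copies are split around copy number \<open>i\<close>, counted from
        0.\<close>
      have "q n = i + Suc (q n - Suc i)" using i by simp
      then have "replicate (q n) (w n) = replicate i (w n) @ w n # replicate (q n - Suc i) (w n)"
        by (metis replicate_Suc replicate_add)
      then have eq: "w (Suc n) = concat (replicate i (w n)) @ (w n @ (concat (replicate (q n - Suc i) (w n)) @ Sojourn n # v n))"
        unfolding w(2) by simp
      from ff.followers_append(1)[OF ff.followers_append(2)[OF x[unfolded eq]]] show ?thesis by simp
    qed
    show "if c 0 then birkhoff_avg f \<phi> k ((f ^^ k) x) \<ge> \<alpha> else birkhoff_avg f \<phi> k ((f ^^ k) x) \<le> - \<alpha>"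
      if "x \<in> ff.followers (w 0) c" for c x
      using ff.macro_coin[of x False c] that unfolding w(1) by (auto split: if_splits)
    show "\<exists>i\<le>ff.wlen (w (Suc n)). dist ((f ^^ i) x) y \<le> 1 / real (Suc n)"
      if x: "x \<in> ff.followers (w (Suc n)) c" and y: "y \<in> Y" for n c x y
    proof -
      \<comment> \<open>The sojourn responsible for the density is the one right after the copies of
        \<open>w n\<close>.\<close>
      have "(f ^^ (q n * ff.wlen (w n))) x \<in> ff.followers (Sojourn n # v n) (\<lambda>j. c (j + q n * ff.wlen (w n)))"
        using ff.followers_append(2)[OF x[unfolded w(2)]] by simp
      then have "ff.visits (Sojourn n) ((f ^^ (q n * ff.wlen (w n))) x)" unfolding ff.followers_def by auto
      then obtain i where i: "i \<le> N n" "dist ((f ^^ i) ((f ^^ (q n * ff.wlen (w n))) x)) y < 1 / real (Suc n)" using y by auto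
      have "i + q n * ff.wlen (w n) \<le> ff.wlen (w (Suc n))" using i(1) w(5)[of n] by linarith
      moreover have "dist ((f ^^ (i + q n * ff.wlen (w n))) x) y \<le> 1 / real (Suc n)"
        using i(2) by (simp add: funpow_add)
      ultimately show ?thesis by blast
    qed
    show "coin_avg (ff.wlen (w n)) (\<lambda>c. SUP x\<in>ff.followers (w n) c. birkhoff_sum f \<phi> (ff.wlen (w n)) x) \<le> 0" for n
      using w(7)[of n] unfolding ff.mean_upper_def ff.upper_def[abs_def] .
    show "- ((1/2)^n * ff.wlen (w (Suc n))) \<le> coin_avg (ff.wlen (w (Suc n))) (\<lambda>c. SUP x\<in>ff.followers (w (Suc n)) c. birkhoff_sum f \<phi> (ff.wlen (w (Suc n))) x)" for n
      using w(8)[of n] unfolding ff.mean_upper_def ff.upper_def[abs_def] .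
  qed (use assms(1,4) fc avg_cont \<alpha>(1) w ff.followers_nonempty in blast)+
  show ?thesis by (rule exists_ergodic_measure)
qed

end
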